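(* Fix an integer $s\ge1$ and a real $\varepsilon>0$. Then there exists $\delta=\delta(s,\varepsilon)>0$ such that the following holds. Let $p$ be a (sufficiently large) prime and let $N$ be an integer with $$N>p^{14/29+\varepsilon}.$$ For $1\le i\le5$, let $\mathcal M_i\subseteq\mathbb F_p^\ast$ be arbitrary sets with $|\mathcal M_i|=N$ and let $\mathcal X_i=L_i+\{1,\ldots,N\}\subseteq\mathbb F_p^\ast$. For $\lambda\in\mathbb F_p$ let $T_5(\lambda)$ be the number of solutions to $$m_1x_1^{-s}+\cdots+m_5x_5^{-s}\equiv\lambda\pmod p,\qquad m_i\in\mathcal M_i,\ x_i\in\mathcal X_i .$$ Then, uniformly for $\lambda\in\mathbb F_p$, $$T_5(\lambda)=\frac{N^{10}}{p}\left(1+O(p^{-\delta})\right).$$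
   Context: $\mathbb F_p$ is the field of $p$ elements and $\mathbb F_p^\ast=\mathbb F_p\setminus\{0\}$. The set $L+\{1,\ldots,N\}$ is the set of residue classes modulo $p$ of the $N$ consecutive integers $L+1,\ldots,L+N$, none of which is divisible by $p$ when the set lies in $\mathbb F_p^\ast$. $x^{-s}$ denotes the inverse of $x^s$ in $\mathbb F_p^\ast$. The sets $\mathcal M_i$ and the shifts $L_i$ may be different for different $i$. The implied constant in $O(\cdot)$ may depend only on $s$ and $\varepsilon$, and not on $p$, the sets $\mathcal M_i$, the shifts $L_i$, $N$ or $\lambda$. *)

theory Defs
  imports Complex_Main "HOL-Library.FuncSet" "HOL-Number_Theory.Residues"
begin

text \<open>\<open>\<F>\<^sub>p\<close> is the library's \<open>residue_ring (int p)\<close>, whose carrier consists of the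
  representatives \<open>0, \<dots>, p - 1\<close>. It is indexed by a number and not by a type because the
  constants \<open>\<delta>\<close> and \<open>C\<close> have to be chosen before \<open>p\<close>.\<close>

abbreviation Fp :: "nat \<Rightarrow> int ring" where
  "Fp p \<equiv> residue_ring (int p)"

definition Fp_star :: "nat \<Rightarrow> int set" where
  "Fp_star p = carrier (Fp p) - {\<zero>\<^bsub>Fp p\<^esub>}"

definition shifted_interval :: "nat \<Rightarrow> int \<Rightarrow> nat \<Rightarrow> int set" where
  "shifted_interval p L N = (\<lambda>k. (L + k) mod int p) ` {1..int N}"

text \<open>The solutions are pairs of 5-tuples, indexed by \<open>{1..5}\<close>. Being elements of \<open>Pi\<^sub>E\<close>, the
  tuples are fixed outside the index set, so that each solution is counted once.\<close>

definition T5 :: "nat \<Rightarrow> nat \<Rightarrow> (nat \<Rightarrow> int set) \<Rightarrow> (nat \<Rightarrow> int set) \<Rightarrow> int \<Rightarrow> nat" where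
  "T5 p s M X a = card {(m, x).
     m \<in> Pi\<^sub>E {1..5} M \<and> x \<in> Pi\<^sub>E {1..5} X \<and>
     (\<Oplus>\<^bsub>Fp p\<^esub>i\<in>{1..5}. m i \<otimes>\<^bsub>Fp p\<^esub> inv\<^bsub>Fp p\<^esub> (x i [^]\<^bsub>Fp p\<^esub> s)) = a}"

end

theory Submission
  imports Defs "HOL-Analysis.Convex" "HOL-Analysis.Harmonic_Numbers"
    "HOL-Computational_Algebra.Polynomial" "HOL-Real_Asymp.Real_Asymp"
begin

text \<open>
Write \<open>e(k) = exp (2 \<pi> i k / p)\<close> and let \<open>S(b)\<close> be the sum of \<open>e(b m / x ^ s)\<close> over \<open>m \<in> M\<close> and \<open>x\<close> in
an interval. By orthogonality \<open>p T\<^sub>5\<close> is a sum over all frequencies \<open>b\<close> modulo \<open>p\<close> of products of five such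
sums (\<open>T5_formula\<close>). The frequency \<open>0\<close> gives the main term \<open>N ^ 10\<close>, and a product of five numbers is
at most the sum of their fifth powers; hence it suffices to bound the fifth moment of \<open>S\<close> over the
nonzero frequencies by \<open>N ^ 10\<close> times a negative power of \<open>p\<close>. By convexity the interval may be cut
into blocks (\<open>fifth_moment_long_le\<close>), so let its length be \<open>n\<close>, about \<open>p powr (193/400)\<close>: this is a
little below \<open>p powr (14/29)\<close>, and also below the square root of \<open>p\<close>.

The basic tool is a lattice argument (\<open>many_points_small_fraction\<close>): a residue that is the quotient
of two points of such an interval in more than \<open>t\<close> ways is a fraction \<open>a / b\<close> with \<open>a\<close> and \<open>b\<close> of size at
most \<open>n / t\<close>. Products of a few fractions of small height behave modulo \<open>p\<close> as they do in the rational
numbers, so that coincidences between them are counted by the divisor bound.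

Let \<open>\<sigma>(b)\<close> be the size of \<open>S(b)\<close> relative to the number of its terms. Three estimates are combined.

\<^item> Supremum (\<open>norm_bilinear_sum_le\<close>): \<open>\<sigma>(b)\<close> is at most a constant times \<open>p powr (-0.0218)\<close>. Replacing
  \<open>x\<close> by \<open>x + u v\<close> and writing it as \<open>u (x / u + v)\<close> reduces the sum to the sums
  over \<open>v\<close> of \<open>e(A / (B + v) ^ s)\<close>, where the pairs \<open>(A, B)\<close> rarely coincide. The eighth moment of these
  sums over all \<open>A\<close> and \<open>B\<close> is elementary: it counts zeros of polynomials
  of bounded degree (\<open>reciprocal_moment_le\<close>).
\<^item> Large values (\<open>large_values_bound\<close>): if \<open>\<sigma> \<ge> y\<close> on a set of \<open>K\<close> frequencies, and \<open>y\<close> is at least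
  \<open>p powr (-1/10)\<close>, then \<open>y\<close> is at most a constant times \<open>p powr 0.01775 * K powr (-3/8)\<close>. Here
  Cauchy--Schwarz replaces the arbitrary set \<open>M\<close> by all residues and leaves the number of coincidences
  \<open>w / x ^ s = w' / x' ^ s\<close> with frequencies \<open>w\<close> and \<open>w'\<close>, that is, of \<open>w = w' \<rho> ^ s\<close> for the ratios \<open>\<rho>\<close> of
  points of the interval (\<open>energy_le\<close>).
\<^item> Mean square: the squares of \<open>\<sigma>\<close> sum to at most a constant times \<open>p powr 0.299\<close>, by the same count
  of coincidences with \<open>M\<close> as the set.

The mean square handles the frequencies with \<open>\<sigma> < p powr (-1/10)\<close>. Among the others, the \<open>j\<close>-th largest
value satisfies the first bound and, with \<open>K = j\<close>, the second one; the power \<open>7/3\<close> of the first times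
the power \<open>8/3\<close> of the second is a negative power of \<open>p\<close> times \<open>1 / j\<close>, and the sum over \<open>j\<close> costs only
a logarithm (\<open>sum_large_le\<close>).
\<close>

section \<open>Counting pairs\<close>

lemma card_le_fibres:
  assumes "finite S" "finite T" "f ` S \<subseteq> T" "\<And>y. y \<in> T \<Longrightarrow> card {x \<in> S. f x = y} \<le> k"
  shows "card S \<le> card T * k"
proof -
  have "card S = (\<Sum>y\<in>T. card {x \<in> S. f x = y})"
    using sum.group[OF assms(1,2,3), where h = "\<lambda>_. 1::nat"] by simp
  also have "\<dots> \<le> (\<Sum>y\<in>T. k)"
    by (intro sum_mono assms(4))
  finally show ?thesis by simp
qed

text \<open>Cauchy--Schwarz in the form that gets rid of an arbitrary set \<open>A\<close>: once a point of \<open>A\<close> is shared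
by two elements of \<open>B\<close>, it can be eliminated from the two relations.\<close>

lemma card_relation_squared:
  assumes "finite A" "finite B"
  shows "(card {(x, y). x \<in> A \<and> y \<in> B \<and> R x y})\<^sup>2
      \<le> card A * card {(x, y, y'). x \<in> A \<and> y \<in> B \<and> y' \<in> B \<and> R x y \<and> R x y'}"
proof -
  define F where "F x = {y \<in> B. R x y}" for x
  have fin: "finite (F x)" for x using assms by (simp add: F_def)
  have "{(x, y). x \<in> A \<and> y \<in> B \<and> R x y} = Sigma A F" by (auto simp: F_def)
  then have 1: "card {(x, y). x \<in> A \<and> y \<in> B \<and> R x y} = (\<Sum>x\<in>A. card (F x))"
    using fin assms by simp
  have "{(x, y, y'). x \<in> A \<and> y \<in> B \<and> y' \<in> B \<and> R x y \<and> R x y'} = Sigma A (\<lambda>x. F x \<times> F x)"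
    by (auto simp: F_def)
  then have 2: "card {(x, y, y'). x \<in> A \<and> y \<in> B \<and> y' \<in> B \<and> R x y \<and> R x y'}
      = (\<Sum>x\<in>A. (card (F x))\<^sup>2)"
    using fin assms by (simp add: card_cartesian_product power2_eq_square)
  have "(\<Sum>x\<in>A. real (card (F x)))\<^sup>2 \<le> (\<Sum>x\<in>A. (real (card (F x)))\<^sup>2) * card A"
    by (rule sum_squared_le_sum_of_squares)
  then have "real ((\<Sum>x\<in>A. card (F x))\<^sup>2) \<le> real ((\<Sum>x\<in>A. (card (F x))\<^sup>2) * card A)"
    by simp
  then show ?thesis unfolding 1 2 of_nat_le_iff by (simp add: mult.commute)
qed

lemma sum_card_swap:
  assumes "finite A" "finite B"
  shows "(\<Sum>x\<in>A. card {y \<in> B. R x y}) = (\<Sum>y\<in>B. card {x \<in> A. R x y})"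
proof -
  have "(\<Sum>x\<in>A. card {y \<in> B. R x y}) = (\<Sum>x\<in>A. \<Sum>y\<in>B. if R x y then 1 else 0)"
    using assms by (simp add: sum.inter_filter[symmetric])
  also have "\<dots> = (\<Sum>y\<in>B. \<Sum>x\<in>A. if R x y then 1 else 0)" by (rule sum.swap)
  also have "\<dots> = (\<Sum>y\<in>B. card {x \<in> A. R x y})"
    using assms by (simp add: sum.inter_filter[symmetric])
  finally show ?thesis .
qed

section \<open>Additive characters modulo \<open>p\<close>\<close>

definition add_char :: "nat \<Rightarrow> int \<Rightarrow> complex" where
  "add_char p k = cis (2 * pi * real_of_int k / real p)"

lemma norm_add_char [simp]: "norm (add_char p k) = 1"
  by (simp add: add_char_def)

lemma add_char_0 [simp]: "add_char p 0 = 1"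
  by (simp add: add_char_def)

lemma add_char_add: "add_char p (k + l) = add_char p k * add_char p l"
  by (simp add: add_char_def cis_mult ring_distribs add_divide_distrib)

lemma add_char_minus: "add_char p (- k) = cnj (add_char p k)"
  by (simp add: add_char_def cis_cnj)

lemma add_char_diff: "add_char p (k - l) = add_char p k * cnj (add_char p l)"
  using add_char_add[of p k "- l"] by (simp add: add_char_minus)

lemma add_char_sum: "finite I \<Longrightarrow> add_char p (\<Sum>i\<in>I. f i) = (\<Prod>i\<in>I. add_char p (f i))"
  by (induction I rule: finite_induct) (simp_all add: add_char_add)

lemma add_char_mult_nat: "add_char p (int a * k) = add_char p k ^ a"
  by (induction a) (simp_all add: algebra_simps add_char_add)

lemma add_char_multiple: "p > 0 \<Longrightarrow> add_char p (int p * k) = 1"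
  by (simp add: add_char_def cis_multiple_2pi flip: mult.assoc)

lemma add_char_cong:
  assumes "p > 0" "[k = l] (mod int p)"
  shows "add_char p k = add_char p l"
proof -
  obtain q where "k = l + int p * q"
    using assms(2) by (metis cong_iff_lin cong_sym)
  then show ?thesis using assms(1) by (simp add: add_char_add add_char_multiple)
qed

lemma add_char_eq_1_iff:
  assumes "p > 0"
  shows "add_char p k = 1 \<longleftrightarrow> int p dvd k"
proof
  assume "add_char p k = 1"
  then obtain n :: int where "2 * pi * real_of_int k / real p = real_of_int (2 * n) * pi"
    unfolding add_char_def by (auto simp: complex_eq_iff cos_one_2pi_int)
  then have "real_of_int k = real_of_int (n * int p)"
    using assms by (simp add: field_simps)
  then have "k = n * int p" by (simp only: of_int_eq_iff)
  then show "int p dvd k" by simp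
next
  assume "int p dvd k"
  then show "add_char p k = 1" using add_char_multiple[OF assms] by (auto elim: dvdE)
qed

lemma sum_add_char:
  assumes "p > 0"
  shows "(\<Sum>b\<in>{0..<int p}. add_char p (b * k)) = (if int p dvd k then of_nat p else 0)"
proof -
  have "(\<Sum>b\<in>{0..<int p}. add_char p (b * k)) = (\<Sum>b<p. add_char p (int b * k))"
    by (rule sum.reindex_bij_witness[of _ int nat]) auto
  also have "\<dots> = (\<Sum>b<p. add_char p k ^ b)"
    by (simp add: add_char_mult_nat)
  also have "\<dots> = (if int p dvd k then of_nat p else 0)"
  proof (cases "int p dvd k")
    case True
    then have "add_char p k = 1" using add_char_eq_1_iff[OF assms] by blast
    then show ?thesis using True by simp
  next
    case False
    then have "add_char p k \<noteq> 1" using add_char_eq_1_iff[OF assms] by simp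
    moreover have "add_char p k ^ p = 1"
      using add_char_multiple[OF assms, of k] by (simp add: add_char_mult_nat)
    ultimately show ?thesis using False by (simp add: geometric_sum)
  qed
  finally show ?thesis .
qed

text \<open>Expanding the square and summing over the frequency first leaves the pairs of indices with
  equal phases; the coefficients enter only through their size.\<close>

lemma mean_square_le:
  fixes f :: "'i \<Rightarrow> int" and c :: "'i \<Rightarrow> complex"
  assumes p: "p > 0" and I: "finite I" and c: "\<And>i. i \<in> I \<Longrightarrow> norm (c i) \<le> 1"
  shows "(\<Sum>b\<in>{0..<int p}. (norm (\<Sum>i\<in>I. c i * add_char p (b * f i)))\<^sup>2)
    \<le> real p * real (card {(i, j). i \<in> I \<and> j \<in> I \<and> [f i = f j] (mod int p)})"
proof -
  let ?G = "{(i, j). i \<in> I \<and> j \<in> I \<and> [f i = f j] (mod int p)}"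
  have sq: "complex_of_real ((norm (\<Sum>i\<in>I. c i * add_char p (b * f i)))\<^sup>2)
    = (\<Sum>i\<in>I. \<Sum>j\<in>I. c i * cnj (c j) * add_char p (b * (f i - f j)))" for b
    unfolding complex_norm_square
    by (simp add: sum_product add_char_diff right_diff_distrib mult_ac)
  have "complex_of_real (\<Sum>b\<in>{0..<int p}. (norm (\<Sum>i\<in>I. c i * add_char p (b * f i)))\<^sup>2)
    = (\<Sum>b\<in>{0..<int p}. \<Sum>i\<in>I. \<Sum>j\<in>I. c i * cnj (c j) * add_char p (b * (f i - f j)))"
    by (simp add: sq del: of_real_power)
  also have "\<dots> = (\<Sum>i\<in>I. \<Sum>b\<in>{0..<int p}. \<Sum>j\<in>I. c i * cnj (c j) * add_char p (b * (f i - f j)))"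
    by (rule sum.swap)
  also have "\<dots> = (\<Sum>i\<in>I. \<Sum>j\<in>I. \<Sum>b\<in>{0..<int p}. c i * cnj (c j) * add_char p (b * (f i - f j)))"
    by (intro sum.cong refl sum.swap)
  also have "\<dots> = (\<Sum>i\<in>I. \<Sum>j\<in>I. c i * cnj (c j) * (if int p dvd (f i - f j) then of_nat p else 0))"
    by (simp add: sum_add_char[OF p] flip: sum_distrib_left)
  finally have eq: "complex_of_real (\<Sum>b\<in>{0..<int p}. (norm (\<Sum>i\<in>I. c i * add_char p (b * f i)))\<^sup>2)
    = (\<Sum>i\<in>I. \<Sum>j\<in>I. c i * cnj (c j) * (if int p dvd (f i - f j) then of_nat p else 0))" .
  have "(\<Sum>b\<in>{0..<int p}. (norm (\<Sum>i\<in>I. c i * add_char p (b * f i)))\<^sup>2)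
     = norm (complex_of_real (\<Sum>b\<in>{0..<int p}. (norm (\<Sum>i\<in>I. c i * add_char p (b * f i)))\<^sup>2))"
    unfolding norm_of_real by (simp add: sum_nonneg)
  also have "\<dots> \<le> (\<Sum>i\<in>I. \<Sum>j\<in>I. norm (c i * cnj (c j) * (if int p dvd (f i - f j) then of_nat p else 0)))"
    unfolding eq by (intro sum_norm_le order.refl)
  also have "\<dots> \<le> (\<Sum>i\<in>I. \<Sum>j\<in>I. (if int p dvd (f i - f j) then real p else 0))"
    using c by (intro sum_mono) (auto simp: norm_mult intro!: mult_le_one mult_left_le_one_le)
  also have "\<dots> = (\<Sum>(i, j)\<in>I \<times> I. (if int p dvd (f i - f j) then real p else 0))"
    by (simp add: sum.cartesian_product)
  also have "\<dots> = (\<Sum>x\<in>?G. real p)"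
    using I by (intro sum.mono_neutral_cong_right) (auto simp: cong_iff_dvd_diff split: if_splits)
  finally show ?thesis by (simp add: mult.commute)
qed

text \<open>An even power of a modulus is a product of \<open>r\<close> copies of the sum and \<open>r\<close> copies of its conjugate.
Expanded, its phases are the signed sums of \<open>2 * r\<close> values, and the sum over the frequency selects
those that vanish modulo \<open>p\<close>.\<close>

lemma even_moment_eq:
  fixes f :: "int \<Rightarrow> int"
  assumes p: "p > 0" and I: "finite I"
  shows "(\<Sum>b\<in>{0..<int p}. (norm (\<Sum>i\<in>I. add_char p (b * f i))) ^ (2 * r))
    = real p * real (card {g \<in> Pi\<^sub>E {..<2 * r} (\<lambda>_. I).
         int p dvd (\<Sum>k<2 * r. (if k < r then f (g k) else - f (g k)))})"
proof -
  let ?P = "Pi\<^sub>E {..<2 * r} (\<lambda>_. I)"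
  let ?h = "\<lambda>g. (\<Sum>k<2 * r. (if k < r then f (g k) else - f (g k)))"
  have fin: "finite ?P" using I by (intro finite_PiE) auto
  have sq: "complex_of_real ((norm (\<Sum>i\<in>I. add_char p (b * f i))) ^ (2 * r))
    = (\<Sum>g\<in>?P. add_char p (b * ?h g))" for b
  proof -
    let ?z = "\<Sum>i\<in>I. add_char p (b * f i)"
    have "complex_of_real (norm ?z ^ (2 * r)) = (?z * cnj ?z) ^ r"
      using complex_norm_square[of ?z] by (simp add: power_mult)
    also have "\<dots> = (\<Prod>k<2 * r. if k < r then ?z else cnj ?z)"
    proof -
      have "{..<2 * r} = {..<r} \<union> {r..<2 * r}" by auto
      moreover have "(\<Prod>k\<in>{r..<2 * r}. if k < r then ?z else cnj ?z) = (\<Prod>k\<in>{r..<2 * r}. cnj ?z)"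
        by (intro prod.cong) auto
      moreover have "(\<Prod>k\<in>{..<r}. if k < r then ?z else cnj ?z) = (\<Prod>k\<in>{..<r}. ?z)"
        by (intro prod.cong) auto
      ultimately show ?thesis
        by (simp add: prod.union_disjoint ivl_disj_int power_mult_distrib)
    qed
    also have "\<dots> = (\<Prod>k<2 * r. \<Sum>i\<in>I. add_char p (b * (if k < r then f i else - f i)))"
      by (intro prod.cong) (auto simp: add_char_minus)
    also have "\<dots> = (\<Sum>g\<in>?P. \<Prod>k<2 * r. add_char p (b * (if k < r then f (g k) else - f (g k))))"
      using I by (intro prod_sum_PiE) auto
    also have "\<dots> = (\<Sum>g\<in>?P. add_char p (b * ?h g))"
      by (simp add: sum_distrib_left add_char_sum)
    finally show ?thesis .
  qed
  have "complex_of_real (\<Sum>b\<in>{0..<int p}. (norm (\<Sum>i\<in>I. add_char p (b * f i))) ^ (2 * r))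
     = (\<Sum>b\<in>{0..<int p}. \<Sum>g\<in>?P. add_char p (b * ?h g))"
    by (simp add: sq del: of_real_power)
  also have "\<dots> = (\<Sum>g\<in>?P. \<Sum>b\<in>{0..<int p}. add_char p (b * ?h g))"
    by (rule sum.swap)
  also have "\<dots> = (\<Sum>g\<in>?P. if int p dvd ?h g then of_nat p else 0)"
    by (simp add: sum_add_char[OF p])
  also have "\<dots> = (\<Sum>g\<in>{g\<in>?P. int p dvd ?h g}. of_nat p)"
    using fin by (rule sum.inter_filter[symmetric])
  also have "\<dots> = complex_of_real (real p * real (card {g\<in>?P. int p dvd ?h g}))"
    by simp
  finally show ?thesis by (simp only: of_real_eq_iff)
qed

section \<open>Polynomials and powers modulo \<open>p\<close>\<close>

text \<open>Split off a linear factor for each root. Nontriviality modulo \<open>p\<close> is expressed by a value that \<open>p\<close>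
does not divide, since this passes to the quotient by a linear factor.\<close>

lemma card_poly_roots_mod_prime_le:
  fixes f :: "int poly"
  assumes p: "prime p" and nz: "\<not> int p dvd poly f z0"
  shows "card {z \<in> {0..<int p}. int p dvd poly f z} \<le> degree f"
  using nz
proof (induction "degree f" arbitrary: f)
  case 0
  then obtain c where "f = [:c:]" by (metis degree_eq_zeroE)
  then show ?case using 0 by simp
next
  case (Suc d)
  let ?Z = "\<lambda>f. {z \<in> {0..<int p}. int p dvd poly f z}"
  show ?case
  proof (cases "?Z f = {}")
    case False
    then obtain r where r: "r \<in> {0..<int p}" "int p dvd poly f r" by blast
    define q where "q = synthetic_div f r"
    have dq: "degree q = d" using Suc by (simp add: q_def degree_synthetic_div)
    have f: "poly f z = (z - r) * poly q z + poly f r" for z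
    proof -
      have "poly (f + smult r q) z = poly (pCons (poly f r) q) z"
        using synthetic_div_correct[of f r] by (simp add: q_def)
      then show ?thesis by (simp add: algebra_simps)
    qed
    have "\<not> int p dvd poly q z0"
      using Suc.prems f[of z0] r(2) by (metis dvd_add dvd_mult)
    then have IH: "card (?Z q) \<le> d" using Suc.hyps(1)[of q] dq by simp
    have pp: "prime (int p)" using p by simp
    have "?Z f \<subseteq> insert r (?Z q)"
    proof
      fix z assume z: "z \<in> ?Z f"
      then have "int p dvd (z - r) * poly q z"
        using f[of z] r(2) by (simp add: dvd_add_left_iff)
      then have "int p dvd z - r \<or> int p dvd poly q z"
        using pp by (simp add: prime_dvd_mult_iff)
      moreover have "z = r" if "int p dvd z - r"
      proof -
        have "z mod int p = r mod int p" using that by (simp add: mod_eq_dvd_iff)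
        then show ?thesis using z r by simp
      qed
      ultimately show "z \<in> insert r (?Z q)" using z by auto
    qed
    then have "card (?Z f) \<le> card (insert r (?Z q))"
      by (intro card_mono) (auto intro: finite_subset[of _ "{0..<int p}"])
    also have "\<dots> \<le> Suc (card (?Z q))" 
 by (rule card_insert_le_m1) auto
    finally show ?thesis using IH Suc.hyps(2) by simp
  next
    case True
    then show ?thesis by (simp only: card.empty)
  qed
qed

lemma card_power_residues_le:
  assumes p: "prime p" and s: "s > 0"
  shows "card {z \<in> {0..<int p}. [z ^ s = c] (mod int p)} \<le> s"
proof -
  have p1: "p > 1" using p prime_gt_1_nat by blast
  let ?A = "{x\<in>{..<p}. [x ^ s = nat (c mod int p)] (mod p)}"
  have "{z \<in> {0..<int p}. [z ^ s = c] (mod int p)} \<subseteq> int ` ?A"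
  proof
    fix z assume z: "z \<in> {z \<in> {0..<int p}. [z ^ s = c] (mod int p)}"
    then have "[int (nat z ^ s) = int (nat (c mod int p))] (mod int p)"
      using p1 by (simp add: Cong.cong_def)
    then have "nat z \<in> ?A" using z unfolding cong_int_iff by auto
    then show "z \<in> int ` ?A" using z by (intro image_eqI[of _ _ "nat z"]) auto
  qed
  then have "card {z \<in> {0..<int p}. [z ^ s = c] (mod int p)} \<le> card (int ` ?A)"
    by (intro card_mono) auto
  also have "\<dots> \<le> card ?A" by (rule card_image_le) auto
  also have "\<dots> \<le> s" by (rule roots_mod_prime_bound[OF p s])
  finally show ?thesis .
qed

section \<open>The divisor bound\<close>

lemma card_divisors_prime_power_mult:
  assumes q: "prime (q::nat)" and m: "\<not> q dvd m"
  shows "card {d. d dvd q ^ e * m} \<le> (e + 1) * card {d. d dvd m}"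
proof -
  have m0: "m > 0" using m by (cases m) auto
  have "{d. d dvd q ^ e * m} \<subseteq> (\<lambda>(i, d). q ^ i * d) ` ({..e} \<times> {d. d dvd m})"
  proof
    fix d assume "d \<in> {d. d dvd q ^ e * m}"
    then obtain a b where ab: "d = a * b" "a dvd q ^ e" "b dvd m"
      using division_decomp[of d "q ^ e" m] by blast
    then obtain i where "i \<le> e" "a = q ^ i"
      using divides_primepow_nat[OF q] by blast
    then show "d \<in> (\<lambda>(i, d). q ^ i * d) ` ({..e} \<times> {d. d dvd m})"
      using ab by (intro image_eqI[of _ _ "(i, b)"]) auto
  qed
  then have "card {d. d dvd q ^ e * m} \<le> card ((\<lambda>(i, d). q ^ i * d) ` ({..e} \<times> {d. d dvd m}))"
    using m0 by (intro card_mono) auto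
  also have "\<dots> \<le> card ({..e} \<times> {d. d dvd m})"
    using m0 by (intro card_image_le) auto
  finally show ?thesis by (simp add: card_cartesian_product)
qed

text \<open>A prime \<open>q\<close> with \<open>q powr \<eta> \<ge> 2\<close> contributes the factor \<open>e + 1 \<le> 2 ^ e \<le> (q ^ e) powr \<eta>\<close>, so
  only the boundedly many smaller primes can produce a constant, and each of them at most the
  factor \<open>K\<close>.\<close>

lemma card_divisors_le_powr:
  fixes \<eta> :: real
  assumes \<eta>: "\<eta> > 0"
  obtains C :: real where "C \<ge> 1" "\<And>n. n > 0 \<Longrightarrow> real (card {d. d dvd n}) \<le> C * real n powr \<eta>"
proof -
  define Q where "Q = (2::real) powr (1 / \<eta>)"
  \<comment> \<open>chosen so that \<open>e + 1 \<le> K * (1 + ln 2 * \<eta> * e) \<le> K * 2 powr (\<eta> * e)\<close>\<close>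
  define K where "K = 1 + 1 / (\<eta> * ln 2)"
  have K1: "K \<ge> 1" using \<eta> by (simp add: K_def)
  define small where "small = (\<lambda>n. {q. prime q \<and> real q < Q \<and> q dvd (n::nat)})"
  have fin_small: "finite (small n)" for n
    by (rule finite_subset[of _ "{..nat \<lceil>Q\<rceil>}"]) (auto simp: small_def le_nat_iff, linarith)
  have main: "n > 0 \<Longrightarrow> real (card {d. d dvd n}) \<le> K ^ card (small n) * real n powr \<eta>" for n
  proof (induction n rule: less_induct)
    case (less n)
    show ?case
    proof (cases "n = 1")
      case True
      then have "small n = {}" by (auto simp: small_def)
      then show ?thesis using True by simp
    next
      case False
      then obtain q where q: "prime q" "q dvd n" using prime_factor_nat by blast
      define e where "e = multiplicity q n"
      obtain m where m: "n = q ^ e * m" "\<not> q dvd m"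
        using multiplicity_decompose'[of n q] less.prems q unfolding e_def
        by (metis dvd_0_right multiplicity_decompose' not_prime_unit gr_implies_not0)
      have q2: "q \<ge> 2" using q prime_ge_2_nat by blast
      have e1: "e \<ge> 1" unfolding e_def
        by (rule multiplicity_geI) (use q less.prems in auto)
      have m0: "m > 0" using m less.prems by (cases m) auto
      have "m < n"
      proof -
        have "1 < q ^ e" using q2 e1 by (intro one_less_power) auto
        then show ?thesis using m0 m(1) by simp
      qed
      then have IH: "real (card {d. d dvd m}) \<le> K ^ card (small m) * real m powr \<eta>"
        using less.IH m0 by blast
      have eq: "real n powr \<eta> = real q powr (\<eta> * e) * real m powr \<eta>"
        using q2 by (simp add: m powr_mult powr_powr mult.commute flip: powr_realpow)
      have sub: "small m \<subseteq> small n" using m by (auto simp: small_def)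
      have "real (e + 1) * K ^ card (small m) \<le> K ^ card (small n) * real q powr (\<eta> * e)"
      proof (cases "real q < Q")
        case True
        have "q \<in> small n - small m" using q m True by (auto simp: small_def)
        then have "small m \<subset> small n" using sub by blast
        then have "card (small m) + 1 \<le> card (small n)"
          using psubset_card_mono[OF fin_small] by (simp add: Suc_leI)
        then have 1: "K ^ (card (small m) + 1) \<le> K ^ card (small n)"
          using K1 by (rule power_increasing)
        have "ln 2 * (\<eta> * e) + 1 \<le> exp (ln 2 * (\<eta> * e))"
          using exp_ge_add_one_self[of "ln 2 * (\<eta> * e)"] by linarith
        also have "\<dots> = 2 powr (\<eta> * e)" by (simp add: powr_def mult.commute)
        also have "\<dots> \<le> real q powr (\<eta> * e)" using q2 \<eta> by (intro powr_mono2) auto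
        finally have a: "ln 2 * \<eta> * e + 1 \<le> real q powr (\<eta> * e)" by (simp add: mult_ac)
        have "real (e + 1) \<le> K * (ln 2 * \<eta> * e + 1)"
          using \<eta> by (simp add: K_def field_simps)
        also have "\<dots> \<le> K * real q powr (\<eta> * e)"
          using a K1 by (intro mult_left_mono) auto
        finally have "real (e + 1) * K ^ card (small m) \<le> K * real q powr (\<eta> * e) * K ^ card (small m)"
          using K1 by (intro mult_right_mono) auto
        also have "\<dots> = K ^ (card (small m) + 1) * real q powr (\<eta> * e)" by simp
        also have "\<dots> \<le> K ^ card (small n) * real q powr (\<eta> * e)"
          using 1 by (intro mult_right_mono) auto
        finally show ?thesis .
      next
        case False
        have "2 = Q powr \<eta>" using \<eta> by (simp add: Q_def powr_powr)
        also have "\<dots> \<le> real q powr \<eta>" using False \<eta> by (intro powr_mono2) (auto simp: Q_def)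
        finally have "2 ^ e \<le> (real q powr \<eta>) ^ e" by (intro power_mono) auto
        also have "\<dots> = real q powr (\<eta> * e)" using q2 by (simp add: powr_powr flip: powr_realpow)
        finally have a: "2 ^ e \<le> real q powr (\<eta> * e)" .
        have "e + 1 \<le> 2 ^ e" by (simp add: Suc_leI less_exp)
        then have "real (e + 1) \<le> real (2 ^ e)" by (simp only: of_nat_le_iff)
        then have b: "real (e + 1) \<le> real q powr (\<eta> * e)" using a by simp
        have "K ^ card (small m) \<le> K ^ card (small n)"
          using K1 card_mono[OF fin_small sub] by (intro power_increasing)
        then have "real (e + 1) * K ^ card (small m) \<le> real q powr (\<eta> * e) * K ^ card (small n)"
          using b K1 by (intro mult_mono) auto
        then show ?thesis by (simp add: mult.commute)
      qed
      then have step: "real (e + 1) * K ^ card (small m) * real m powr \<eta>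
          \<le> K ^ card (small n) * real q powr (\<eta> * e) * real m powr \<eta>"
        by (intro mult_right_mono) auto
      have "real (card {d. d dvd n}) \<le> real ((e + 1) * card {d. d dvd m})"
        using card_divisors_prime_power_mult[OF q(1) m(2), of e] m(1) by (simp only: of_nat_le_iff)
      also have "\<dots> = real (e + 1) * real (card {d. d dvd m})" by (simp only: of_nat_mult)
      also have "\<dots> \<le> real (e + 1) * (K ^ card (small m) * real m powr \<eta>)"
        using IH by (intro mult_left_mono) auto
      finally show ?thesis using step eq by (simp add: mult_ac)
    qed
  qed
  define C where "C = K ^ nat \<lceil>Q\<rceil>"
  show ?thesis
  proof
    show "C \<ge> 1" using K1 by (simp add: C_def)
    fix n :: nat assume n: "n > 0"
    have "small n \<subseteq> {1..nat \<lceil>Q\<rceil>}"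
    proof
      fix q assume "q \<in> small n"
      then have "prime q" "real q < Q" by (auto simp: small_def)
      then have "q \<ge> 1" "int q \<le> \<lceil>Q\<rceil>" using prime_ge_1_nat by (auto, linarith)
      then show "q \<in> {1..nat \<lceil>Q\<rceil>}" by auto
    qed
    then have "card (small n) \<le> nat \<lceil>Q\<rceil>"
      using card_mono[of "{1..nat \<lceil>Q\<rceil>}" "small n"] by simp
    then have "K ^ card (small n) \<le> C" unfolding C_def using K1 by (intro power_increasing)
    then have "K ^ card (small n) * real n powr \<eta> \<le> C * real n powr \<eta>"
      by (intro mult_right_mono) auto
    then show "real (card {d. d dvd n}) \<le> C * real n powr \<eta>" using main[OF n] by linarith
  qed
qed

lemma card_int_divisors_le:
  fixes k :: int
  assumes "k \<noteq> 0"
  shows "finite {d. d dvd k}" "card {d. d dvd k} \<le> 2 * card {d. d dvd nat \<bar>k\<bar>}"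
proof -
  let ?D = "{d. d dvd nat \<bar>k\<bar>}"
  have fin: "finite ?D" using assms by (intro finite_divisors_nat) simp
  have sub: "{d. d dvd k} \<subseteq> int ` ?D \<union> (\<lambda>d. - int d) ` ?D"
  proof
    fix d assume "d \<in> {d. d dvd k}"
    then have d: "nat \<bar>d\<bar> \<in> ?D" by (simp add: nat_dvd_iff) 
    consider "d = int (nat \<bar>d\<bar>)" | "d = - int (nat \<bar>d\<bar>)" by linarith
    then show "d \<in> int ` ?D \<union> (\<lambda>d. - int d) ` ?D"
      using d by cases (metis UnI1 imageI, metis (mono_tags, lifting) UnI2 imageI)
  qed
  show "finite {d. d dvd k}" using assms by simp
  have "card {d. d dvd k} \<le> card (int ` ?D \<union> (\<lambda>d. - int d) ` ?D)"
    using fin sub by (intro card_mono) auto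
  also have "\<dots> \<le> card (int ` ?D) + card ((\<lambda>d. - int d) ` ?D)" by (rule card_Un_le)
  also have "\<dots> \<le> card ?D + card ?D" by (intro add_mono card_image_le fin)
  finally show "card {d. d dvd k} \<le> 2 * card ?D" by simp
qed

lemma card_quadruples_with_product_le:
  fixes A :: int
  assumes "A \<noteq> 0" and D: "card {d. d dvd A} \<le> k"
  shows "card {(a, b, c, d). a * b * c * d = A} \<le> k ^ 4"
proof -
  let ?D = "{d. d dvd A}"
  have fin: "finite ?D" using card_int_divisors_le(1)[OF assms(1)] .
  have "{(a, b, c, d). a * b * c * d = A} \<subseteq> ?D \<times> ?D \<times> ?D \<times> ?D"
    by auto
  then have "card {(a, b, c, d). a * b * c * d = A} \<le> card (?D \<times> ?D \<times> ?D \<times> ?D)"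
    using fin by (intro card_mono) auto
  also have "\<dots> = card ?D ^ 4" by (simp add: card_cartesian_product power4_eq_xxxx)
  also have "\<dots> \<le> k ^ 4" using D by (rule power_mono) simp
  finally show ?thesis .
qed

section \<open>Ratios of two points of a short interval\<close>

text \<open>The nonzero residues that are fractions of height at most \<open>h\<close>.\<close>

definition small_fractions :: "nat \<Rightarrow> nat \<Rightarrow> int set" where
  "small_fractions p h = {\<rho> \<in> {1..<int p}. \<exists>a b. a \<noteq> 0 \<and> b \<noteq> 0 \<and>
     \<bar>a\<bar> \<le> int h \<and> \<bar>b\<bar> \<le> int h \<and> [a = \<rho> * b] (mod int p)}"

definition ratio_count :: "nat \<Rightarrow> int \<Rightarrow> nat \<Rightarrow> int \<Rightarrow> nat" where
  "ratio_count p L n \<rho> =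
     card {(x, y). x \<in> {L+1..L+int n} \<and> y \<in> {L+1..L+int n} \<and> [x = \<rho> * y] (mod int p)}"

lemma small_fractions_subset: "small_fractions p h \<subseteq> {1..<int p}"
  by (auto simp: small_fractions_def)

lemma finite_small_fractions: "finite (small_fractions p h)"
  by (rule finite_subset[OF small_fractions_subset]) simp

text \<open>The pairs \<open>(x, y)\<close> with \<open>x = \<rho> * y\<close> lie in a square of side \<open>n\<close>, and any two of their differences
span a parallelogram whose area is divisible by \<open>p\<close>, but smaller than \<open>p\<close>. So all of them lie on one
line. If \<open>(a, b)\<close> is the difference with the least \<open>b > 0\<close>, then the more than \<open>t\<close> points spread over at
least \<open>t\<close> such steps in both coordinates.\<close>

lemma many_points_small_fraction:
  assumes p: "prime p" and n: "2 * n\<^sup>2 < p" and \<rho>: "\<rho> \<in> {1..<int p}"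
    and t: "t \<ge> 1" "t < ratio_count p L n \<rho>"
  shows "\<rho> \<in> small_fractions p (n div t)"
proof -
  let ?I = "{L+1..L+int n}"
  let ?P = "{(x, y). x \<in> ?I \<and> y \<in> ?I \<and> [x = \<rho> * y] (mod int p)}"
  have finP: "finite ?P" by (rule finite_subset[of _ "?I \<times> ?I"]) auto
  have pp: "prime (int p)" using p by simp
  have np: "int n < int p"
    using n by (smt (verit) of_nat_less_iff power2_nat_le_imp_le less_le_not_le nat_le_linear mult_2 trans_le_add1)
  \<comment> \<open>as \<open>n < p\<close>, a point is determined by its second coordinate\<close>
  have inj: "inj_on snd ?P"
  proof (rule inj_onI, clarsimp)
    fix x x' y assume "L + 1 \<le> x" "x \<le> L + int n" "L + 1 \<le> x'" "x' \<le> L + int n"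
      and c: "[x = \<rho> * y] (mod int p)" "[x' = \<rho> * y] (mod int p)"
    moreover have "int p dvd x - x'"
      using cong_trans[OF c(1) cong_sym[OF c(2)]] by (simp add: cong_iff_dvd_diff)
    ultimately show "x = x'"
      using np zdvd_imp_le[of "int p" "\<bar>x - x'\<bar>"] by (cases "x = x'") auto
  qed
  define Y where "Y = snd ` ?P"
  have finY: "finite Y" using finP by (simp add: Y_def)
  have cY: "card Y > t" using t inj by (simp add: Y_def card_image ratio_count_def)
  define B where "B = {b. b > 0 \<and> (\<exists>y\<in>Y. \<exists>y'\<in>Y. b = y' - y)}"
  have finB: "finite B"
    by (rule finite_subset[of _ "(\<lambda>(y, y'). y' - y) ` (Y \<times> Y)"]) (use finY in \<open>auto simp: B_def\<close>)
  define y1 where "y1 = Min Y"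
  define y2 where "y2 = Max Y"
  have Yne: "Y \<noteq> {}" using cY by auto
  have y12: "y1 \<in> Y" "y2 \<in> Y" using finY Yne by (auto simp: y1_def y2_def)
  have Yb: "y1 \<le> y" "y \<le> y2" if "y \<in> Y" for y using that finY by (auto simp: y1_def y2_def)
  have "y1 \<noteq> y2"
  proof
    assume "y1 = y2"
    then have "Y \<subseteq> {y1}" using Yb by fastforce
    then have "card Y \<le> card {y1}" by (intro card_mono) auto
    then show False using cY t by simp
  qed
  then have "y2 - y1 \<in> B" using y12 Yb(1)[OF y12(2)] by (auto simp: B_def)
  then have Bne: "B \<noteq> {}" by blast
  define b where "b = Min B"
  have bB: "b \<in> B" using finB Bne by (simp add: b_def)
  have bmin: "b \<le> b'" if "b' \<in> B" for b' using that finB by (simp add: b_def)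
  have b0: "b > 0" using bB by (simp add: B_def)
  obtain z1 z2 where z: "z1 \<in> Y" "z2 \<in> Y" "b = z2 - z1" using bB by (auto simp: B_def)
  obtain w1 where w1: "(w1, z1) \<in> ?P" using z(1) by (auto simp: Y_def)
  obtain w2 where w2: "(w2, z2) \<in> ?P" using z(2) by (auto simp: Y_def)
  define a where "a = w2 - w1"
  have ab: "[a = \<rho> * b] (mod int p)"
    using w1 w2 unfolding a_def z(3) right_diff_distrib by (auto intro: cong_diff)
  have bn: "b < int n" using w1 w2 z(3) by auto
  have an: "\<bar>a\<bar> < int n" using w1 w2 by (auto simp: a_def)
  have a0: "a \<noteq> 0"
  proof
    assume "a = 0"
    then have "int p dvd \<rho> * b" using ab by (metis cong_0_iff cong_sym)
    then have "int p dvd \<rho> \<or> int p dvd b" using pp by (simp add: prime_dvd_mult_iff)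
    then show False using \<rho> b0 bn np zdvd_imp_le[of "int p" \<rho>] zdvd_imp_le[of "int p" b] by auto
  qed
  obtain x1 where x1: "(x1, y1) \<in> ?P" using y12(1) by (auto simp: Y_def)
  obtain x2 where x2: "(x2, y2) \<in> ?P" using y12(2) by (auto simp: Y_def)
  define a' where "a' = x2 - x1"
  define b' where "b' = y2 - y1"
  have ab': "[a' = \<rho> * b'] (mod int p)"
    using x1 x2 unfolding a'_def b'_def right_diff_distrib by (auto intro: cong_diff)
  have b'n: "b' < int n" "b' \<ge> 0" using x1 x2 Yb(1)[OF y12(2)] by (auto simp: b'_def)
  have a'n: "\<bar>a'\<bar> < int n" using x1 x2 by (auto simp: a'_def)
  have collinear: "a' * b = a * b'"
  proof (rule ccontr)
    assume ne: "a' * b \<noteq> a * b'"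
    have "[a' * b = \<rho> * b' * b] (mod int p)" using ab' by (rule cong_scalar_right)
    moreover have "[a * b' = \<rho> * b * b'] (mod int p)" using ab by (rule cong_scalar_right)
    ultimately have "[a' * b = a * b'] (mod int p)"
      by (metis cong_sym cong_trans mult.assoc mult.commute)
    then have "int p dvd \<bar>a' * b - a * b'\<bar>" by (simp add: cong_iff_dvd_diff)
    then have "int p \<le> \<bar>a' * b - a * b'\<bar>" using ne by (intro zdvd_imp_le) auto
    also have "\<dots> \<le> \<bar>a'\<bar> * \<bar>b\<bar> + \<bar>a\<bar> * \<bar>b'\<bar>"
      using abs_triangle_ineq4[of "a' * b" "a * b'"] by (simp add: abs_mult)
    also have "\<dots> \<le> int n * int n + int n * int n"
      using a'n b'n an bn b0 by (intro add_mono mult_mono) auto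
    also have "\<dots> = int (2 * n\<^sup>2)" by (simp add: power2_eq_square)
    also have "\<dots> < int p" using n by (simp only: of_nat_less_iff)
    finally show False by simp
  qed
  have spread: "int t * b \<le> b'"
  proof -
    have "inj_on (\<lambda>y. (y - y1) div b) Y"
    proof (rule inj_onI)
      fix y y' assume y: "y \<in> Y" "y' \<in> Y" and eq: "(y - y1) div b = (y' - y1) div b"
      have "\<bar>y - y'\<bar> < b"
      proof -
        have "(y - y1) - (y' - y1) = (y - y1) mod b - (y' - y1) mod b"
          using eq by (metis add_diff_cancel_left mult_div_mod_eq)
        then have "y - y' = (y - y1) mod b - (y' - y1) mod b" by simp
        moreover have "0 \<le> (y - y1) mod b" "(y - y1) mod b < b" "0 \<le> (y' - y1) mod b" "(y' - y1) mod b < b"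
          using b0 by auto
        ultimately show ?thesis by linarith
      qed
      moreover have "y - y' \<in> B" if "y > y'" using that y by (auto simp: B_def)
      moreover have "y' - y \<in> B" if "y < y'" using that y by (auto simp: B_def)
      ultimately show "y = y'" using bmin[of "y - y'"] bmin[of "y' - y"] by linarith
    qed
    moreover have "(\<lambda>y. (y - y1) div b) ` Y \<subseteq> {0..b' div b}"
      using Yb b0 by (auto simp: b'_def pos_imp_zdiv_nonneg_iff intro!: zdiv_mono1)
    ultimately have "card Y \<le> card {0..b' div b}" by (intro card_inj_on_le) auto
    then have "int t \<le> b' div b" using cY b'n b0 by (auto simp: pos_imp_zdiv_nonneg_iff)
    then have "int t * b \<le> b' div b * b" using b0 by (intro mult_right_mono) auto
    also have "\<dots> \<le> b'" using b0 by (metis div_mult_mod_eq le_add_same_cancel1 pos_mod_sign)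
    finally show ?thesis .
  qed
  have "int t * \<bar>a\<bar> * b \<le> \<bar>a\<bar> * b'"
    using spread mult_left_mono[OF spread, of "\<bar>a\<bar>"] by (simp add: mult_ac)
  also have "\<dots> = \<bar>a'\<bar> * b"
    using collinear b0 b'n by (metis abs_mult abs_of_nonneg abs_of_pos)
  finally have "int t * \<bar>a\<bar> \<le> \<bar>a'\<bar>" using b0 by simp
  then have 1: "int t * \<bar>a\<bar> \<le> int n" using a'n by simp
  have 2: "int t * b \<le> int n" using spread b'n by simp
  have div: "x \<le> int (n div t)" if "int t * x \<le> int n" for x
    proof -
    have "x = int t * x div int t" using t(1) by simp
    also have "\<dots> \<le> int n div int t" using that t(1) by (intro zdiv_mono1) auto
    finally show ?thesis by (simp only: zdiv_int)
  qed
  have "\<bar>a\<bar> \<le> int (n div t)" "\<bar>b\<bar> \<le> int (n div t)"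
    using div[OF 1] div[OF 2] b0 by simp_all
  moreover have "b \<noteq> 0" using b0 by simp
  ultimately have "\<exists>a b. a \<noteq> 0 \<and> b \<noteq> 0 \<and> \<bar>a\<bar> \<le> int (n div t) \<and> \<bar>b\<bar> \<le> int (n div t)
      \<and> [a = \<rho> * b] (mod int p)"
    using a0 ab by (intro exI[of _ a] exI[of _ b] conjI)
  then show ?thesis using \<rho> unfolding small_fractions_def by (intro CollectI conjI)
qed

text \<open>Write a ratio count as the number of the \<open>t\<close> that it exceeds.\<close>

lemma sum_ratio_count_le:
  fixes R :: "int \<Rightarrow> nat"
  assumes p: "prime p" and n: "2 * n\<^sup>2 < p"
  shows "(\<Sum>\<rho>\<in>{1..<int p}. ratio_count p L n \<rho> * R \<rho>)
    \<le> (\<Sum>\<rho>\<in>{1..<int p}. R \<rho>) + (\<Sum>t\<in>{1..n}. \<Sum>\<rho>\<in>small_fractions p (n div t). R \<rho>)"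
proof -
  have le: "ratio_count p L n \<rho> \<le> 1 + card {t \<in> {1..n}. \<rho> \<in> small_fractions p (n div t)}"
    if \<rho>: "\<rho> \<in> {1..<int p}" for \<rho>
  proof -
    let ?r = "ratio_count p L n \<rho>"
    have A: "t \<in> {t \<in> {1..n}. \<rho> \<in> small_fractions p (n div t)}" if t: "t \<in> {1..<?r}" for t
    proof -
      have "\<rho> \<in> small_fractions p (n div t)"
        using many_points_small_fraction[OF p n \<rho>, of t L] t by simp
      moreover from this have "n div t \<noteq> 0" by (auto simp: small_fractions_def)
      then have "t \<le> n" by (metis div_less not_less)
      ultimately show ?thesis using t by simp
    qed
    have "card {1..<?r} \<le> card {t \<in> {1..n}. \<rho> \<in> small_fractions p (n div t)}"
      using A by (intro card_mono) auto
    then show ?thesis by simp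
  qed
  have "(\<Sum>\<rho>\<in>{1..<int p}. ratio_count p L n \<rho> * R \<rho>)
    \<le> (\<Sum>\<rho>\<in>{1..<int p}. (1 + card {t \<in> {1..n}. \<rho> \<in> small_fractions p (n div t)}) * R \<rho>)"
    using le by (intro sum_mono mult_right_mono) auto
  also have "\<dots> = (\<Sum>\<rho>\<in>{1..<int p}. R \<rho>)
     + (\<Sum>\<rho>\<in>{1..<int p}. \<Sum>t\<in>{1..n}. if \<rho> \<in> small_fractions p (n div t) then R \<rho> else 0)"
    by (simp add: ring_distribs sum.distrib flip: sum.inter_filter)
  also have "(\<Sum>\<rho>\<in>{1..<int p}. \<Sum>t\<in>{1..n}. if \<rho> \<in> small_fractions p (n div t) then R \<rho> else 0)
     = (\<Sum>t\<in>{1..n}. \<Sum>\<rho>\<in>{1..<int p}. if \<rho> \<in> small_fractions p (n div t) then R \<rho> else 0)"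
    by (rule sum.swap)
  also have "\<dots> = (\<Sum>t\<in>{1..n}. \<Sum>\<rho>\<in>small_fractions p (n div t). R \<rho>)"
  proof (rule sum.cong[OF refl])
    fix t
    have "{\<rho> \<in> {1..<int p}. \<rho> \<in> small_fractions p (n div t)} = small_fractions p (n div t)"
      by (auto simp: small_fractions_def)
    then show "(\<Sum>\<rho>\<in>{1..<int p}. if \<rho> \<in> small_fractions p (n div t) then R \<rho> else 0)
        = (\<Sum>\<rho>\<in>small_fractions p (n div t). R \<rho>)"
      using sum.inter_filter[of "{1..<int p}" R "\<lambda>\<rho>. \<rho> \<in> small_fractions p (n div t)"] by simp
  qed
  finally show ?thesis .
qed

section \<open>The multiplicative energy of a set and an interval\<close>

locale reciprocal_powers =
  fixes p s :: nat
  assumes p: "prime p" and p3: "p \<ge> 3" and s: "s \<ge> 1"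
begin

text \<open>By Fermat's theorem this power inverts \<open>x ^ s\<close> modulo \<open>p\<close>. Being a power of an integer, it is
multiplicative and compatible with congruences without any condition on \<open>x\<close>, so that shifts of \<open>x\<close>
into multiples of \<open>p\<close> need no exceptions.\<close>

definition recip_pow :: "int \<Rightarrow> int" where
  "recip_pow x = x ^ ((p - 2) * s)"

lemma prime_int_p: "prime (int p)"
  using p by simp

lemma p_pos: "p > 0"
  using p3 by simp

lemma recip_pow_mult: "recip_pow (x * y) = recip_pow x * recip_pow y"
  by (simp add: recip_pow_def power_mult_distrib)

lemma recip_pow_cong: "[x = y] (mod int p) \<Longrightarrow> [recip_pow x = recip_pow y] (mod int p)"
  unfolding recip_pow_def by (rule cong_pow)

lemma fermat_inverse:
  assumes "\<not> int p dvd x"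
  shows "[x * x ^ (p - 2) = 1] (mod int p)"
proof -
  let ?a = "nat (x mod int p)"
  have a: "[int ?a = x] (mod int p)" using p_pos by (simp add: Cong.cong_def)
  then have "\<not> p dvd ?a"
    using assms by (metis cong_dvd_iff int_dvd_int_iff)
  then have "[?a ^ (p - 1) = 1] (mod p)" by (rule fermat_theorem[OF p])
  then have "[int ?a ^ (p - 1) = 1] (mod int p)"
    by (metis cong_int_iff of_nat_1 of_nat_power)
  moreover have "[int ?a ^ (p - 1) = x ^ (p - 1)] (mod int p)" using a by (rule cong_pow)
  ultimately have "[x ^ (p - 1) = 1] (mod int p)" by (metis cong_sym cong_trans)
  moreover have "x * x ^ (p - 2) = x ^ (p - 1)"
  proof -
    have "p - 1 = Suc (p - 2)" using p3 by simp
    then show ?thesis by simp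
  qed
  ultimately show ?thesis by simp
qed

lemma recip_pow_inverse:
  assumes "\<not> int p dvd x"
  shows "[x ^ s * recip_pow x = 1] (mod int p)"
proof -
  have "[(x * x ^ (p - 2)) ^ s = 1 ^ s] (mod int p)"
    by (intro cong_pow fermat_inverse assms)
  then show ?thesis by (simp add: recip_pow_def power_mult_distrib power_mult)
qed

lemma cong_mult_cancel:
  assumes "\<not> int p dvd k" "[a * k = b * k] (mod int p)"
  shows "[a = b] (mod int p)"
proof -
  have "coprime k (int p)" using assms(1) prime_int_p by (metis coprime_commute prime_imp_coprime)
  then show ?thesis using assms(2) cong_mult_rcancel by blast
qed

lemma not_dvd_range: "x \<in> {1..<int p} \<Longrightarrow> \<not> int p dvd x"
  by (auto dest: zdvd_imp_le)

lemma cong_range_eq: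
  "\<lbrakk>x \<in> {0..<int p}; y \<in> {0..<int p}; [x = y] (mod int p)\<rbrakk> \<Longrightarrow> x = y"
  by (simp add: Cong.cong_def)

lemma not_dvd_power: "\<not> int p dvd x \<Longrightarrow> \<not> int p dvd x ^ k"
  using prime_dvd_power[OF prime_int_p] by metis

lemma mod_range: "\<not> int p dvd x \<Longrightarrow> x mod int p \<in> {1..<int p}"
  using p_pos pos_mod_sign[of "int p" x] pos_mod_bound[of "int p" x]
  unfolding dvd_eq_mod_eq_0 atLeastLessThan_iff by linarith

definition ratio :: "int \<Rightarrow> int \<Rightarrow> int" where
  "ratio x y = (x * y ^ (p - 2)) mod int p"

lemma ratio:
  assumes "\<not> int p dvd x" "\<not> int p dvd y"
  shows "ratio x y \<in> {1..<int p}" "[x = ratio x y * y] (mod int p)"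
proof -
  show "ratio x y \<in> {1..<int p}" unfolding ratio_def
    using assms prime_int_p by (intro mod_range) (auto simp: prime_dvd_mult_iff dest: not_dvd_power)
  have "[ratio x y * y = (x * y ^ (p - 2)) * y] (mod int p)"
    unfolding ratio_def by (rule cong_scalar_right) (simp add: Cong.cong_def)
  also have "(x * y ^ (p - 2)) * y = x * (y * y ^ (p - 2))" by (simp add: mult_ac)
  also have "[x * (y * y ^ (p - 2)) = x * 1] (mod int p)"
    by (intro cong_mult cong_refl fermat_inverse assms)
  finally show "[x = ratio x y * y] (mod int p)" by (simp add: cong_sym_eq)
qed

text \<open>Sort the pairs of points by their ratio: a condition that depends on the ratio alone then
separates from the points.\<close>

lemma card_by_ratio_le:
  fixes G :: "int \<Rightarrow> 'b set"
  assumes nd: "\<And>x. x \<in> {L+1..L+int n} \<Longrightarrow> \<not> int p dvd x"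
    and fin: "\<And>\<rho>. finite (G \<rho>)"
  shows "card {(x, y, z). x \<in> {L+1..L+int n} \<and> y \<in> {L+1..L+int n} \<and> z \<in> G (ratio x y)}
    \<le> (\<Sum>\<rho>\<in>{1..<int p}. ratio_count p L n \<rho> * card (G \<rho>))"
proof -
  let ?f = "\<lambda>(x, y, z). (ratio x y, ((x, y), z))"
  let ?I = "{L+1..L+int n}"
  let ?P = "\<lambda>\<rho>. {(x, y). x \<in> ?I \<and> y \<in> ?I \<and> [x = \<rho> * y] (mod int p)}"
  have finP: "finite (?P \<rho>)" for \<rho> by (rule finite_subset[of _ "?I \<times> ?I"]) auto
  let ?T = "SIGMA \<rho>:{1..<int p}. ?P \<rho> \<times> G \<rho>"
  have "card {(x, y, z). x \<in> ?I \<and> y \<in> ?I \<and> z \<in> G (ratio x y)} \<le> card ?T"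
  proof (rule card_inj_on_le[where f = "?f"])
    show "?f ` {(x, y, z). x \<in> ?I \<and> y \<in> ?I \<and> z \<in> G (ratio x y)} \<subseteq> ?T"
    proof (rule image_subsetI)
      fix t assume "t \<in> {(x, y, z). x \<in> ?I \<and> y \<in> ?I \<and> z \<in> G (ratio x y)}"
      then obtain x y z where t: "t = (x, y, z)" and xy: "x \<in> ?I" "y \<in> ?I" and z: "z \<in> G (ratio x y)"
        by auto
      show "?f t \<in> ?T"
        using ratio[OF nd[OF xy(1)] nd[OF xy(2)]] xy z unfolding t by simp
    qed
    show "inj_on ?f {(x, y, z). x \<in> ?I \<and> y \<in> ?I \<and> z \<in> G (ratio x y)}"
      by (auto intro!: inj_onI)
    show "finite ?T" using finP fin by (intro finite_SigmaI finite_cartesian_product) auto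
  qed
  also have "card ?T = (\<Sum>\<rho>\<in>{1..<int p}. card (?P \<rho> \<times> G \<rho>))"
    using finP fin by (intro card_SigmaI) auto
  finally show ?thesis by (simp add: card_cartesian_product ratio_count_def)
qed

definition energy :: "int set \<Rightarrow> int \<Rightarrow> nat \<Rightarrow> nat" where
  "energy W L n = card {((w, x), (w', x')). (w, x) \<in> W \<times> {L+1..L+int n} \<and>
     (w', x') \<in> W \<times> {L+1..L+int n} \<and> [w * recip_pow x = w' * recip_pow x'] (mod int p)}"

definition power_pairs :: "int set \<Rightarrow> int \<Rightarrow> (int \<times> int) set" where
  "power_pairs W \<rho> = {(w, w'). w \<in> W \<and> w' \<in> W \<and> [w = w' * \<rho> ^ s] (mod int p)}"

lemma finite_power_pairs: "finite W \<Longrightarrow> finite (power_pairs W \<rho>)"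
  by (rule finite_subset[of _ "W \<times> W"]) (auto simp: power_pairs_def)

text \<open>With \<open>\<rho> = x / x'\<close> the congruence \<open>w / x ^ s = w' / x' ^ s\<close> becomes \<open>w = w' * \<rho> ^ s\<close>, which no longer
mentions the interval.\<close>

lemma energy_le_sum_ratio:
  assumes nd: "\<And>x. x \<in> {L+1..L+int n} \<Longrightarrow> \<not> int p dvd x" and W: "finite W"
  shows "energy W L n \<le> (\<Sum>\<rho>\<in>{1..<int p}. ratio_count p L n \<rho> * card (power_pairs W \<rho>))"
proof -
  let ?f = "\<lambda>((w, x), (w', x')). (x, x', (w, w'))"
  let ?I = "{L+1..L+int n}"
  let ?E = "{((w, x), (w', x')). (w, x) \<in> W \<times> ?I \<and> (w', x') \<in> W \<times> ?I \<and>
      [w * recip_pow x = w' * recip_pow x'] (mod int p)}"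
  let ?T = "{(x, y, z). x \<in> ?I \<and> y \<in> ?I \<and> z \<in> power_pairs W (ratio x y)}"
  have "card ?E \<le> card ?T"
  proof (rule card_inj_on_le[where f = "?f"])
    show "inj_on ?f ?E" by (auto intro!: inj_onI)
    show "finite ?T"
      by (rule finite_subset[of _ "?I \<times> ?I \<times> (W \<times> W)"]) (use W in \<open>auto simp: power_pairs_def\<close>)
    show "?f ` ?E \<subseteq> ?T"
    proof (rule image_subsetI)
      fix t assume "t \<in> ?E"
      then obtain w x w' x' where t: "t = ((w, x), (w', x'))"
        and w: "w \<in> W" "w' \<in> W" and x: "x \<in> ?I" "x' \<in> ?I"
        and c: "[w * recip_pow x = w' * recip_pow x'] (mod int p)" by auto
      note ndx = nd[OF x(1)] and ndx' = nd[OF x(2)]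
      have "[w * x' ^ s = (w * recip_pow x) * (x ^ s * x' ^ s)] (mod int p)"
      proof -
        have "[w * x' ^ s * (x ^ s * recip_pow x) = w * x' ^ s * 1] (mod int p)"
          by (intro cong_mult cong_refl recip_pow_inverse ndx)
        then show ?thesis by (simp add: mult_ac cong_sym_eq)
      qed
      also have "[(w * recip_pow x) * (x ^ s * x' ^ s) = (w' * recip_pow x') * (x ^ s * x' ^ s)] (mod int p)"
        by (intro cong_mult c cong_refl)
      also have "[(w' * recip_pow x') * (x ^ s * x' ^ s) = w' * x ^ s] (mod int p)"
      proof -
        have "[w' * x ^ s * (x' ^ s * recip_pow x') = w' * x ^ s * 1] (mod int p)"
          by (intro cong_mult cong_refl recip_pow_inverse ndx')
        then show ?thesis by (simp add: mult_ac)
      qed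
      also have "[w' * x ^ s = w' * (ratio x x' * x') ^ s] (mod int p)"
        by (intro cong_mult cong_pow cong_refl ratio ndx ndx')
      also have "w' * (ratio x x' * x') ^ s = (w' * ratio x x' ^ s) * x' ^ s"
        by (simp add: power_mult_distrib)
      finally have "[w = w' * ratio x x' ^ s] (mod int p)"
        by (rule cong_mult_cancel[OF not_dvd_power[OF ndx']])
      then show "?f t \<in> ?T"
        using w x unfolding t by (simp add: power_pairs_def)
    qed
  qed
  also have "card ?T \<le> (\<Sum>\<rho>\<in>{1..<int p}. ratio_count p L n \<rho> * card (power_pairs W \<rho>))"
    using nd W by (intro card_by_ratio_le finite_power_pairs)
  finally show ?thesis by (simp add: energy_def)
qed

lemma card_roots_le:
  "card {z \<in> {1..<int p}. [c = z ^ s] (mod int p)} \<le> s"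
proof -
  have "card {z \<in> {1..<int p}. [c = z ^ s] (mod int p)} \<le> card {z \<in> {0..<int p}. [z ^ s = c] (mod int p)}"
    by (intro card_mono) (auto intro: cong_sym finite_subset[of _ "{0..<int p}"])
  also have "\<dots> \<le> s" using card_power_residues_le[OF p] s by simp
  finally show ?thesis .
qed

text \<open>Given \<open>w\<close> and \<open>w'\<close>, the residue \<open>\<rho>\<close> is one of the at most \<open>s\<close> roots \<open>z\<close> of \<open>z ^ s = w / w'\<close>.\<close>

lemma sum_power_pairs_le:
  assumes W: "W \<subseteq> {1..<int p}"
  shows "(\<Sum>\<rho>\<in>{1..<int p}. card (power_pairs W \<rho>)) \<le> s * (card W)\<^sup>2"
proof -
  have finW: "finite W" using W finite_subset by blast
  let ?S = "SIGMA \<rho>:{1..<int p}. power_pairs W \<rho>"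
  have "(\<Sum>\<rho>\<in>{1..<int p}. card (power_pairs W \<rho>)) = card ?S"
    using finite_power_pairs[OF finW] by (intro card_SigmaI[symmetric]) auto
  also have "\<dots> \<le> card (W \<times> W) * s"
  proof (rule card_le_fibres[where f = snd])
    show "finite ?S" using finite_power_pairs[OF finW] by auto
    show "finite (W \<times> W)" using finW by auto
    show "snd ` ?S \<subseteq> W \<times> W" by (auto simp: power_pairs_def)
    fix y assume y: "y \<in> W \<times> W"
    obtain w w' where ww: "y = (w, w')" "w \<in> W" "w' \<in> W" using y by blast
    let ?c = "w * w' ^ (p - 2)"
    have w': "\<not> int p dvd w'" using W ww not_dvd_range by blast
    have sub: "fst ` {x \<in> ?S. snd x = y} \<subseteq> {z \<in> {1..<int p}. [?c = z ^ s] (mod int p)}"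
    proof (rule image_subsetI)
      fix t assume "t \<in> {x \<in> ?S. snd x = y}"
      then obtain \<rho> where t: "t = (\<rho>, y)" and \<rho>: "\<rho> \<in> {1..<int p}" and y: "y \<in> power_pairs W \<rho>"
        by (cases t) auto
      have "[w = w' * \<rho> ^ s] (mod int p)" using ww y by (simp add: power_pairs_def)
      then have "[w * w' ^ (p - 2) = (w' * \<rho> ^ s) * w' ^ (p - 2)] (mod int p)" by (rule cong_scalar_right)
      also have "(w' * \<rho> ^ s) * w' ^ (p - 2) = \<rho> ^ s * (w' * w' ^ (p - 2))" by (simp add: mult_ac)
      also have "[\<rho> ^ s * (w' * w' ^ (p - 2)) = \<rho> ^ s * 1] (mod int p)"
        by (intro cong_mult cong_refl fermat_inverse w')
      finally show "fst t \<in> {z \<in> {1..<int p}. [?c = z ^ s] (mod int p)}" using \<rho> t by simp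
    qed
    have "card {x \<in> ?S. snd x = y} = card (fst ` {x \<in> ?S. snd x = y})"
      by (intro card_image[symmetric] inj_onI) auto
    also have "\<dots> \<le> card {z \<in> {1..<int p}. [?c = z ^ s] (mod int p)}"
      using sub by (intro card_mono) (auto intro: finite_subset[of _ "{1..<int p}"])
    also have "\<dots> \<le> s" by (rule card_roots_le)
    finally show "card {x \<in> ?S. snd x = y} \<le> s" .
  qed
  finally show ?thesis by (simp add: card_cartesian_product power2_eq_square mult.commute)
qed

text \<open>Two applications of Cauchy--Schwarz eliminate the arbitrary set, at the price of products of
  four fractions.\<close>

lemma sum_power_pairs_fractions_pow4_le:
  assumes W: "W \<subseteq> {1..<int p}" and F: "F \<subseteq> {1..<int p}"
  shows "(\<Sum>\<rho>\<in>F. card (power_pairs W \<rho>)) ^ 4 \<le> card W ^ 5 *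
    card {(\<rho>1, \<rho>2, \<rho>3, \<rho>4). \<rho>1 \<in> F \<and> \<rho>2 \<in> F \<and> \<rho>3 \<in> F \<and> \<rho>4 \<in> F \<and>
      [(\<rho>1 * \<rho>2) ^ s = (\<rho>3 * \<rho>4) ^ s] (mod int p)}"
proof -
  let ?f2 = "\<lambda>((w1, w2), (\<rho>1, \<rho>1'), (\<rho>2, \<rho>2')). (w1, (\<rho>1', \<rho>2, \<rho>1, \<rho>2'))"
  let ?f1 = "\<lambda>(w, \<rho>, \<rho>'). (((w * \<rho> ^ s) mod int p, (w * \<rho>' ^ s) mod int p), (\<rho>, \<rho>'))"
  have finW: "finite W" and finF: "finite F" using W F finite_subset by blast+
  have ndW: "\<not> int p dvd w" if "w \<in> W" for w using that W not_dvd_range by blast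
  have ndF: "\<not> int p dvd \<rho>" if "\<rho> \<in> F" for \<rho> using that F not_dvd_range by blast
  let ?Q = "\<Sum>\<rho>\<in>F. card (power_pairs W \<rho>)"
  let ?R = "\<lambda>w \<rho>. (w * \<rho> ^ s) mod int p \<in> W"
  define A1 where "A1 = {(w, \<rho>). w \<in> W \<and> \<rho> \<in> F \<and> ?R w \<rho>}"
  define B1 where "B1 = {(w, \<rho>, \<rho>'). w \<in> W \<and> \<rho> \<in> F \<and> \<rho>' \<in> F \<and> ?R w \<rho> \<and> ?R w \<rho>'}"
  let ?R2 = "\<lambda>(w1, w2) (\<rho>, \<rho>'). [w1 * \<rho>' ^ s = w2 * \<rho> ^ s] (mod int p)"
  define A2 where "A2 = {(x, y). x \<in> W \<times> W \<and> y \<in> F \<times> F \<and> ?R2 x y}"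
  define B2 where "B2 = {(x, y, y'). x \<in> W \<times> W \<and> y \<in> F \<times> F \<and> y' \<in> F \<times> F \<and> ?R2 x y \<and> ?R2 x y'}"
  define Z where "Z = {(\<rho>1, \<rho>2, \<rho>3, \<rho>4). \<rho>1 \<in> F \<and> \<rho>2 \<in> F \<and> \<rho>3 \<in> F \<and> \<rho>4 \<in> F \<and>
      [(\<rho>1 * \<rho>2) ^ s = (\<rho>3 * \<rho>4) ^ s] (mod int p)}"
  have finZ: "finite Z"
    unfolding Z_def by (rule finite_subset[of _ "F \<times> F \<times> F \<times> F"]) (use finF in auto)
  have memW: "(w' * \<rho> ^ s) mod int p = w" if "w \<in> W" "[w = w' * \<rho> ^ s] (mod int p)" for w w' \<rho>
    using that W by (auto simp: Cong.cong_def)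
  \<comment> \<open>first step: two fractions lead from a common element of \<open>W\<close> to two elements of \<open>W\<close>\<close>
  have "?Q = card (SIGMA \<rho>:F. power_pairs W \<rho>)"
    using finite_power_pairs[OF finW] finF by (intro card_SigmaI[symmetric]) auto
  also have "\<dots> \<le> card A1"
  proof (rule card_inj_on_le[where f = "\<lambda>(\<rho>, (w, w')). (w', \<rho>)"])
    show "inj_on (\<lambda>(\<rho>, (w, w')). (w', \<rho>)) (SIGMA \<rho>:F. power_pairs W \<rho>)"
    proof -
      have "w = v" if "(w, w') \<in> power_pairs W \<rho>" "(v, w') \<in> power_pairs W \<rho>" for w v w' \<rho>
        using that memW[of w w' \<rho>] memW[of v w' \<rho>] by (simp add: power_pairs_def)
      then show ?thesis by (auto intro!: inj_onI)
    qed
    show "(\<lambda>(\<rho>, (w, w')). (w', \<rho>)) ` (SIGMA \<rho>:F. power_pairs W \<rho>) \<subseteq> A1"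
      using memW by (auto simp: power_pairs_def A1_def)
    show "finite A1" unfolding A1_def by (rule finite_subset[of _ "W \<times> F"]) (use finW finF in auto)
  qed
  finally have "?Q\<^sup>2 \<le> (card A1)\<^sup>2" by (rule power_mono) simp
  also have "\<dots> \<le> card W * card B1" 
    unfolding A1_def B1_def by (rule card_relation_squared[OF finW finF])
  also have "card B1 \<le> card A2"
  proof (rule card_inj_on_le[where f = "?f1"])
    show "inj_on ?f1 B1"
    proof (rule inj_onI)
      fix t t' assume tt: "t \<in> B1" "t' \<in> B1"
        and eq: "?f1 t
          = ?f1 t'"
      obtain w \<rho> \<rho>' where t: "t = (w, \<rho>, \<rho>')" by (cases t)
      obtain w' \<sigma> \<sigma>' where t': "t' = (w', \<sigma>, \<sigma>')" by (cases t')
      have \<sigma>: "\<sigma> = \<rho>" "\<sigma>' = \<rho>'" using eq unfolding t t' by simp_all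
      have eq': "(w * \<rho> ^ s) mod int p = (w' * \<rho> ^ s) mod int p"
        using eq unfolding t t' \<sigma> by simp
      have w: "w \<in> W" "w' \<in> W" "\<rho> \<in> F" using tt unfolding t t' B1_def by simp_all
      from eq' have "[w * \<rho> ^ s = w' * \<rho> ^ s] (mod int p)" by (simp add: Cong.cong_def)
      then have "[w = w'] (mod int p)" by (rule cong_mult_cancel[OF not_dvd_power[OF ndF[OF w(3)]]])
      then have "w = w'" by (intro cong_range_eq) (use w(1,2) W in auto)
      then show "t = t'" using t t' \<sigma> by simp
    qed
    show "?f1 ` B1 \<subseteq> A2"
    proof (rule image_subsetI)
      fix t assume "t \<in> B1"
      then obtain w \<rho> \<rho>' where t: "t = (w, \<rho>, \<rho>')" "\<rho> \<in> F" "\<rho>' \<in> F" "?R w \<rho>" "?R w \<rho>'"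
        unfolding B1_def by auto
      have "[(w * \<rho> ^ s) mod int p * \<rho>' ^ s = (w * \<rho> ^ s) * \<rho>' ^ s] (mod int p)"
        by (rule cong_scalar_right) (simp add: Cong.cong_def)
      moreover have "[(w * \<rho>' ^ s) mod int p * \<rho> ^ s = (w * \<rho>' ^ s) * \<rho> ^ s] (mod int p)"
        by (rule cong_scalar_right) (simp add: Cong.cong_def)
      moreover have "(w * \<rho> ^ s) * \<rho>' ^ s = (w * \<rho>' ^ s) * \<rho> ^ s" by (simp add: mult_ac)
      ultimately have "[(w * \<rho> ^ s) mod int p * \<rho>' ^ s = (w * \<rho>' ^ s) mod int p * \<rho> ^ s] (mod int p)"
        by (metis cong_sym cong_trans)
      then show "?f1 t \<in> A2"
        using t(2-) unfolding t(1) A2_def by simp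
    qed
    show "finite A2" unfolding A2_def by (rule finite_subset[of _ "(W \<times> W) \<times> (F \<times> F)"]) (use finW finF in auto)
  qed
  finally have 1: "?Q\<^sup>2 \<le> card W * card A2" by simp
  \<comment> \<open>second step: dividing two such relations with the same pair from \<open>W\<close> eliminates the pair\<close>
  have "(card A2)\<^sup>2 \<le> card (W \<times> W) * card B2"
    unfolding A2_def B2_def using finW finF by (intro card_relation_squared) auto
  also have "card B2 \<le> card (W \<times> Z)"
  proof (rule card_inj_on_le[where f = "?f2"])
    show "inj_on ?f2 B2"
    proof (rule inj_onI)
      fix t t' assume tt: "t \<in> B2" "t' \<in> B2"
        and eq: "?f2 t
          = ?f2 t'"
      obtain w w2 \<rho>1 \<rho>1' \<rho>2 \<rho>2' where t: "t = ((w, w2), (\<rho>1, \<rho>1'), (\<rho>2, \<rho>2'))"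
        by (metis prod.exhaust)
      obtain v w2' \<sigma>1 \<sigma>1' \<sigma>2 \<sigma>2' where t': "t' = ((v, w2'), (\<sigma>1, \<sigma>1'), (\<sigma>2, \<sigma>2'))"
        by (metis prod.exhaust)
      have \<sigma>: "v = w" "\<sigma>1 = \<rho>1" "\<sigma>1' = \<rho>1'" "\<sigma>2 = \<rho>2" "\<sigma>2' = \<rho>2'" using eq unfolding t t' by simp_all
      have w: "w2 \<in> W" "w2' \<in> W" "\<rho>1 \<in> F"
        and c: "[w * \<rho>1' ^ s = w2 * \<rho>1 ^ s] (mod int p)" "[w * \<rho>1' ^ s = w2' * \<rho>1 ^ s] (mod int p)"
        using tt unfolding t t' \<sigma> B2_def by simp_all
      have "[w2 * \<rho>1 ^ s = w2' * \<rho>1 ^ s] (mod int p)" by (rule cong_trans[OF cong_sym[OF c(1)] c(2)])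
      then have "[w2 = w2'] (mod int p)" by (rule cong_mult_cancel[OF not_dvd_power[OF ndF[OF w(3)]]])
      then have "w2 = w2'" by (intro cong_range_eq) (use w(1,2) W in auto)
      then show "t = t'" using t t' \<sigma> by simp
    qed
    show "?f2 ` B2 \<subseteq> W \<times> Z"
    proof (rule image_subsetI)
      fix t assume "t \<in> B2"
      then obtain w1 w2 \<rho>1 \<rho>1' \<rho>2 \<rho>2' where t: "t = ((w1, w2), (\<rho>1, \<rho>1'), (\<rho>2, \<rho>2'))"
        and w: "w1 \<in> W" "w2 \<in> W" and \<rho>: "\<rho>1 \<in> F" "\<rho>1' \<in> F" "\<rho>2 \<in> F" "\<rho>2' \<in> F"
        and c: "[w1 * \<rho>1' ^ s = w2 * \<rho>1 ^ s] (mod int p)" "[w1 * \<rho>2' ^ s = w2 * \<rho>2 ^ s] (mod int p)"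
        unfolding B2_def by auto
      have "[(w1 * \<rho>1' ^ s) * (w2 * \<rho>2 ^ s) = (w2 * \<rho>1 ^ s) * (w1 * \<rho>2' ^ s)] (mod int p)"
        by (intro cong_mult c(1) cong_sym[OF c(2)])
      then have "[(\<rho>1' * \<rho>2) ^ s * (w1 * w2) = (\<rho>1 * \<rho>2') ^ s * (w1 * w2)] (mod int p)"
        by (simp add: power_mult_distrib mult_ac)
      moreover have "\<not> int p dvd w1 * w2" using ndW w prime_int_p by (auto simp: prime_dvd_mult_iff)
      ultimately have "[(\<rho>1' * \<rho>2) ^ s = (\<rho>1 * \<rho>2') ^ s] (mod int p)" by (rule cong_mult_cancel[rotated])
      then show "?f2 t \<in> W \<times> Z"
        using w \<rho> unfolding t Z_def by simp
    qed
    show "finite (W \<times> Z)" using finW finZ by blast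
  qed
  finally have 2: "(card A2)\<^sup>2 \<le> card W ^ 3 * card Z"
    by (simp add: card_cartesian_product power3_eq_cube mult_ac)
  have "?Q ^ 4 = (?Q\<^sup>2)\<^sup>2" by (simp flip: power_mult)
  also have "\<dots> \<le> (card W * card A2)\<^sup>2" using 1 by (rule power_mono) simp
  also have "\<dots> = (card W)\<^sup>2 * (card A2)\<^sup>2" by (rule power_mult_distrib)
  also have "\<dots> \<le> (card W)\<^sup>2 * (card W ^ 3 * card Z)" using 2 by (rule mult_left_mono) simp
  also have "\<dots> = card W ^ 5 * card Z" by (simp add: power_add[symmetric] mult.assoc[symmetric])
  finally show ?thesis unfolding Z_def .
qed

text \<open>Clearing denominators leaves two products of four integers with congruent \<open>s\<close>-th powers: one
  product is free, the other is then one of \<open>s\<close> integers, each of which factors in few ways.\<close>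

lemma card_fraction_quadruples_le:
  assumes h: "2 * h ^ 4 < p"
    and D: "\<And>m. m \<in> {1..p} \<Longrightarrow> card {d. d dvd m} \<le> D"
  defines "F \<equiv> small_fractions p h"
  shows "card {(\<rho>1, \<rho>2, \<rho>3, \<rho>4). \<rho>1 \<in> F \<and> \<rho>2 \<in> F \<and> \<rho>3 \<in> F \<and> \<rho>4 \<in> F \<and>
      [(\<rho>1 * \<rho>2) ^ s = (\<rho>3 * \<rho>4) ^ s] (mod int p)} \<le> 256 * s * (h * D) ^ 4"
proof -
  let ?c = "\<lambda>x y :: int. [x = y] (mod int p)"
  define Z where "Z = {(\<rho>1, \<rho>2, \<rho>3, \<rho>4). \<rho>1 \<in> F \<and> \<rho>2 \<in> F \<and> \<rho>3 \<in> F \<and> \<rho>4 \<in> F \<and>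
      ?c ((\<rho>1 * \<rho>2) ^ s) ((\<rho>3 * \<rho>4) ^ s)}"
  define H where "H = {- int h..int h} - {0}"
  have finH: "finite H" by (simp add: H_def)
  have cH: "card H = 2 * h"
    unfolding H_def by (subst card_Diff_singleton) auto
  define is_frac where "is_frac \<rho> ab \<longleftrightarrow> fst ab \<in> H \<and> snd ab \<in> H \<and> ?c (fst ab) (\<rho> * snd ab)"
    for \<rho> :: int and ab :: "int \<times> int"
  have "\<exists>ab. is_frac \<rho> ab" if \<rho>: "\<rho> \<in> F" for \<rho>
  proof -
    obtain a b where "a \<noteq> 0" "b \<noteq> 0" "\<bar>a\<bar> \<le> int h" "\<bar>b\<bar> \<le> int h" "?c a (\<rho> * b)"
      using \<rho> by (auto simp: F_def small_fractions_def)
    then have "is_frac \<rho> (a, b)" by (auto simp: is_frac_def H_def)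
    then show ?thesis by blast
  qed
  then obtain g where g: "is_frac \<rho> (g \<rho>)" if "\<rho> \<in> F" for \<rho> by metis
  define a where "a \<rho> = fst (g \<rho>)" for \<rho>
  define b where "b \<rho> = snd (g \<rho>)" for \<rho>
  have ab: "a \<rho> \<in> H" "b \<rho> \<in> H" "?c (a \<rho>) (\<rho> * b \<rho>)" if "\<rho> \<in> F" for \<rho>
    using g[OF that] by (auto simp: a_def b_def is_frac_def)
  have hp: "h < p"
  proof -
    have "h \<le> h ^ 4" by (cases "h = 0") (auto intro: self_le_power)
    then show ?thesis using h by linarith
  qed
  have ndH: "\<not> int p dvd x" if "x \<in> H" for x
  proof
    assume "int p dvd x"
    then have "int p dvd \<bar>x\<bar>" by simp
    then have "int p \<le> \<bar>x\<bar>" using that by (intro zdvd_imp_le) (auto simp: H_def)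
    then show False using that hp by (auto simp: H_def)
  qed
  define pr where "pr = (\<lambda>(u1, u2, u3, u4). u1 * u2 * u3 * (u4 :: int))"
  define H4 where "H4 = H \<times> H \<times> H \<times> H"
  have finH4: "finite H4" using finH by (simp add: H4_def)
  define Y where "Y = {(u, v). u \<in> H4 \<and> v \<in> H4 \<and> ?c (pr u ^ s) (pr v ^ s)}"
  have finY: "finite Y" by (rule finite_subset[of _ "H4 \<times> H4"]) (use finH4 in \<open>auto simp: Y_def\<close>)
  let ?\<phi> = "\<lambda>(\<rho>1, \<rho>2, \<rho>3, \<rho>4). ((a \<rho>1, a \<rho>2, b \<rho>3, b \<rho>4), (a \<rho>3, a \<rho>4, b \<rho>1, b \<rho>2))"
  have "card Z \<le> card Y"
  proof (rule card_inj_on_le[where f = ?\<phi>])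
    have inj: "\<rho> = \<sigma>" if "\<rho> \<in> F" "\<sigma> \<in> F" "a \<rho> = a \<sigma>" "b \<rho> = b \<sigma>" for \<rho> \<sigma>
    proof -
      have "?c (\<rho> * b \<rho>) (\<sigma> * b \<rho>)"
        using ab(3)[OF that(1)] ab(3)[OF that(2)] that(3,4) by (metis cong_sym cong_trans)
      then have "?c \<rho> \<sigma>" by (rule cong_mult_cancel[OF ndH[OF ab(2)[OF that(1)]]])
      then show ?thesis by (intro cong_range_eq) (use that in \<open>auto simp: F_def small_fractions_def\<close>)
    qed
    show "inj_on ?\<phi> Z"
    proof (rule inj_onI)
      fix t t' assume tt: "t \<in> Z" "t' \<in> Z" and eq: "?\<phi> t = ?\<phi> t'"
      obtain \<rho>1 \<rho>2 \<rho>3 \<rho>4 where t: "t = (\<rho>1, \<rho>2, \<rho>3, \<rho>4)" by (cases t)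
      obtain \<sigma>1 \<sigma>2 \<sigma>3 \<sigma>4 where t': "t' = (\<sigma>1, \<sigma>2, \<sigma>3, \<sigma>4)" by (cases t')
      show "t = t'"
        using tt eq inj[of \<rho>1 \<sigma>1] inj[of \<rho>2 \<sigma>2] inj[of \<rho>3 \<sigma>3] inj[of \<rho>4 \<sigma>4] unfolding t t' Z_def by simp
    qed
    show "?\<phi> ` Z \<subseteq> Y"
    proof (rule image_subsetI)
      fix t assume "t \<in> Z"
      then obtain \<rho>1 \<rho>2 \<rho>3 \<rho>4 where t: "t = (\<rho>1, \<rho>2, \<rho>3, \<rho>4)"
        and F: "\<rho>1 \<in> F" "\<rho>2 \<in> F" "\<rho>3 \<in> F" "\<rho>4 \<in> F" and c: "?c ((\<rho>1 * \<rho>2) ^ s) ((\<rho>3 * \<rho>4) ^ s)"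
        unfolding Z_def by auto
      let ?k = "(b \<rho>1 * b \<rho>2 * b \<rho>3 * b \<rho>4) ^ s"
      have "?c ((a \<rho>1 * a \<rho>2 * b \<rho>3 * b \<rho>4) ^ s) ((\<rho>1 * b \<rho>1 * (\<rho>2 * b \<rho>2) * b \<rho>3 * b \<rho>4) ^ s)"
        by (intro cong_pow cong_mult cong_refl ab(3) F)
      also have "(\<rho>1 * b \<rho>1 * (\<rho>2 * b \<rho>2) * b \<rho>3 * b \<rho>4) ^ s = (\<rho>1 * \<rho>2) ^ s * ?k"
        by (simp add: power_mult_distrib mult_ac)
      also have "?c ((\<rho>1 * \<rho>2) ^ s * ?k) ((\<rho>3 * \<rho>4) ^ s * ?k)"
        by (intro cong_mult c cong_refl)
      also have "(\<rho>3 * \<rho>4) ^ s * ?k = (\<rho>3 * b \<rho>3 * (\<rho>4 * b \<rho>4) * b \<rho>1 * b \<rho>2) ^ s"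
        by (simp add: power_mult_distrib mult_ac)
      also have "?c \<dots> ((a \<rho>3 * a \<rho>4 * b \<rho>1 * b \<rho>2) ^ s)"
        by (intro cong_pow cong_mult cong_refl cong_sym[OF ab(3)] F)
      finally show "?\<phi> t \<in> Y" unfolding t Y_def H4_def pr_def using ab F by simp
    qed
    show "finite Y" by (rule finY)
  qed
  also have "card Y \<le> card H4 * (s * (2 * D) ^ 4)"
  proof (rule card_le_fibres[where f = snd])
    show "finite Y" by (rule finY)
    show "finite H4" by (rule finH4)
    show "snd ` Y \<subseteq> H4" by (auto simp: Y_def)
    fix v assume v: "v \<in> H4"
    define As where "As = {A \<in> {- int (h ^ 4)..int (h ^ 4)} - {0}. ?c (A ^ s) (pr v ^ s)}"
    have finAs: "finite As"
      by (rule finite_subset[of _ "{- int (h ^ 4)..int (h ^ 4)}"]) (auto simp: As_def)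
    have pr_range: "pr u \<in> {- int (h ^ 4)..int (h ^ 4)} - {0}" if "u \<in> H4" for u
    proof -
      obtain u1 u2 u3 u4 where u: "u = (u1, u2, u3, u4)" by (cases u)
      then have uH: "u1 \<in> H" "u2 \<in> H" "u3 \<in> H" "u4 \<in> H" using that by (auto simp: H4_def)
      then have "\<bar>u1\<bar> * \<bar>u2\<bar> * \<bar>u3\<bar> * \<bar>u4\<bar> \<le> int h * int h * int h * int h"
        by (intro mult_mono) (auto simp: H_def)
      then have "\<bar>pr u\<bar> \<le> int (h ^ 4)" by (simp add: u pr_def abs_mult power4_eq_xxxx)
      moreover have "pr u \<noteq> 0" using uH by (auto simp: u pr_def H_def)
      ultimately show ?thesis by auto
    qed
    have "card As \<le> card {z \<in> {1..<int p}. ?c (pr v ^ s) (z ^ s)}"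
    proof (rule card_inj_on_le[where f = "\<lambda>A. A mod int p"])
      have ndA: "\<not> int p dvd A" if "A \<in> As" for A
      proof
        assume "int p dvd A"
        then have "int p dvd \<bar>A\<bar>" by simp
        then have "int p \<le> \<bar>A\<bar>" using that by (intro zdvd_imp_le) (auto simp: As_def)
        moreover have "\<bar>A\<bar> \<le> int (h ^ 4)" using that by (auto simp: As_def)
        moreover have "int (h ^ 4) < int p" using h by linarith
        ultimately show False by linarith
      qed
      show "inj_on (\<lambda>A. A mod int p) As"
      proof (rule inj_onI, rule ccontr)
        fix A A' assume A: "A \<in> As" "A' \<in> As" "A mod int p = A' mod int p" "A \<noteq> A'"
        then have "int p dvd \<bar>A - A'\<bar>" by (simp add: mod_eq_dvd_iff)
        then have "int p \<le> \<bar>A - A'\<bar>" using A(4) by (intro zdvd_imp_le) auto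
        moreover have "\<bar>A\<bar> \<le> int (h ^ 4)" "\<bar>A'\<bar> \<le> int (h ^ 4)" using A(1,2) by (auto simp: As_def)
        moreover have "2 * int (h ^ 4) < int p"
          using h by (metis of_nat_less_iff of_nat_mult of_nat_numeral)
        ultimately show False by linarith
      qed
      show "(\<lambda>A. A mod int p) ` As \<subseteq> {z \<in> {1..<int p}. ?c (pr v ^ s) (z ^ s)}"
      proof (rule image_subsetI)
        fix A assume A: "A \<in> As"
        have "?c (pr v ^ s) (A ^ s)" using A by (simp add: As_def cong_sym_eq)
        also have "?c (A ^ s) ((A mod int p) ^ s)" by (intro cong_pow) (simp add: Cong.cong_def)
        finally show "A mod int p \<in> {z \<in> {1..<int p}. ?c (pr v ^ s) (z ^ s)}"
          using mod_range[OF ndA[OF A]] by simp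
      qed
      show "finite {z \<in> {1..<int p}. ?c (pr v ^ s) (z ^ s)}"
        by (rule finite_subset[of _ "{1..<int p}"]) auto
    qed
    also have "\<dots> \<le> s" by (rule card_roots_le)
    finally have cAs: "card As \<le> s" .
    have "card {x \<in> Y. snd x = v} \<le> card As * (2 * D) ^ 4"
    proof (rule card_le_fibres[where f = "\<lambda>x. pr (fst x)"])
      show "finite {x \<in> Y. snd x = v}" using finY by simp
      show "finite As" by (rule finAs)
      show "(\<lambda>x. pr (fst x)) ` {x \<in> Y. snd x = v} \<subseteq> As"
        using pr_range by (auto simp: Y_def As_def)
      fix A assume A: "A \<in> As"
      then have A0: "A \<noteq> 0" and Ah: "\<bar>A\<bar> \<le> int (h ^ 4)" by (auto simp: As_def)
      have "\<bar>A\<bar> > 0" by (rule zero_less_abs_iff[THEN iffD2, OF A0])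
      moreover have "int (h ^ 4) \<le> int p" using h by linarith
      ultimately have "nat \<bar>A\<bar> \<in> {1..p}" using Ah unfolding atLeastAtMost_iff by linarith
      then have "card {d. d dvd A} \<le> 2 * D"
        using card_int_divisors_le(2)[OF A0] D by (meson le_trans mult_le_mono2)
      then have bound: "card {(a, b, c, d). a * b * c * d = A} \<le> (2 * D) ^ 4"
        by (rule card_quadruples_with_product_le[OF A0])
      have finq: "finite {(a, b, c, d). a * b * c * d = A}"
        by (rule finite_subset[of _ "{d. d dvd A} \<times> {d. d dvd A} \<times> {d. d dvd A} \<times> {d. d dvd A}"])
          (use card_int_divisors_le(1)[OF A0] in auto)
      have "card {x \<in> {x \<in> Y. snd x = v}. pr (fst x) = A} \<le> card {(a, b, c, d). a * b * c * d = A}"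
        by (rule card_inj_on_le[where f = fst]) (use finq in \<open>auto simp: pr_def inj_on_def\<close>)
      with bound show "card {x \<in> {x \<in> Y. snd x = v}. pr (fst x) = A} \<le> (2 * D) ^ 4" by linarith
    qed
    also have "\<dots> \<le> s * (2 * D) ^ 4" using cAs by (rule mult_right_mono) simp
    finally show "card {x \<in> Y. snd x = v} \<le> s * (2 * D) ^ 4" .
  qed
  also have "\<dots> = 256 * s * (h * D) ^ 4"
    by (simp add: H4_def card_cartesian_product cH power_mult_distrib power4_eq_xxxx)
  finally show ?thesis unfolding Z_def .
qed

lemma sum_power_pairs_small_fractions_le:
  assumes W: "W \<subseteq> {1..<int p}" and h: "2 * h ^ 4 < p"
    and D: "\<And>m. m \<in> {1..p} \<Longrightarrow> card {d. d dvd m} \<le> D"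
  shows "real (\<Sum>\<rho>\<in>small_fractions p h. card (power_pairs W \<rho>))
    \<le> 4 * real s * real (card W) powr (5/4) * real h * real D"
proof -
  let ?F = "small_fractions p h"
  let ?Q = "\<Sum>\<rho>\<in>?F. card (power_pairs W \<rho>)"
  let ?K = "card W"
  note F = small_fractions_subset[of p h]
  have "?Q ^ 4 \<le> ?K ^ 5 * (256 * s * (h * D) ^ 4)"
    using sum_power_pairs_fractions_pow4_le[OF W F] card_fraction_quadruples_le[OF h D]
    by (meson le_trans mult_le_mono2)
  also have "\<dots> \<le> ?K ^ 5 * (256 * s ^ 4 * (h * D) ^ 4)"
    using s by (intro mult_left_mono mult_right_mono self_le_power) auto
  finally have "real (?Q ^ 4) \<le> real (?K ^ 5 * (256 * s ^ 4 * (h * D) ^ 4))" by (simp only: of_nat_le_iff)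
  also have "\<dots> = (4 * real s * real ?K powr (5/4) * real h * real D) ^ 4"
  proof -
    have "(real ?K powr (5/4)) ^ 4 = real ?K ^ 5"
    proof (cases "?K = 0")
      case False
      then have "(real ?K powr (5/4)) ^ 4 = real ?K powr 5"
        by (simp add: powr_power)
      then show ?thesis using False by (simp add: powr_numeral)
    qed simp
    then show ?thesis by (simp add: power_mult_distrib)
  qed
  finally have "real ?Q ^ 4 \<le> (4 * real s * real ?K powr (5/4) * real h * real D) ^ 4" by (simp only: of_nat_power)
  then show ?thesis by (rule power_le_imp_le_base[where n = 3, simplified]) auto
qed

text \<open>A ratio that occurs more than \<open>t\<close> times is a fraction of height at most \<open>n / t\<close>. The height is
  small enough for the previous bound except for the few smallest \<open>t\<close>, where the trivial bound
  serves.\<close>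

lemma energy_le:
  assumes W: "W \<subseteq> {1..<int p}" and n: "2 * n\<^sup>2 < p"
    and nd: "\<And>x. x \<in> {L+1..L+int n} \<Longrightarrow> \<not> int p dvd x"
    and D: "\<And>m. m \<in> {1..p} \<Longrightarrow> card {d. d dvd m} \<le> D"
  shows "real (energy W L n) \<le> real s * (real (card W))\<^sup>2 * (1 + 2 * real n * real p powr (-1/4))
    + 4 * real s * real (card W) powr (5/4) * real n * real D * harm n"
proof -
  let ?R = "\<lambda>\<rho>. card (power_pairs W \<rho>)"
  let ?K = "real (card W)"
  let ?Q = "\<lambda>t. real (\<Sum>\<rho>\<in>small_fractions p (n div t). ?R \<rho>)"
  \<comment> \<open>for \<open>t > y\<close> the height \<open>n / t\<close> satisfies \<open>2 * (n / t) ^ 4 < p\<close>\<close>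
  define y where "y = 2 * real n * real p powr (-1/4)"
  have finW: "finite W" using W finite_subset by blast
  have R: "real (\<Sum>\<rho>\<in>{1..<int p}. ?R \<rho>) \<le> real s * ?K\<^sup>2"
    using sum_power_pairs_le[OF W] by (metis of_nat_le_iff of_nat_mult of_nat_power)
  define small where "small = {t \<in> {1..n}. real t \<le> y}"
  have Q: "?Q t \<le> 4 * real s * ?K powr (5/4) * real n * real D * inverse (real t)
      + (if t \<in> small then real s * ?K\<^sup>2 else 0)" if t: "t \<in> {1..n}" for t
  proof (cases "2 * (n div t) ^ 4 < p")
    case True
    have "?Q t \<le> 4 * real s * ?K powr (5/4) * real (n div t) * real D"
      by (rule sum_power_pairs_small_fractions_le[OF W True D])
    also have "\<dots> \<le> 4 * real s * ?K powr (5/4) * (real n / real t) * real D"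
      by (intro mult_left_mono mult_right_mono of_nat_div_le_of_nat) auto
    also have "\<dots> = 4 * real s * ?K powr (5/4) * real n * real D * inverse (real t)"
      by (simp only: divide_inverse mult_ac)
    finally have "?Q t \<le> 4 * real s * ?K powr (5/4) * real n * real D * inverse (real t)" .
    moreover have "0 \<le> (if t \<in> small then real s * ?K\<^sup>2 else 0)" by simp
    ultimately show ?thesis by (rule add_increasing2[rotated])
  next
    case False
    have "real p \<le> 2 * (real n / real t) ^ 4"
    proof -
      have "real p \<le> real (2 * (n div t) ^ 4)" using False by (simp only: of_nat_le_iff not_less)
      also have "\<dots> = 2 * real (n div t) ^ 4" by simp
      also have "\<dots> \<le> 2 * (real n / real t) ^ 4"
        by (intro mult_left_mono power_mono of_nat_div_le_of_nat) auto
      finally show ?thesis .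
    qed
    then have "real t ^ 4 \<le> 2 * real n ^ 4 / real p"
      using t p_pos by (simp add: field_simps)
    also have "\<dots> \<le> 16 * real n ^ 4 / real p" by (intro divide_right_mono) auto
    also have "\<dots> = y ^ 4"
    proof -
      have "(real p powr (-1/4)) ^ 4 = real p powr (-1)" using p_pos by (subst powr_power) auto
      also have "\<dots> = 1 / real p" using p_pos by (subst powr_minus_divide) auto
      finally show ?thesis by (simp add: y_def power_mult_distrib)
    qed
    finally have "real t \<le> y" by (rule power_le_imp_le_base[where n = 3, simplified]) (simp add: y_def)
    then have "t \<in> small" using t by (simp add: small_def)
    have "?Q t \<le> real (\<Sum>\<rho>\<in>{1..<int p}. ?R \<rho>)"
      unfolding of_nat_le_iff by (intro sum_mono2 small_fractions_subset) auto
    then have "?Q t \<le> real s * ?K\<^sup>2" using R by (rule order_trans)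
    also have "\<dots> = (if t \<in> small then real s * ?K\<^sup>2 else 0)" using \<open>t \<in> small\<close> by simp
    finally show ?thesis by (rule add_increasing[rotated]) (simp add: t)
  qed
  have "card small \<le> nat \<lfloor>y\<rfloor>"
  proof -
    have "small \<subseteq> {1..nat \<lfloor>y\<rfloor>}" by (auto simp: small_def le_nat_floor)
    then show ?thesis using card_mono[of "{1..nat \<lfloor>y\<rfloor>}" small] by simp
  qed
  also have "real (nat \<lfloor>y\<rfloor>) \<le> y" by (rule of_nat_floor) (simp add: y_def)
  finally have cs: "real (card small) \<le> y" by simp
  have "energy W L n \<le> (\<Sum>\<rho>\<in>{1..<int p}. ?R \<rho>) + (\<Sum>t\<in>{1..n}. \<Sum>\<rho>\<in>small_fractions p (n div t). ?R \<rho>)"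
    by (rule order_trans[OF energy_le_sum_ratio[OF _ finW] sum_ratio_count_le[OF p n]]) (rule nd)
  then have "real (energy W L n) \<le> real (\<Sum>\<rho>\<in>{1..<int p}. ?R \<rho>) + (\<Sum>t\<in>{1..n}. ?Q t)"
    unfolding of_nat_sum[symmetric] of_nat_add[symmetric] of_nat_le_iff .
  also have "\<dots> \<le> real s * ?K\<^sup>2 + (\<Sum>t\<in>{1..n}. 4 * real s * ?K powr (5/4) * real n * real D * inverse (real t)
      + (if t \<in> small then real s * ?K\<^sup>2 else 0))"
    by (intro add_mono R sum_mono Q)
  also have "\<dots> = real s * ?K\<^sup>2 + 4 * real s * ?K powr (5/4) * real n * real D * harm n
      + real (card small) * (real s * ?K\<^sup>2)"
  proof -
    have "(\<Sum>t\<in>{1..n}. if t \<in> small then real s * ?K\<^sup>2 else 0) = real (card small) * (real s * ?K\<^sup>2)"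
    proof -
      have "{1..n} \<inter> small = small" by (auto simp: small_def)
      then show ?thesis by (simp add: sum.If_cases)
    qed
    then show ?thesis by (simp add: sum.distrib harm_def flip: sum_distrib_left)
  qed
  also have "\<dots> \<le> real s * ?K\<^sup>2 + 4 * real s * ?K powr (5/4) * real n * real D * harm n
      + y * (real s * ?K\<^sup>2)"
    using cs by (intro add_left_mono mult_right_mono) auto
  finally show ?thesis by (simp add: y_def algebra_simps)
qed

text \<open>The same argument for the denominators of a shift, where the congruence of the cross products
  is an equality of integers.\<close>

lemma card_shift_collisions_le:
  assumes n: "2 * n\<^sup>2 < p" and nU: "2 * n * U < p"
    and nd: "\<And>x. x \<in> {L+1..L+int n} \<Longrightarrow> \<not> int p dvd x"
    and D: "\<And>m. m \<in> {1..p} \<Longrightarrow> card {d. d dvd m} \<le> D"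
  shows "real (card {((x, u), (x', u')). (x, u) \<in> {L+1..L+int n} \<times> {1..int U} \<and>
      (x', u') \<in> {L+1..L+int n} \<times> {1..int U} \<and> [x * u' = x' * u] (mod int p)})
    \<le> (real U)\<^sup>2 + 4 * real n * real U * real D * harm n"
proof (cases "n = 0")
  case True
  then show ?thesis by (simp add: case_prod_unfold)
next
  case n0: False
  let ?f = "\<lambda>((x, u), (x', u')). (x, x', (u, u'))"
  let ?ub = "\<lambda>((u, u'), (a, b)). (u, b)"
  let ?a = "\<lambda>((u, u'), (a, b)). a"
  let ?I = "{L+1..L+int n}" and ?U = "{1..int U}"
  let ?c = "\<lambda>x y :: int. [x = y] (mod int p)"
  define J where "J = {((x, u), (x', u')). (x, u) \<in> ?I \<times> ?U \<and> (x', u') \<in> ?I \<times> ?U \<and> ?c (x * u') (x' * u)}"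
  define G where "G \<rho> = {(u, u'). u \<in> ?U \<and> u' \<in> ?U \<and> ?c u (\<rho> * u')}" for \<rho>
  let ?X = "{(x, y, z). x \<in> ?I \<and> y \<in> ?I \<and> z \<in> G (ratio x y)}"
  have finG: "finite (G \<rho>)" for \<rho> by (rule finite_subset[of _ "?U \<times> ?U"]) (auto simp: G_def)
  have Up: "int U < int p"
  proof -
    have "U \<le> 2 * n * U" using n0 by simp
    then show ?thesis using nU by linarith
  qed
  have ndU: "\<not> int p dvd u" if "u \<in> ?U" for u using that Up by (intro not_dvd_range) auto
  have G_unique: "\<rho> = \<sigma>" if "u \<in> G \<rho>" "u \<in> G \<sigma>" "\<rho> \<in> {1..<int p}" "\<sigma> \<in> {1..<int p}" for u \<rho> \<sigma>
  proof -
    obtain v w where u: "u = (v, w)" by (cases u)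
    have "?c (\<rho> * w) (\<sigma> * w)" using that(1,2) unfolding u G_def by (metis (no_types, lifting) case_prodD cong_sym cong_trans mem_Collect_eq)
    moreover have "w \<in> ?U" using that(1) by (simp add: u G_def)
    ultimately have "?c \<rho> \<sigma>" using cong_mult_cancel[OF ndU] by metis
    then show ?thesis by (intro cong_range_eq) (use that in auto)
  qed
  have "card J \<le> card ?X"
  proof (rule card_inj_on_le[where f = "?f"])
    show "inj_on ?f J" by (auto intro!: inj_onI)
    show "finite ?X"
      by (rule finite_subset[of _ "?I \<times> ?I \<times> (?U \<times> ?U)"]) (auto simp: G_def)
    show "?f ` J \<subseteq> ?X"
    proof (rule image_subsetI)
      fix t assume "t \<in> J"
      then obtain x u x' u' where t: "t = ((x, u), (x', u'))" and x: "x \<in> ?I" "x' \<in> ?I"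
        and u: "u \<in> ?U" "u' \<in> ?U" and c: "?c (x * u') (x' * u)" unfolding J_def by auto
      have "?c (u * x') (x * u')" using c by (simp add: mult.commute cong_sym_eq)
      also have "?c (x * u') (ratio x x' * x' * u')"
        by (intro cong_mult cong_refl ratio nd x)
      also have "ratio x x' * x' * u' = ratio x x' * u' * x'" by (simp add: mult_ac)
      finally have "?c u (ratio x x' * u')" by (rule cong_mult_cancel[OF nd[OF x(2)]])
      then show "?f t \<in> ?X"
        unfolding t G_def using x u by simp
    qed
  qed
  also have "\<dots> \<le> (\<Sum>\<rho>\<in>{1..<int p}. ratio_count p L n \<rho> * card (G \<rho>))"
    by (rule card_by_ratio_le[OF nd finG])
  also have "\<dots> \<le> (\<Sum>\<rho>\<in>{1..<int p}. card (G \<rho>)) + (\<Sum>t\<in>{1..n}. \<Sum>\<rho>\<in>small_fractions p (n div t). card (G \<rho>))"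
    by (rule sum_ratio_count_le[OF p n])
  finally have 1: "card J \<le> (\<Sum>\<rho>\<in>{1..<int p}. card (G \<rho>)) + (\<Sum>t\<in>{1..n}. \<Sum>\<rho>\<in>small_fractions p (n div t). card (G \<rho>))" .
  have sumG: "(\<Sum>\<rho>\<in>A. card (G \<rho>)) = card (\<Union>\<rho>\<in>A. G \<rho>)" if "A \<subseteq> {1..<int p}" for A
    by (rule card_UN_disjoint[symmetric])
      (use that finG G_unique finite_subset[OF that] in blast)+
  have "(\<Sum>\<rho>\<in>{1..<int p}. card (G \<rho>)) \<le> card (?U \<times> ?U)"
    unfolding sumG[OF order.refl] by (intro card_mono) (auto simp: G_def)
  then have 2: "(\<Sum>\<rho>\<in>{1..<int p}. card (G \<rho>)) \<le> U\<^sup>2"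
    by (simp add: card_cartesian_product power2_eq_square)
  have 3: "(\<Sum>\<rho>\<in>small_fractions p h. card (G \<rho>)) \<le> 4 * h * U * D" if h: "h \<le> n" for h
  proof -
    define H where "H = {- int h..int h} - {0}"
    have cH: "card H = 2 * h"
    unfolding H_def by (subst card_Diff_singleton) auto
    define S where "S = {((u, u'), (a, b)). u \<in> ?U \<and> u' \<in> ?U \<and> a \<in> H \<and> b \<in> H \<and> a * u' = u * b}"
    have finS: "finite S"
      unfolding S_def by (rule finite_subset[of _ "(?U \<times> ?U) \<times> (H \<times> H)"]) (auto simp: H_def)
    have "(\<Union>\<rho>\<in>small_fractions p h. G \<rho>) \<subseteq> fst ` S"
    proof
      fix t assume "t \<in> (\<Union>\<rho>\<in>small_fractions p h. G \<rho>)"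
      then obtain \<rho> u u' where \<rho>: "\<rho> \<in> small_fractions p h" and t: "t = (u, u')"
        and u: "u \<in> ?U" "u' \<in> ?U" and c: "?c u (\<rho> * u')" by (auto simp: G_def)
      obtain a b where ab: "a \<noteq> 0" "b \<noteq> 0" "\<bar>a\<bar> \<le> int h" "\<bar>b\<bar> \<le> int h" "?c a (\<rho> * b)"
        using \<rho> by (auto simp: small_fractions_def)
      have "?c (a * u') (\<rho> * b * u')" by (intro cong_mult ab cong_refl)
      also have "\<rho> * b * u' = \<rho> * u' * b" by (simp add: mult_ac)
      also have "?c (\<rho> * u' * b) (u * b)" by (intro cong_mult cong_refl cong_sym[OF c])
      finally have cc: "?c (a * u') (u * b)" .
      have "a * u' = u * b"
      proof (rule ccontr)
        assume ne: "a * u' \<noteq> u * b"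
        have "int p dvd \<bar>a * u' - u * b\<bar>" using cc by (simp add: cong_iff_dvd_diff)
        then have "int p \<le> \<bar>a * u' - u * b\<bar>" using ne by (intro zdvd_imp_le) auto
        also have "\<dots> \<le> \<bar>a\<bar> * \<bar>u'\<bar> + \<bar>u\<bar> * \<bar>b\<bar>"
          using abs_triangle_ineq4[of "a * u'" "u * b"] by (simp add: abs_mult)
        also have "\<dots> \<le> int n * int U + int U * int n"
          using ab u h by (intro add_mono mult_mono) auto
        also have "\<dots> = int (2 * n * U)" by simp
        also have "\<dots> < int p" using nU by (simp only: of_nat_less_iff)
        finally show False by simp
      qed
      moreover have "a \<in> H" "b \<in> H" using ab(1-4) by (simp_all add: H_def abs_le_iff)
      ultimately have "((u, u'), (a, b)) \<in> S" using u by (simp add: S_def)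
      then have "fst ((u, u'), (a, b)) \<in> fst ` S" by (rule imageI)
      then show "t \<in> fst ` S" by (simp add: t)
    qed
    then have "card (\<Union>\<rho>\<in>small_fractions p h. G \<rho>) \<le> card (fst ` S)"
      using finS by (intro card_mono) auto
    also have "\<dots> \<le> card S" by (rule card_image_le[OF finS])
    also have "\<dots> \<le> card (?U \<times> H) * (2 * D)"
    proof (rule card_le_fibres[where f = "?ub"])
      show "finite S" by (rule finS)
      show "finite (?U \<times> H)" by (simp add: H_def)
      show "?ub ` S \<subseteq> ?U \<times> H" by (auto simp: S_def)
      fix y assume "y \<in> ?U \<times> H"
      then obtain u b where y: "y = (u, b)" and u: "u \<in> ?U" and b: "b \<in> H" by auto
      have ub0: "u * b \<noteq> 0" using u b by (auto simp: H_def)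
      have "\<bar>u * b\<bar> \<le> int U * int n"
        unfolding abs_mult using u b h by (intro mult_mono) (auto simp: H_def)
      also have "\<dots> = int (n * U)" by simp
      also have "\<dots> \<le> int p" using nU by linarith
      finally have "\<bar>u * b\<bar> \<le> int p" .
      moreover have "\<bar>u * b\<bar> > 0" by (rule zero_less_abs_iff[THEN iffD2, OF ub0])
      ultimately have "nat \<bar>u * b\<bar> \<in> {1..p}" unfolding atLeastAtMost_iff by linarith
      then have d: "card {d. d dvd u * b} \<le> 2 * D"
        using card_int_divisors_le(2)[OF ub0] D by (meson le_trans mult_le_mono2)
      have "card {x \<in> S. ?ub x = y} \<le> card {d. d dvd u * b}"
      proof (rule card_inj_on_le[where f = "?a"])
        show "inj_on ?a {x \<in> S. ?ub x = y}"
        proof (rule inj_onI)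
          fix t t' assume tt: "t \<in> {x \<in> S. ?ub x = y}"
              "t' \<in> {x \<in> S. ?ub x = y}"
            and eq: "?a t = ?a t'"
          obtain u1 v1 a1 b1 where t: "t = ((u1, v1), (a1, b1))" by (metis prod.exhaust)
          obtain u2 v2 a2 b2 where t': "t' = ((u2, v2), (a2, b2))" by (metis prod.exhaust)
          have eqs: "u1 = u" "u2 = u" "b1 = b" "b2 = b" "a2 = a1" using tt eq unfolding t t' y by simp_all
          have "a1 * v1 = u * b" "a1 * v2 = u * b" "a1 \<noteq> 0"
            using tt eqs unfolding t t' S_def H_def by simp_all
          then have "v1 = v2" by (metis mult_cancel_left)
          then show "t = t'" using t t' eqs by simp
        qed
        show "?a ` {x \<in> S. ?ub x = y} \<subseteq> {d. d dvd u * b}"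
        proof (rule image_subsetI)
          fix t assume tt: "t \<in> {x \<in> S. ?ub x = y}"
          obtain u1 v1 a1 b1 where t: "t = ((u1, v1), (a1, b1))" by (metis prod.exhaust)
          have "a1 * v1 = u * b" using tt unfolding t y S_def by simp
          then show "?a t \<in> {d. d dvd u * b}"
            unfolding t by (simp flip: \<open>a1 * v1 = u * b\<close>)
        qed
        show "finite {d. d dvd u * b}" by (rule card_int_divisors_le(1)[OF ub0])
      qed
      then show "card {x \<in> S. ?ub x = y} \<le> 2 * D" using d by linarith
    qed
    also have "\<dots> = 4 * h * U * D" by (simp add: card_cartesian_product cH)
    finally show ?thesis
      using sumG[OF small_fractions_subset] by simp
  qed
  have "real (card J) \<le> real (\<Sum>\<rho>\<in>{1..<int p}. card (G \<rho>))
      + (\<Sum>t\<in>{1..n}. real (\<Sum>\<rho>\<in>small_fractions p (n div t). card (G \<rho>)))"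
    using 1 unfolding of_nat_sum[symmetric] of_nat_add[symmetric] of_nat_le_iff .
  also have "\<dots> \<le> real (U\<^sup>2) + (\<Sum>t\<in>{1..n}. 4 * real U * real D * real n * inverse (real t))"
  proof (intro add_mono sum_mono)
    show "real (\<Sum>\<rho>\<in>{1..<int p}. card (G \<rho>)) \<le> real (U\<^sup>2)" using 2 by (simp only: of_nat_le_iff)
    fix t assume t: "t \<in> {1..n}"
    have "real (\<Sum>\<rho>\<in>small_fractions p (n div t). card (G \<rho>)) \<le> real (4 * (n div t) * U * D)"
      using 3[of "n div t"] by (simp only: of_nat_le_iff div_le_dividend)
    also have "\<dots> = 4 * real U * real D * real (n div t)" by simp
    also have "\<dots> \<le> 4 * real U * real D * (real n / real t)"
      by (intro mult_left_mono of_nat_div_le_of_nat) auto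
    finally show "real (\<Sum>\<rho>\<in>small_fractions p (n div t). card (G \<rho>)) \<le> 4 * real U * real D * real n * inverse (real t)"
      by (simp add: divide_inverse mult_ac)
  qed
  also have "\<dots> = (real U)\<^sup>2 + 4 * real n * real U * real D * harm n"
    by (simp add: harm_def flip: sum_distrib_left)
  finally show ?thesis unfolding J_def .
qed

end

section \<open>Moments of short sums of reciprocal powers\<close>

text \<open>Such a function factors through the set of the first \<open>r\<close> numbers.\<close>

lemma card_functions_small_image_le:
  fixes I :: "int set"
  assumes I: "finite I" and k: "k > 0"
  shows "card {g \<in> Pi\<^sub>E {..<k} (\<lambda>_. I). card (g ` {..<k}) \<le> r} \<le> r ^ k * card I ^ r"
proof -
  let ?G = "{g \<in> Pi\<^sub>E {..<k} (\<lambda>_. I). card (g ` {..<k}) \<le> r}"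
  let ?H = "Pi\<^sub>E {..<k} (\<lambda>_. {..<r})" and ?F = "Pi\<^sub>E {..<r} (\<lambda>_. I)"
  let ?c = "\<lambda>(h, f). (\<lambda>i\<in>{..<k}. f (h i))"
  have "?G \<subseteq> ?c ` (?H \<times> ?F)"
  proof
    fix g assume g: "g \<in> ?G"
    then have gI: "g i \<in> I" if "i < k" for i using that by auto
    let ?Y = "g ` {..<k}"
    have "card ?Y \<le> card {..<r}" using g by simp
    then obtain e where e: "e ` ?Y \<subseteq> {..<r}" "inj_on e ?Y"
      using card_le_inj[of ?Y "{..<r}"] by auto
    define h where "h = (\<lambda>i\<in>{..<k}. e (g i))"
    define f where "f = (\<lambda>j\<in>{..<r}. if j \<in> e ` ?Y then the_inv_into ?Y e j else g 0)"
    have "h \<in> ?H" using e(1) by (auto simp: h_def)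
    moreover have "f j \<in> I" if "j < r" for j
    proof (cases "j \<in> e ` ?Y")
      case True
      then have "the_inv_into ?Y e j \<in> ?Y" using e(2) by (intro the_inv_into_into) auto
      then show ?thesis using that True gI by (auto simp: f_def)
    next
      case False
      then show ?thesis using that gI[OF k] by (simp add: f_def)
    qed
    then have "f \<in> ?F" by (auto simp: f_def)
    moreover have "g = ?c (h, f)"
    proof
      fix i
      show "g i = ?c (h, f) i"
      proof (cases "i < k")
        case True
        then have "e (g i) \<in> {..<r}" "e (g i) \<in> e ` ?Y" using e(1) by auto
        moreover have "the_inv_into ?Y e (e (g i)) = g i"
          using True by (intro the_inv_into_f_f e(2)) auto
        ultimately show ?thesis using True by (simp add: h_def f_def)
      next
        case False
        have "g \<in> Pi\<^sub>E {..<k} (\<lambda>_. I)" using g by simp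
        then have "g i = undefined" by (rule PiE_arb) (simp add: False)
        then show ?thesis using False by simp
      qed
    qed
    ultimately show "g \<in> ?c ` (?H \<times> ?F)" by blast
  qed
  moreover have fin: "finite (?H \<times> ?F)" using I by (intro finite_cartesian_product finite_PiE) auto
  ultimately have "card ?G \<le> card (?c ` (?H \<times> ?F))" by (intro card_mono finite_imageI)
  also have "\<dots> \<le> card (?H \<times> ?F)" using fin by (rule card_image_le)
  also have "\<dots> = r ^ k * card I ^ r" by (simp add: card_cartesian_product card_PiE)
  finally show ?thesis .
qed

text \<open>Otherwise each value would be taken at least twice.\<close>

lemma ex_unique_value:
  assumes "r < card (g ` {..<2 * r})"
  shows "\<exists>j<2 * r. \<forall>l<2 * r. l \<noteq> j \<longrightarrow> g l \<noteq> g j"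
proof (rule ccontr)
  assume neg: "\<not> ?thesis"
  have two: "2 \<le> card {i \<in> {..<2 * r}. g i = y}" if y: "y \<in> g ` {..<2 * r}" for y
  proof -
    obtain j where j: "j < 2 * r" "y = g j" using y by auto
    obtain l where l: "l < 2 * r" "l \<noteq> j" "g l = g j" using neg j(1) by blast
    have "card {j, l} \<le> card {i \<in> {..<2 * r}. g i = y}" using j l by (intro card_mono) auto
    then show ?thesis using l(2) by simp
  qed
  have "(\<Sum>y\<in>g ` {..<2 * r}. 2) \<le> (\<Sum>y\<in>g ` {..<2 * r}. card {i \<in> {..<2 * r}. g i = y})"
    using two by (rule sum_mono)
  also have "\<dots> = card {..<2 * r}"
    using sum.group[of "{..<2 * r}" "g ` {..<2 * r}" g "\<lambda>_. 1::nat"] by simp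
  finally have "2 * card (g ` {..<2 * r}) \<le> 2 * r" by simp
  then show False using assms by simp
qed

context reciprocal_powers
begin

text \<open>If one of the values occurs only once, then multiplication by all the \<open>(B + g k) ^ s\<close> turns
  the congruence into a polynomial equation for \<open>B\<close>, which is nontrivial since the polynomial does
  not vanish at the pole that occurs once.\<close>

lemma card_reciprocal_sum_zeros_le:
  fixes g :: "nat \<Rightarrow> int" and \<epsilon> :: "nat \<Rightarrow> int"
  assumes \<epsilon>: "\<And>k. \<epsilon> k \<in> {1, -1}"
    and gV: "\<And>k. k < q \<Longrightarrow> g k \<in> {1..int V}" and V: "V < p"
    and j: "j < q" "\<And>l. l < q \<Longrightarrow> l \<noteq> j \<Longrightarrow> g l \<noteq> g j"
  shows "card {B \<in> {0..<int p}. int p dvd (\<Sum>k<q. \<epsilon> k * recip_pow (B + g k))} \<le> q * (s + 1)"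
proof -
  define F where "F = (\<Sum>k<q. smult (\<epsilon> k) (\<Prod>l\<in>{..<q} - {k}. [:g l, 1:] ^ s))"
  have pF: "poly F B = (\<Sum>k<q. \<epsilon> k * (\<Prod>l\<in>{..<q} - {k}. (B + g l) ^ s))" for B
    by (simp add: F_def poly_sum poly_prod add.commute)
  have nz: "\<not> int p dvd poly F (- g j)"
  proof
    assume dvd: "int p dvd poly F (- g j)"
    have "poly F (- g j) = (\<Sum>k\<in>{j}. \<epsilon> k * (\<Prod>l\<in>{..<q} - {k}. (- g j + g l) ^ s))"
      unfolding pF
    proof (rule sum.mono_neutral_right)
      show "\<forall>i\<in>{..<q} - {j}. \<epsilon> i * (\<Prod>l\<in>{..<q} - {i}. (- g j + g l) ^ s) = 0"
      proof
        fix i assume i: "i \<in> {..<q} - {j}"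
        have "(\<Prod>l\<in>{..<q} - {i}. (- g j + g l) ^ s) = 0"
          by (rule prod_zero) (use i j s in \<open>auto intro!: bexI[of _ j]\<close>)
        then show "\<epsilon> i * (\<Prod>l\<in>{..<q} - {i}. (- g j + g l) ^ s) = 0" by simp
      qed
    qed (use j in auto)
    then have "int p dvd \<epsilon> j * (\<Prod>l\<in>{..<q} - {j}. (- g j + g l) ^ s)" using dvd by simp
    then have "int p dvd (\<Prod>l\<in>{..<q} - {j}. (- g j + g l) ^ s)" using \<epsilon>[of j] by auto
    then have "\<exists>l\<in>{..<q} - {j}. int p dvd (- g j + g l) ^ s"
      by (subst (asm) prime_dvd_prod_iff[OF _ prime_int_p]) auto
    then obtain l where l: "l \<in> {..<q} - {j}" "int p dvd (- g j + g l) ^ s" by blast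
    then have "int p dvd - g j + g l" using not_dvd_power by blast
    then have "int p dvd \<bar>g l - g j\<bar>" by (simp add: add.commute)
    moreover have "\<bar>g l - g j\<bar> > 0" using j(2)[of l] l(1) by auto
    ultimately have "int p \<le> \<bar>g l - g j\<bar>" by (intro zdvd_imp_le)
    moreover have "\<bar>g l - g j\<bar> < int V" using gV[of l] gV[of j] l(1) j(1) by auto
    ultimately show False using V by linarith
  qed
  have degF: "degree F \<le> q * s"
    unfolding F_def
  proof (rule degree_sum_le)
    fix k assume k: "k \<in> {..<q}"
    have "degree (smult (\<epsilon> k) (\<Prod>l\<in>{..<q} - {k}. [:g l, 1:] ^ s))
        \<le> degree (\<Prod>l\<in>{..<q} - {k}. [:g l, 1:] ^ s)" by (rule degree_smult_le)
    also have "\<dots> \<le> (\<Sum>l\<in>{..<q} - {k}. degree ([:g l, 1:] ^ s))"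
      using degree_prod_sum_le[of "{..<q} - {k}" "\<lambda>l. [:g l, 1:] ^ s"] by simp
    also have "\<dots> \<le> (\<Sum>l\<in>{..<q} - {k}. s)"
      using degree_power_le[of "[:_, 1::int:]" s] by (intro sum_mono) (simp add: degree_linear_power)
    also have "\<dots> \<le> q * s" by (simp add: card_Diff_singleton_if)
    finally show "degree (smult (\<epsilon> k) (\<Prod>l\<in>{..<q} - {k}. [:g l, 1:] ^ s)) \<le> q * s" .
  qed simp
  let ?R = "\<lambda>f :: int poly. {z \<in> {0..<int p}. int p dvd poly f z}"
  have fin: "finite (?R f)" for f by (rule finite_subset[of _ "{0..<int p}"]) auto
  have sub: "{B \<in> {0..<int p}. int p dvd (\<Sum>k<q. \<epsilon> k * recip_pow (B + g k))}
      \<subseteq> ?R F \<union> (\<Union>k<q. ?R [:g k, 1:])"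
  proof
    fix B assume B: "B \<in> {B \<in> {0..<int p}. int p dvd (\<Sum>k<q. \<epsilon> k * recip_pow (B + g k))}"
    show "B \<in> ?R F \<union> (\<Union>k<q. ?R [:g k, 1:])"
    proof (cases "\<exists>k<q. int p dvd B + g k")
      case True
      then show ?thesis using B by (auto simp: add.commute)
    next
      case False
      let ?P = "\<Prod>l<q. (B + g l) ^ s"
      have "[poly F B = (\<Sum>k<q. ?P * (\<epsilon> k * recip_pow (B + g k)))] (mod int p)"
        unfolding pF
      proof (rule cong_sum)
        fix k assume k: "k \<in> {..<q}"
        let ?Q = "\<Prod>l\<in>{..<q} - {k}. (B + g l) ^ s"
        have "?P = (B + g k) ^ s * ?Q" using k by (intro prod.remove) auto
        then have eq: "?P * (\<epsilon> k * recip_pow (B + g k)) = \<epsilon> k * ?Q * ((B + g k) ^ s * recip_pow (B + g k))"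
          by (simp add: mult_ac)
        have "[\<epsilon> k * ?Q * ((B + g k) ^ s * recip_pow (B + g k)) = \<epsilon> k * ?Q * 1] (mod int p)"
          using False k by (intro cong_mult cong_refl recip_pow_inverse) auto
        then show "[\<epsilon> k * ?Q = ?P * (\<epsilon> k * recip_pow (B + g k))] (mod int p)"
          unfolding eq by (simp add: cong_sym_eq)
      qed
      also have "(\<Sum>k<q. ?P * (\<epsilon> k * recip_pow (B + g k))) = ?P * (\<Sum>k<q. \<epsilon> k * recip_pow (B + g k))"
        by (simp add: sum_distrib_left)
      finally have "int p dvd poly F B" using B by (simp add: cong_dvd_iff)
      then show ?thesis using B by simp
    qed
  qed
  have "card {B \<in> {0..<int p}. int p dvd (\<Sum>k<q. \<epsilon> k * recip_pow (B + g k))}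
      \<le> card (?R F \<union> (\<Union>k<q. ?R [:g k, 1:]))"
    by (rule card_mono[OF _ sub]) (intro finite_UnI finite_UN_I fin finite_lessThan)
  also have "\<dots> \<le> card (?R F) + card (\<Union>k<q. ?R [:g k, 1:])" by (rule card_Un_le)
  also have "card (?R F) \<le> q * s" using card_poly_roots_mod_prime_le[OF p nz] degF by (rule order_trans)
  also have "card (\<Union>k<q. ?R [:g k, 1:]) \<le> (\<Sum>k<q. card (?R [:g k, 1:]))" by (rule card_UN_le) simp
  also have "\<dots> \<le> (\<Sum>k<q. 1)"
  proof (rule sum_mono)
    fix k
    have "\<not> int p dvd poly [:g k, 1:] (1 - g k)" using prime_int_p by (simp add: prime_int_iff)
    from card_poly_roots_mod_prime_le[OF p this] show "card (?R [:g k, 1:]) \<le> 1" by simp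
  qed
  finally show ?thesis by (simp add: algebra_simps)
qed

text \<open>The moment counts the \<open>B\<close> and the \<open>2 * r\<close>-tuples of values \<open>v\<close> for which a signed sum of reciprocal powers
vanishes. Tuples with at most \<open>r\<close> distinct values are few, and every other tuple has a value that
occurs once, hence boundedly many \<open>B\<close>.\<close>

lemma reciprocal_moment_le:
  assumes V: "V < p" and r: "r > 0"
  shows "(\<Sum>A\<in>{0..<int p}. \<Sum>B\<in>{0..<int p}.
      (norm (\<Sum>v\<in>{1..int V}. add_char p (A * recip_pow (B + v)))) ^ (2 * r))
    \<le> real p * (real V ^ (2 * r) * (2 * real r * (real s + 1)) + real r ^ (2 * r) * real V ^ r * real p)"
proof -
  let ?I = "{1..int V}" and ?Fp = "{0..<int p}"
  let ?P = "Pi\<^sub>E {..<2 * r} (\<lambda>_. ?I)"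
  let ?h = "\<lambda>B g. (\<Sum>k<2 * r. (if k < r then recip_pow (B + g k) else - recip_pow (B + g k)))"
  let ?small = "{g \<in> ?P. card (g ` {..<2 * r}) \<le> r}"
  have finP: "finite ?P" by (intro finite_PiE) auto
  have zeros: "card {B \<in> ?Fp. int p dvd ?h B g} \<le> 2 * r * (s + 1) + (if g \<in> ?small then p else 0)"
    if g: "g \<in> ?P" for g
  proof (cases "g \<in> ?small")
    case True
    have "card {B \<in> ?Fp. int p dvd ?h B g} \<le> card ?Fp" by (intro card_mono) auto
    then show ?thesis using True by simp
  next
    case False
    then have "r < card (g ` {..<2 * r})" using g by auto
    then obtain j where j: "j < 2 * r" "\<And>l. l < 2 * r \<Longrightarrow> l \<noteq> j \<Longrightarrow> g l \<noteq> g j"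
      using ex_unique_value by meson
    define \<epsilon> :: "nat \<Rightarrow> int" where "\<epsilon> k = (if k < r then 1 else -1)" for k
    have "?h B g = (\<Sum>k<2 * r. \<epsilon> k * recip_pow (B + g k))" for B
      by (intro sum.cong) (auto simp: \<epsilon>_def)
    moreover have "card {B \<in> ?Fp. int p dvd (\<Sum>k<2 * r. \<epsilon> k * recip_pow (B + g k))} \<le> 2 * r * (s + 1)"
      by (rule card_reciprocal_sum_zeros_le[where V = V and j = j]) (use g j V in \<open>auto simp: \<epsilon>_def\<close>)
    ultimately show ?thesis by simp
  qed
  have "(\<Sum>A\<in>?Fp. \<Sum>B\<in>?Fp. (norm (\<Sum>v\<in>?I. add_char p (A * recip_pow (B + v)))) ^ (2 * r))
     = (\<Sum>B\<in>?Fp. \<Sum>A\<in>?Fp. (norm (\<Sum>v\<in>?I. add_char p (A * recip_pow (B + v)))) ^ (2 * r))"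
    by (rule sum.swap)
  also have "\<dots> = (\<Sum>B\<in>?Fp. real p * real (card {g \<in> ?P. int p dvd ?h B g}))"
    using even_moment_eq[OF p_pos, of ?I _ r] by simp
  also have "\<dots> = real p * real (\<Sum>B\<in>?Fp. card {g \<in> ?P. int p dvd ?h B g})"
    by (simp add: sum_distrib_left)
  finally have eq: "(\<Sum>A\<in>?Fp. \<Sum>B\<in>?Fp. (norm (\<Sum>v\<in>?I. add_char p (A * recip_pow (B + v)))) ^ (2 * r))
    = real p * real (\<Sum>B\<in>?Fp. card {g \<in> ?P. int p dvd ?h B g})" .
  have sum_if: "(\<Sum>g\<in>P. a + (if g \<in> S then b else 0)) = card P * a + card S * b"
    if "finite P" "S \<subseteq> P" for P S :: "(nat \<Rightarrow> int) set" and a b :: nat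
    using that by (simp add: sum.distrib sum.If_cases Int_absorb1)
  have "(\<Sum>B\<in>?Fp. card {g \<in> ?P. int p dvd ?h B g}) = (\<Sum>g\<in>?P. card {B \<in> ?Fp. int p dvd ?h B g})"
    by (rule sum_card_swap[OF _ finP]) simp
  also have "\<dots> \<le> (\<Sum>g\<in>?P. 2 * r * (s + 1) + (if g \<in> ?small then p else 0))"
    by (rule sum_mono[OF zeros])
  also have "\<dots> = card ?P * (2 * r * (s + 1)) + card ?small * p"
    by (rule sum_if[OF finP]) (rule Collect_restrict)
  also have "\<dots> \<le> V ^ (2 * r) * (2 * r * (s + 1)) + r ^ (2 * r) * V ^ r * p"
  proof (rule add_mono)
    show "card ?P * (2 * r * (s + 1)) \<le> V ^ (2 * r) * (2 * r * (s + 1))" by (simp add: card_PiE)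
    have "card ?small \<le> r ^ (2 * r) * card ?I ^ r"
      using r by (intro card_functions_small_image_le) auto
    then show "card ?small * p \<le> r ^ (2 * r) * V ^ r * p" by simp
  qed
  finally have "real (\<Sum>B\<in>?Fp. card {g \<in> ?P. int p dvd ?h B g})
    \<le> real (V ^ (2 * r) * (2 * r * (s + 1)) + r ^ (2 * r) * V ^ r * p)"
    by (simp only: of_nat_le_iff)
  also have "\<dots> = real V ^ (2 * r) * (2 * real r * (real s + 1)) + real r ^ (2 * r) * real V ^ r * real p"
    by (simp add: distrib_left)
  finally show ?thesis unfolding eq by (rule mult_left_mono) simp
qed

end

section \<open>The bilinear sum\<close>

text \<open>Three applications of Cauchy--Schwarz. Only the last one has to take into account how often \<open>\<phi>\<close>
repeats a value, so the repetitions enter to the first power.\<close>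

lemma sum_eighth_power_le:
  fixes G :: "'b \<Rightarrow> real"
  assumes T: "finite T" and Q: "finite Q" and \<phi>: "\<phi> ` T \<subseteq> Q" and G: "\<And>q. G q \<ge> 0"
  shows "(\<Sum>t\<in>T. G (\<phi> t)) ^ 8
    \<le> real (card T) ^ 6 * real (card {(t, t'). t \<in> T \<and> t' \<in> T \<and> \<phi> t = \<phi> t'}) * (\<Sum>q\<in>Q. G q ^ 8)"
proof -
  let ?S = "\<lambda>k. \<Sum>t\<in>T. G (\<phi> t) ^ k"
  let ?n = "real (card T)"
  define \<nu> where "\<nu> q = card {t \<in> T. \<phi> t = q}" for q
  have S: "?S k \<ge> 0" for k by (intro sum_nonneg zero_le_power G)
  have sq: "(?S k)\<^sup>2 \<le> ?n * ?S (2 * k)" for k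
    using sum_squared_le_sum_of_squares[of "\<lambda>t. G (\<phi> t) ^ k" T]
    by (simp add: mult.commute power_mult[symmetric])
  have "?S 4 = (\<Sum>q\<in>Q. \<Sum>t\<in>{t \<in> T. \<phi> t = q}. G (\<phi> t) ^ 4)"
    using T Q \<phi> by (intro sum.group[symmetric])
  also have "\<dots> = (\<Sum>q\<in>Q. real (\<nu> q) * G q ^ 4)" by (simp add: \<nu>_def)
  finally have "(?S 4)\<^sup>2 \<le> (\<Sum>q\<in>Q. (real (\<nu> q))\<^sup>2) * (\<Sum>q\<in>Q. (G q ^ 4)\<^sup>2)"
    using Cauchy_Schwarz_ineq_sum[of "\<lambda>q. real (\<nu> q)" "\<lambda>q. G q ^ 4" Q] by simp
  moreover have "(\<Sum>q\<in>Q. (real (\<nu> q))\<^sup>2) = real (card {(t, t'). t \<in> T \<and> t' \<in> T \<and> \<phi> t = \<phi> t'})"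
  proof -
    have "{(t, t'). t \<in> T \<and> t' \<in> T \<and> \<phi> t = \<phi> t'}
        = (\<Union>q\<in>Q. {t \<in> T. \<phi> t = q} \<times> {t \<in> T. \<phi> t = q})" using \<phi> by auto
    also have "card \<dots> = (\<Sum>q\<in>Q. card ({t \<in> T. \<phi> t = q} \<times> {t \<in> T. \<phi> t = q}))"
      using T Q by (intro card_UN_disjoint) auto
    finally show ?thesis by (simp add: card_cartesian_product \<nu>_def power2_eq_square)
  qed
  ultimately have 4: "(?S 4)\<^sup>2 \<le> real (card {(t, t'). t \<in> T \<and> t' \<in> T \<and> \<phi> t = \<phi> t'}) * (\<Sum>q\<in>Q. G q ^ 8)"
    by (simp add: power_mult[symmetric])
  have "(?S 1) ^ 8 = ((?S 1)\<^sup>2) ^ 4" by (simp flip: power_mult)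
  also have "\<dots> \<le> (?n * ?S 2) ^ 4" using sq[of 1] by (intro power_mono) (auto simp: numeral_eq_Suc)
  also have "\<dots> = ?n ^ 4 * ((?S 2)\<^sup>2)\<^sup>2" by (simp add: power_mult_distrib flip: power_mult)
  also have "\<dots> \<le> ?n ^ 4 * (?n * ?S 4)\<^sup>2" using sq[of 2] by (intro mult_left_mono power_mono) auto
  also have "\<dots> = ?n ^ 6 * (?S 4)\<^sup>2" by (simp add: power_mult_distrib mult.assoc[symmetric] flip: power_add)
  also have "\<dots> \<le> ?n ^ 6 * (real (card {(t, t'). t \<in> T \<and> t' \<in> T \<and> \<phi> t = \<phi> t'}) * (\<Sum>q\<in>Q. G q ^ 8))"
    using 4 by (intro mult_left_mono) auto
  finally show ?thesis by (simp add: mult.assoc)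
qed

lemma norm_sum_shift_le:
  fixes f :: "int \<Rightarrow> complex"
  assumes f: "\<And>x. norm (f x) \<le> 1" and k: "k \<ge> 0"
  shows "norm ((\<Sum>x\<in>{L+1..L+int n}. f x) - (\<Sum>x\<in>{L+1..L+int n}. f (x + k))) \<le> 2 * real_of_int k"
proof -
  let ?A = "{L+1..L+int n}" and ?B = "{L+k+1..L+k+int n}"
  have "(\<Sum>x\<in>?A. f (x + k)) = (\<Sum>x\<in>?B. f x)"
    by (rule sum.reindex_bij_witness[of _ "\<lambda>x. x - k" "\<lambda>x. x + k"]) auto
  moreover have "(\<Sum>x\<in>?A. f x) = (\<Sum>x\<in>?A - ?B. f x) + (\<Sum>x\<in>?A \<inter> ?B. f x)"
    by (metis add.commute finite_atLeastAtMost_int sum.Int_Diff)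
  moreover have "(\<Sum>x\<in>?B. f x) = (\<Sum>x\<in>?B - ?A. f x) + (\<Sum>x\<in>?A \<inter> ?B. f x)"
    by (metis Int_commute add.commute finite_atLeastAtMost_int sum.Int_Diff)
  ultimately have "norm ((\<Sum>x\<in>?A. f x) - (\<Sum>x\<in>?A. f (x + k))) = norm ((\<Sum>x\<in>?A - ?B. f x) - (\<Sum>x\<in>?B - ?A. f x))"
    by simp
  also have "\<dots> \<le> norm (\<Sum>x\<in>?A - ?B. f x) + norm (\<Sum>x\<in>?B - ?A. f x)" by (rule norm_triangle_ineq4)
  also have "\<dots> \<le> real (card (?A - ?B)) + real (card (?B - ?A))"
  proof -
    have "norm (\<Sum>x\<in>X. f x) \<le> real (card X)" for X
      using sum_norm_le[of X f "\<lambda>_. 1"] f by simp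
    then show ?thesis by (intro add_mono)
  qed
  also have "card (?A - ?B) \<le> card {L+1..L+k}" using k by (intro card_mono) auto
  also have "card (?B - ?A) \<le> card {L+int n+1..L+int n+k}" using k by (intro card_mono) auto
  finally show ?thesis using k by simp
qed

context reciprocal_powers
begin

definition bilinear_sum :: "int set \<Rightarrow> int \<Rightarrow> nat \<Rightarrow> int \<Rightarrow> complex" where
  "bilinear_sum M L n a = (\<Sum>m\<in>M. \<Sum>x\<in>{L+1..L+int n}. add_char p (a * (m * recip_pow x)))"

text \<open>Replace \<open>x\<close> by \<open>x + u * v\<close> and take out \<open>u\<close>, so that the sum over \<open>v\<close> depends on the other
  variables only through the residues of \<open>a * m / u ^ s\<close> and \<open>x / u\<close>. These pairs are nearly
  distinct, and over all pairs the eighth moment of the sum over \<open>v\<close> is known.\<close>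

lemma norm_bilinear_sum_shift_le:
  assumes M: "M \<subseteq> {1..<int p}" and a: "\<not> int p dvd a"
    and n: "2 * n\<^sup>2 < p" and nU: "2 * n * U < p" and V: "V < p"
    and nd: "\<And>x. x \<in> {L+1..L+int n} \<Longrightarrow> \<not> int p dvd x"
    and D: "\<And>m. m \<in> {1..p} \<Longrightarrow> card {d. d dvd m} \<le> D"
  obtains Y where "Y \<ge> 0"
    "real U * real V * norm (bilinear_sum M L n a) \<le> 2 * real (card M) * (real U * real V)\<^sup>2 + Y"
    "Y ^ 8 \<le> (real (card M) * real n * real U) ^ 6
      * (real (card M) * ((real U)\<^sup>2 + 4 * real n * real U * real D * harm n))
      * (real p * (real V ^ 8 * (8 * (real s + 1)) + 4 ^ 8 * real V ^ 4 * real p))"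
proof
  let ?I = "{L+1..L+int n}" and ?U = "{1..int U}" and ?V = "{1..int V}" and ?Fp = "{0..<int p}"
  let ?c = "\<lambda>x y :: int. [x = y] (mod int p)"
  have finM: "finite M" using M finite_subset by blast
  define T where "T = M \<times> (?I \<times> ?U)"
  have finT: "finite T" using finM by (simp add: T_def)
  define \<phi> where "\<phi> = (\<lambda>(m, x, u). ((a * m * recip_pow u) mod int p, (x * u ^ (p - 2)) mod int p))"
  define G where "G = (\<lambda>(A, B). norm (\<Sum>v\<in>?V. add_char p (A * recip_pow (B + v))))"
  define Y where "Y = (\<Sum>t\<in>T. G (\<phi> t))"
  define T2 where "T2 u v = (\<Sum>m\<in>M. \<Sum>x\<in>?I. add_char p (a * (m * recip_pow (x + u * v))))" for u v
  let ?S = "bilinear_sum M L n a"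
  have ndU: "\<not> int p dvd u" if u: "u \<in> ?U" "?I \<noteq> {}" for u
  proof -
    have "n > 0" using u(2) by (cases n) auto
    then have "U \<le> 2 * n * U" by simp
    then have "U < p" using nU by linarith
    then show ?thesis using u(1) by (intro not_dvd_range) auto
  qed
  have G0: "G q \<ge> 0" for q by (simp add: G_def case_prod_unfold)
  then show "Y \<ge> 0" unfolding Y_def by (intro sum_nonneg)
  show "real U * real V * norm ?S \<le> 2 * real (card M) * (real U * real V)\<^sup>2 + Y"
  proof -
    have diff: "norm (?S - T2 u v) \<le> 2 * real (card M) * (real U * real V)" if uv: "u \<in> ?U" "v \<in> ?V" for u v
    proof -
      let ?f = "\<lambda>m x. add_char p (a * (m * recip_pow x))"
      have uv': "u * v \<ge> 0" using uv by simp
      have eq: "?S - T2 u v = (\<Sum>m\<in>M. (\<Sum>x\<in>?I. ?f m x) - (\<Sum>x\<in>?I. ?f m (x + u * v)))"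
        by (simp add: bilinear_sum_def T2_def sum_subtractf)
      have "norm (?S - T2 u v) \<le> (\<Sum>m\<in>M. 2 * real_of_int (u * v))"
        unfolding eq by (rule sum_norm_le, rule norm_sum_shift_le[OF _ uv'], simp)
      moreover have "real_of_int (u * v) \<le> real U * real V"
      proof -
        have "u * v \<le> int U * int V" using uv by (intro mult_mono) simp_all
        then have "real_of_int (u * v) \<le> real_of_int (int U * int V)" by (simp only: of_int_le_iff)
        then show ?thesis by simp
      qed
      then have "(\<Sum>m\<in>M. 2 * real_of_int (u * v)) \<le> (\<Sum>m\<in>M. 2 * (real U * real V))"
        by (intro sum_mono mult_left_mono) simp_all
      ultimately show ?thesis by (simp add: mult_ac)
    qed
    have factor: "(\<Sum>v\<in>?V. add_char p (a * (m * recip_pow (x + u * v))))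
        = (\<Sum>v\<in>?V. add_char p (fst (\<phi> (m, x, u)) * recip_pow (snd (\<phi> (m, x, u)) + v)))"
      if u: "u \<in> ?U" and x: "x \<in> ?I" for m x u
    proof (rule sum.cong[OF refl])
      fix v
      have ndu: "\<not> int p dvd u" using ndU u x by blast
      let ?y = "x * u ^ (p - 2)"
      have "?c (u * (?y + v)) (x * 1 + u * v)"
      proof -
        have "u * (?y + v) = x * (u * u ^ (p - 2)) + u * v" by (simp add: algebra_simps)
        then show ?thesis using fermat_inverse[OF ndu] by (simp only: cong_add cong_mult cong_refl)
      qed
      then have "?c (recip_pow (x + u * v)) (recip_pow (u * (?y + v)))"
        by (intro recip_pow_cong) (simp add: cong_sym_eq)
      then have "?c (a * (m * recip_pow (x + u * v))) (a * (m * (recip_pow u * recip_pow (?y + v))))"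
        unfolding recip_pow_mult by (intro cong_mult cong_refl)
      also have "a * (m * (recip_pow u * recip_pow (?y + v))) = (a * m * recip_pow u) * recip_pow (?y + v)"
        by (simp add: mult_ac)
      also have "?c \<dots> (((a * m * recip_pow u) mod int p) * recip_pow (?y mod int p + v))"
        by (intro cong_mult recip_pow_cong cong_add cong_refl) (simp_all add: Cong.cong_def)
      finally show "add_char p (a * (m * recip_pow (x + u * v)))
          = add_char p (fst (\<phi> (m, x, u)) * recip_pow (snd (\<phi> (m, x, u)) + v))"
        unfolding \<phi>_def by (intro add_char_cong[OF p_pos]) simp
    qed
    have "(\<Sum>u\<in>?U. \<Sum>v\<in>?V. T2 u v) = (\<Sum>u\<in>?U. \<Sum>m\<in>M. \<Sum>x\<in>?I. \<Sum>v\<in>?V. add_char p (a * (m * recip_pow (x + u * v))))"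
    proof (rule sum.cong[OF refl])
      fix u
      have "(\<Sum>v\<in>?V. T2 u v) = (\<Sum>m\<in>M. \<Sum>v\<in>?V. \<Sum>x\<in>?I. add_char p (a * (m * recip_pow (x + u * v))))"
        unfolding T2_def by (rule sum.swap)
      also have "\<dots> = (\<Sum>m\<in>M. \<Sum>x\<in>?I. \<Sum>v\<in>?V. add_char p (a * (m * recip_pow (x + u * v))))"
        by (intro sum.cong[OF refl] sum.swap)
      finally show "(\<Sum>v\<in>?V. T2 u v) = (\<Sum>m\<in>M. \<Sum>x\<in>?I. \<Sum>v\<in>?V. add_char p (a * (m * recip_pow (x + u * v))))" .
    qed
    then have "norm (\<Sum>u\<in>?U. \<Sum>v\<in>?V. T2 u v)
        \<le> (\<Sum>u\<in>?U. \<Sum>m\<in>M. \<Sum>x\<in>?I. norm (\<Sum>v\<in>?V. add_char p (a * (m * recip_pow (x + u * v)))))"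
      by (simp only:) (intro sum_norm_le order.refl)
    also have "\<dots> = (\<Sum>u\<in>?U. \<Sum>m\<in>M. \<Sum>x\<in>?I. G (\<phi> (m, x, u)))"
      by (intro sum.cong refl) (simp only: factor G_def case_prod_unfold)
    also have "\<dots> = (\<Sum>m\<in>M. \<Sum>u\<in>?U. \<Sum>x\<in>?I. G (\<phi> (m, x, u)))" by (rule sum.swap)
    also have "\<dots> = (\<Sum>m\<in>M. \<Sum>x\<in>?I. \<Sum>u\<in>?U. G (\<phi> (m, x, u)))" by (intro sum.cong[OF refl] sum.swap)
    also have "\<dots> = Y" by (simp add: Y_def T_def sum.cartesian_product case_prod_unfold)
    finally have main: "norm (\<Sum>u\<in>?U. \<Sum>v\<in>?V. T2 u v) \<le> Y" .
    have "of_nat U * of_nat V * ?S = (\<Sum>u\<in>?U. \<Sum>v\<in>?V. ?S - T2 u v) + (\<Sum>u\<in>?U. \<Sum>v\<in>?V. T2 u v)"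
      by (simp add: sum_subtractf)
    also have "norm \<dots> \<le> norm (\<Sum>u\<in>?U. \<Sum>v\<in>?V. ?S - T2 u v) + norm (\<Sum>u\<in>?U. \<Sum>v\<in>?V. T2 u v)"
      by (rule norm_triangle_ineq)
    also have "\<dots> \<le> (\<Sum>u\<in>?U. \<Sum>v\<in>?V. 2 * real (card M) * (real U * real V)) + Y"
      by (intro add_mono main sum_norm_le diff)
    finally show ?thesis by (simp add: norm_mult power2_eq_square mult_ac)
  qed
  show "Y ^ 8 \<le> (real (card M) * real n * real U) ^ 6
      * (real (card M) * ((real U)\<^sup>2 + 4 * real n * real U * real D * harm n))
      * (real p * (real V ^ 8 * (8 * (real s + 1)) + 4 ^ 8 * real V ^ 4 * real p))"
  proof -
    let ?C = "{(t, t'). t \<in> T \<and> t' \<in> T \<and> \<phi> t = \<phi> t'}"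
    let ?J = "{((x, u), (x', u')). (x, u) \<in> ?I \<times> ?U \<and> (x', u') \<in> ?I \<times> ?U \<and> ?c (x * u') (x' * u)}"
    have finJ: "finite ?J" by (rule finite_subset[of _ "(?I \<times> ?U) \<times> (?I \<times> ?U)"]) auto
    have cancel: "?c (x * u') (x' * u)" "m = m' \<or> u \<noteq> u2"
      if t: "(m, (x, u)) \<in> T" "(m', (x', u')) \<in> T" "\<phi> (m, x, u) = \<phi> (m', x', u')" and u2: "u2 = u'" 
      for m x u m' x' u' u2
    proof -
      have I: "x \<in> ?I" "u \<in> ?U" "u' \<in> ?U" using t by (auto simp: T_def)
      then have nd': "\<not> int p dvd u" "\<not> int p dvd u'" using ndU by blast+
      have "?c (x * u ^ (p - 2)) (x' * u' ^ (p - 2))" using t(3) by (simp add: \<phi>_def Cong.cong_def)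
      then have "?c (x * u ^ (p - 2) * (u * u')) (x' * u' ^ (p - 2) * (u * u'))" by (rule cong_scalar_right)
      then have 1: "?c (x * u' * (u * u ^ (p - 2))) (x' * u * (u' * u' ^ (p - 2)))" by (simp add: mult_ac)
      have "?c (x * u' * 1) (x * u' * (u * u ^ (p - 2)))"
        by (intro cong_mult cong_refl cong_sym[OF fermat_inverse] nd')
      also note 1
      also have "?c (x' * u * (u' * u' ^ (p - 2))) (x' * u * 1)"
        by (intro cong_mult cong_refl fermat_inverse nd')
      finally show "?c (x * u') (x' * u)" by simp
      show "m = m' \<or> u \<noteq> u2"
      proof (cases "u = u2")
        case True
        then have uu: "u' = u" using u2 by simp
        have "\<not> int p dvd recip_pow u" using nd'(1) unfolding recip_pow_def by (rule not_dvd_power)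
        moreover have "?c (m * a * recip_pow u) (m' * a * recip_pow u)"
          using t(3) by (simp add: \<phi>_def Cong.cong_def uu mult_ac)
        ultimately have "?c (m * a) (m' * a)" by (rule cong_mult_cancel)
        then have "?c m m'" by (rule cong_mult_cancel[OF a])
        moreover have "m \<in> M" "m' \<in> M" using t by (auto simp: T_def)
        ultimately have "m = m'" by (intro cong_range_eq) (use M in auto)
        then show ?thesis by simp
      qed simp
    qed
    let ?f = "\<lambda>((m, (x, u)), (m', (x', u'))). (m, ((x, u), (x', u')))"
    have cC: "card ?C \<le> card (M \<times> ?J)"
    proof (rule card_inj_on_le[where f = "?f"])
      show "inj_on ?f ?C"
      proof (rule inj_onI)
        fix z z' assume zz: "z \<in> ?C" "z' \<in> ?C"
          and eq: "?f z
            = ?f z'"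
        obtain m x u m' x' u' where z: "z = ((m, (x, u)), (m', (x', u')))" by (metis prod.exhaust)
        obtain k y w k' y' w' where z': "z' = ((k, (y, w)), (k', (y', w')))" by (metis prod.exhaust)
        have e: "k = m" "y = x" "w = u" "y' = x'" "w' = u'" using eq unfolding z z' by simp_all
        have "(m', x', u') \<in> T" "(k', x', u') \<in> T" "\<phi> (m', x', u') = \<phi> (k', x', u')"
          using zz unfolding z z' e by simp_all
        then have "m' = k'" using cancel(2) by blast
        then show "z = z'" unfolding z z' e by simp
      qed
      show "?f ` ?C \<subseteq> M \<times> ?J"
      proof (rule image_subsetI)
        fix z assume zz: "z \<in> ?C"
        obtain m x u m' x' u' where z: "z = ((m, (x, u)), (m', (x', u')))" by (metis prod.exhaust)
        have t: "(m, x, u) \<in> T" "(m', x', u') \<in> T" "\<phi> (m, x, u) = \<phi> (m', x', u')" using zz unfolding z by simp_all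
        have "?c (x * u') (x' * u)" by (rule cancel(1)[OF t refl])
        then show "?f z \<in> M \<times> ?J"
          using t(1,2) unfolding z T_def by simp
      qed
      show "finite (M \<times> ?J)" using finM finJ by blast
    qed
    have J: "real (card ?J) \<le> (real U)\<^sup>2 + 4 * real n * real U * real D * harm n"
      by (rule card_shift_collisions_le[OF n nU nd D])
    have "real (card ?C) \<le> real (card M) * real (card ?J)"
      using cC unfolding card_cartesian_product of_nat_mult[symmetric] of_nat_le_iff .
    also have "\<dots> \<le> real (card M) * ((real U)\<^sup>2 + 4 * real n * real U * real D * harm n)"
      by (rule mult_left_mono[OF J]) simp
    finally have C: "real (card ?C) \<le> real (card M) * ((real U)\<^sup>2 + 4 * real n * real U * real D * harm n)" .
    have W: "(\<Sum>q\<in>?Fp \<times> ?Fp. G q ^ 8) \<le> real p * (real V ^ 8 * (8 * (real s + 1)) + 4 ^ 8 * real V ^ 4 * real p)"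
      using reciprocal_moment_le[OF V, of 4] by (simp add: G_def sum.cartesian_product case_prod_unfold)
    have T: "real (card T) = real (card M) * real n * real U" by (simp add: T_def card_cartesian_product)
    have "Y ^ 8 \<le> real (card T) ^ 6 * real (card ?C) * (\<Sum>q\<in>?Fp \<times> ?Fp. G q ^ 8)"
      unfolding Y_def
      by (rule sum_eighth_power_le[OF finT _ _ G0]) (use p_pos in \<open>auto simp: \<phi>_def\<close>)
    also have "\<dots> \<le> (real (card M) * real n * real U) ^ 6
      * (real (card M) * ((real U)\<^sup>2 + 4 * real n * real U * real D * harm n))
      * (real p * (real V ^ 8 * (8 * (real s + 1)) + 4 ^ 8 * real V ^ 4 * real p))"
      unfolding T
    proof (intro mult_mono order.refl C W)
      show "0 \<le> (real (card M) * real n * real U) ^ 6 *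
          (real (card M) * ((real U)\<^sup>2 + 4 * real n * real U * real D * harm n))"
        by (intro mult_nonneg_nonneg add_nonneg_nonneg harm_nonneg) simp_all
      show "0 \<le> (\<Sum>q\<in>?Fp \<times> ?Fp. G q ^ 8)" by (intro sum_nonneg zero_le_power G0)
    qed simp_all
    finally show ?thesis .
  qed
qed

lemma sum_norm_bilinear_sum_squared_le:
  assumes "finite M"
  shows "(\<Sum>a\<in>{0..<int p}. (norm (bilinear_sum M L n a))\<^sup>2) \<le> real p * real (energy M L n)"
proof -
  let ?I = "M \<times> {L+1..L+int n}"
  let ?f = "\<lambda>(m, x). m * recip_pow x"
  have "bilinear_sum M L n a = (\<Sum>i\<in>?I. 1 * add_char p (a * ?f i))" for a
    by (simp add: bilinear_sum_def sum.cartesian_product case_prod_unfold)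
  moreover have "{(i, j). i \<in> ?I \<and> j \<in> ?I \<and> [?f i = ?f j] (mod int p)}
     = {((w, x), (w', x')). (w, x) \<in> ?I \<and> (w', x') \<in> ?I \<and> [w * recip_pow x = w' * recip_pow x'] (mod int p)}"
    by auto
  ultimately show ?thesis
    using mean_square_le[OF p_pos, of ?I "\<lambda>_. 1" ?f] assms by (simp add: energy_def)
qed

text \<open>Group the frequency with the reciprocal power and extend the sum over \<open>M\<close> to all residues: the
  set of frequencies takes over the role of \<open>M\<close> in the energy.\<close>

lemma large_values_le:
  assumes M: "M \<subseteq> {1..<int p}" and W: "finite W"
    and y: "\<And>a. a \<in> W \<Longrightarrow> y \<le> norm (bilinear_sum M L n a)" and y0: "y \<ge> 0"
  shows "(real (card W) * y)\<^sup>2 \<le> real (card M) * (real p * real (energy W L n))"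
proof -
  let ?X = "{L+1..L+int n}"
  let ?I = "W \<times> ?X"
  let ?S = "bilinear_sum M L n"
  define c where "c a = cnj (sgn (?S a))" for a
  have c1: "norm (c a) \<le> 1" for a by (simp add: c_def norm_sgn)
  have cS: "c a * ?S a = of_real (norm (?S a))" for a
    by (cases "?S a = 0") (simp_all add: c_def sgn_eq complex_norm_square[symmetric] power2_eq_square field_simps)
  define H where "H m = norm (\<Sum>i\<in>?I. c (fst i) * add_char p (m * (fst i * recip_pow (snd i))))" for m
  have "real (card W) * y \<le> (\<Sum>a\<in>W. norm (?S a))"
    using sum_bounded_below[of W y "\<lambda>a. norm (?S a)"] y by simp
  also have "\<dots> = norm (\<Sum>a\<in>W. c a * ?S a)"
    unfolding cS of_real_sum[symmetric] norm_of_real by (simp add: sum_nonneg)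
  also have "(\<Sum>a\<in>W. c a * ?S a) = (\<Sum>a\<in>W. \<Sum>m\<in>M. \<Sum>x\<in>?X. c a * add_char p (m * (a * recip_pow x)))"
    by (simp add: bilinear_sum_def sum_distrib_left mult_ac)
  also have "\<dots> = (\<Sum>m\<in>M. \<Sum>a\<in>W. \<Sum>x\<in>?X. c a * add_char p (m * (a * recip_pow x)))"
    by (rule sum.swap)
  also have "\<dots> = (\<Sum>m\<in>M. \<Sum>i\<in>?I. c (fst i) * add_char p (m * (fst i * recip_pow (snd i))))"
    by (simp add: sum.cartesian_product case_prod_unfold)
  also have "norm \<dots> \<le> (\<Sum>m\<in>M. H m)" unfolding H_def by (intro sum_norm_le order.refl)
  finally have "(real (card W) * y)\<^sup>2 \<le> (\<Sum>m\<in>M. H m)\<^sup>2" using y0 by (intro power_mono) auto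
  also have "\<dots> \<le> (\<Sum>m\<in>M. (H m)\<^sup>2) * real (card M)" by (rule sum_squared_le_sum_of_squares)
  also have "\<dots> \<le> (\<Sum>m\<in>{0..<int p}. (H m)\<^sup>2) * real (card M)"
    using M by (intro mult_right_mono sum_mono2) auto
  also have "\<dots> \<le> (real p * real (energy W L n)) * real (card M)"
  proof (rule mult_right_mono)
    have "{(i, j). i \<in> ?I \<and> j \<in> ?I \<and> [fst i * recip_pow (snd i) = fst j * recip_pow (snd j)] (mod int p)}
     = {((w, x), (w', x')). (w, x) \<in> ?I \<and> (w', x') \<in> ?I \<and> [w * recip_pow x = w' * recip_pow x'] (mod int p)}"
      by auto
    then show "(\<Sum>m\<in>{0..<int p}. (H m)\<^sup>2) \<le> real p * real (energy W L n)"
      using mean_square_le[OF p_pos, of ?I "\<lambda>i. c (fst i)" "\<lambda>i. fst i * recip_pow (snd i)"] W c1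
      by (simp add: energy_def H_def)
  qed simp
  finally show ?thesis by (simp add: mult_ac)
qed

end

section \<open>The fifth moment over a short interval\<close>

text \<open>In decreasing order, the \<open>j\<close>-th value is the least one of a set of \<open>j\<close> elements. The induction
removes the least value.\<close>

lemma sum_fifth_powers_le_sorted:
  fixes \<sigma> :: "'a \<Rightarrow> real"
  assumes "finite A" and \<sigma>: "\<And>a. a \<in> A \<Longrightarrow> \<sigma> a \<ge> 0"
    and b: "\<And>W. W \<subseteq> A \<Longrightarrow> W \<noteq> {} \<Longrightarrow> \<exists>a\<in>W. \<sigma> a ^ 5 \<le> b (card W)"
  shows "(\<Sum>a\<in>A. \<sigma> a ^ 5) \<le> (\<Sum>j\<in>{1..card A}. b j)"
  using assms
proof (induction "card A" arbitrary: A)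
  case 0
  then show ?case by simp
next
  case (Suc k)
  then have "A \<noteq> {}" by auto
  then obtain a where a: "a \<in> A" "\<sigma> a ^ 5 \<le> b (card A)" using Suc.prems(3)[of A] by auto
  have k: "k = card (A - {a})" using Suc.hyps(2) a(1) Suc.prems(1) by simp
  have "(\<Sum>a\<in>A - {a}. \<sigma> a ^ 5) \<le> (\<Sum>j\<in>{1..card (A - {a})}. b j)"
  proof (rule Suc.hyps(1)[OF k])
    fix W assume "W \<subseteq> A - {a}" "W \<noteq> {}"
    then show "\<exists>a\<in>W. \<sigma> a ^ 5 \<le> b (card W)" by (intro Suc.prems(3)) auto
  qed (use Suc.prems(1,2) in auto)
  then have "(\<Sum>a\<in>A. \<sigma> a ^ 5) \<le> b (Suc k) + (\<Sum>j\<in>{1..k}. b j)"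
    using a Suc.hyps(2) Suc.prems(1) k by (simp add: sum.remove)
  then show ?case by (simp flip: Suc.hyps(2))
qed

text \<open>The inequalities between powers of \<open>p\<close> that fail for small \<open>p\<close> only.\<close>

definition sufficiently_large :: "nat \<Rightarrow> real \<Rightarrow> bool" where
  "sufficiently_large s x \<longleftrightarrow> x \<ge> 3 \<and> 8 * x powr (193/200) < x \<and> 4 * x powr (277/400) < x
     \<and> 2 * x powr (21/100) \<le> x powr (193/400) \<and> 2 * x powr (1/4) \<le> x powr (193/400)
     \<and> x powr (1/4) < x \<and> 24 * real s \<le> x powr (3/200)"

lemma eventually_sufficiently_large: "eventually (sufficiently_large s) at_top"
proof -
  have "filterlim (\<lambda>x::real. x powr (3/200)) at_top at_top" by real_asymp
  then have "eventually (\<lambda>x::real. 24 * real s \<le> x powr (3/200)) at_top"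
    by (simp add: filterlim_at_top)
  moreover have "eventually (\<lambda>x::real. 8 * x powr (193/200) < x) at_top" by real_asymp
  moreover have "eventually (\<lambda>x::real. 4 * x powr (277/400) < x) at_top" by real_asymp
  moreover have "eventually (\<lambda>x::real. 2 * x powr (21/100) \<le> x powr (193/400)) at_top" by real_asymp
  moreover have "eventually (\<lambda>x::real. 2 * x powr (1/4) \<le> x powr (193/400)) at_top" by real_asymp
  moreover have "eventually (\<lambda>x::real. x powr (1/4) < x) at_top" by real_asymp
  moreover have "eventually (\<lambda>x::real. x \<ge> 3) at_top" by (rule eventually_ge_at_top)
  ultimately show ?thesis unfolding sufficiently_large_def by eventually_elim simp
qed

lemma nat_floor_ge_half:
  assumes "x \<ge> (1 :: real)"
  shows "x / 2 \<le> real (nat \<lfloor>x\<rfloor>)" "real (nat \<lfloor>x\<rfloor>) \<le> x"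
proof -
  show "real (nat \<lfloor>x\<rfloor>) \<le> x" using assms by (intro of_nat_floor) simp
  have "real (nat \<lfloor>x\<rfloor>) \<ge> 1" using assms by (simp add: le_nat_floor)
  moreover have "real (nat \<lfloor>x\<rfloor>) > x - 1" using assms by linarith
  ultimately show "x / 2 \<le> real (nat \<lfloor>x\<rfloor>)" by linarith
qed

text \<open>The exponent \<open>193/400\<close> of the block length is slightly below \<open>14/29\<close>; the exponent \<open>1/2000\<close> leaves
room for the divisor bound and a logarithm.\<close>

locale short_interval_sum = reciprocal_powers +
  fixes M :: "int set" and L :: int and n D :: nat
  assumes M: "M \<subseteq> {1..<int p}"
    and not_dvd: "\<And>x. x \<in> {L+1..L+int n} \<Longrightarrow> \<not> int p dvd x"
    and divisors: "\<And>m. m \<in> {1..p} \<Longrightarrow> card {d. d dvd m} \<le> D"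
    and large: "sufficiently_large s (real p)"
    and card_M: "real p powr (193/400) \<le> 2 * real (card M)"
    and n_lower: "real p powr (193/400) \<le> 2 * real n"
    and n_upper: "real n \<le> 2 * real p powr (193/400)"
    and D_harm: "real D * harm n \<le> real p powr (1/2000)"
    and harm_p: "harm p \<le> real p powr (1/2000)"
begin

abbreviation (input) "S \<equiv> bilinear_sum M L n"

lemma P3: "real p \<ge> 3" and P_pos: "real p > 0"
  using p3 by simp_all

lemma powr_P_pos: "real p powr a > 0"
  using P_pos by simp

lemma N_pos: "real (card M) > 0" and n_pos: "real n > 0"
  using card_M n_lower powr_P_pos[of "193/400"] by linarith+

lemma n_square: "2 * n\<^sup>2 < p"
proof -
  have "(real n)\<^sup>2 \<le> (2 * real p powr (193/400))\<^sup>2" using n_upper by (intro power_mono) auto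
  also have "\<dots> = 4 * real p powr (193/200)"
    using P_pos by (simp add: power_mult_distrib powr_power)
  finally have "2 * (real n)\<^sup>2 < real p" using large unfolding sufficiently_large_def by linarith
  then have "real (2 * n\<^sup>2) < real p" by simp
  then show ?thesis by (simp only: of_nat_less_iff)
qed

definition sup_const :: real where
  "sup_const = 4 + 5 * 2 ^ 11 * (8 * (real s + 1) + 4 ^ 8)"

text \<open>The shifts are \<open>u * v\<close> with \<open>v\<close> up to \<open>V\<close>, about \<open>p powr (1/4)\<close>, which balances the two terms
\<open>V ^ 8\<close> and \<open>V ^ 4 * p\<close> of the eighth moment, and with \<open>u\<close> up to \<open>p powr (21/100)\<close>, so that \<open>u * v\<close> stays
below \<open>n\<close> by a factor of about \<open>p powr (9/400)\<close>, which is what the first term in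
\<open>norm_bilinear_sum_shift_le\<close> saves. The eighth power of the second term saves \<open>p powr (7/40)\<close>, up to
the divisor bound. The exponent \<open>109/5000\<close> is below both \<open>9/400\<close> and \<open>7/320\<close>.\<close>

lemma norm_bilinear_sum_le:
  assumes a: "\<not> int p dvd a"
  shows "norm (S a) \<le> sup_const * real p powr (-109/5000) * (real (card M) * real n)"
proof -
  define P where "P = real p"
  define N where "N = real (card M)"
  define n' where "n' = real n"
  define U where "U = nat \<lfloor>P powr (21/100)\<rfloor>"
  define V where "V = nat \<lfloor>P powr (1/4)\<rfloor>"
  define u where "u = real U"
  define v where "v = real V"
  define c1 where "c1 = 8 * (real s + 1) + 4 ^ 8"
  define C where "C = 5 * 2 ^ 11 * c1"
  have P: "P \<ge> 3" using P3 by (simp add: P_def)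
  have Pp: "P powr e > 0" for e using P by simp
  have P1: "P powr e \<ge> 1" if "e \<ge> 0" for e using P that by (intro ge_one_powr_ge_zero) auto
  have pos: "N > 0" "n' > 0" using N_pos n_pos by (auto simp: N_def n'_def)
  have u: "P powr (21/100) / 2 \<le> u" "u \<le> P powr (21/100)"
    unfolding u_def U_def using P1[of "21/100"] by (intro nat_floor_ge_half; simp)+
  have v: "P powr (1/4) / 2 \<le> v" "v \<le> P powr (1/4)"
    unfolding v_def V_def using P1[of "1/4"] by (intro nat_floor_ge_half; simp)+
  have uv0: "u > 0" "v > 0" using u v Pp[of "21/100"] Pp[of "1/4"] by linarith+
  have n': "P powr (193/400) \<le> 2 * n'" "n' \<le> 2 * P powr (193/400)"
    using n_lower n_upper by (simp_all add: P_def n'_def)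
  have N: "P powr (193/400) \<le> 2 * N" using card_M by (simp add: P_def N_def)
  have lg: "4 * P powr (277/400) < P" "2 * P powr (21/100) \<le> P powr (193/400)" "P powr (1/4) < P"
    using large by (simp_all add: sufficiently_large_def P_def)
  have nU: "2 * n * U < p"
  proof -
    have "n' * u \<le> 2 * P powr (193/400) * P powr (21/100)"
      using n' u uv0 pos by (intro mult_mono) auto
    also have "\<dots> = 2 * P powr (277/400)" by (simp flip: powr_add)
    finally have "real (2 * n * U) < real p" using lg(1) by (simp add: n'_def u_def P_def)
    then show ?thesis by (simp only: of_nat_less_iff)
  qed
  have Vp: "V < p" using v(2) lg(3) by (simp add: v_def P_def)
  obtain Y where Y0: "Y \<ge> 0"
    and Y1: "u * v * norm (S a) \<le> 2 * N * (u * v)\<^sup>2 + Y"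
    and Y8: "Y ^ 8 \<le> (N * n' * u) ^ 6 * (N * (u\<^sup>2 + 4 * n' * u * real D * harm n))
      * (P * (v ^ 8 * (8 * (real s + 1)) + 4 ^ 8 * v ^ 4 * P))"
    using norm_bilinear_sum_shift_le[OF M a n_square nU Vp not_dvd divisors]
    unfolding u_def v_def N_def n'_def P_def by blast
  have "u * v \<le> P powr (21/100) * P powr (1/4)" using u v uv0 by (intro mult_mono) auto
  also have "\<dots> = P powr (23/50)" by (simp flip: powr_add)
  also have "\<dots> \<le> P powr (-109/5000 + 193/400)" using P by (intro powr_mono) auto
  also have "\<dots> = P powr (-109/5000) * P powr (193/400)" by (rule powr_add)
  also have "\<dots> \<le> P powr (-109/5000) * (2 * n')" using n' by (intro mult_left_mono) auto
  finally have "2 * N * (u * v) \<le> 2 * N * (P powr (-109/5000) * (2 * n'))"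
    using pos by (intro mult_left_mono) auto
  then have part1: "2 * N * (u * v) \<le> 4 * P powr (-109/5000) * (N * n')" by (simp add: mult_ac)
  have part2: "Y \<le> C * P powr (-109/5000) * (N * n' * u * v)"
  proof (rule power_le_imp_le_base[where n = 7, simplified])
    let ?Q = "N * n' * u"
    have a1: "u\<^sup>2 + 4 * n' * u * real D * harm n \<le> 5 * (n' * u * P powr (1/2000))"
    proof -
      have "u \<le> n'" using u(2) lg(2) n'(1) by linarith
      then have "u\<^sup>2 \<le> n' * u * 1" using uv0 by (simp add: power2_eq_square)
      also have "\<dots> \<le> n' * u * P powr (1/2000)"
        using P1[of "1/2000"] uv0 pos by (intro mult_left_mono) auto
      finally have "u\<^sup>2 \<le> n' * u * P powr (1/2000)" .
      moreover have "n' * u * (real D * harm n) \<le> n' * u * P powr (1/2000)"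
        using D_harm uv0 pos by (intro mult_left_mono) (auto simp: P_def)
      ultimately show ?thesis by (simp add: mult_ac)
    qed
    have v4: "v ^ 4 \<le> P"
    proof -
      have "v ^ 4 \<le> (P powr (1/4)) ^ 4" using v uv0 by (intro power_mono) auto
      also have "\<dots> = P" using P by (simp add: powr_power)
      finally show ?thesis .
    qed
    have v8: "v ^ 8 \<le> P\<^sup>2"
      using power_mono[OF v4, of 2] by (simp flip: power_mult)
    have a2: "P * (v ^ 8 * (8 * (real s + 1)) + 4 ^ 8 * v ^ 4 * P) \<le> c1 * P ^ 3"
    proof -
      have "v ^ 8 * (8 * (real s + 1)) \<le> P\<^sup>2 * (8 * (real s + 1))"
        by (rule mult_right_mono[OF v8]) simp
      moreover have "4 ^ 8 * v ^ 4 * P \<le> 4 ^ 8 * P * P"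
        using v4 P by (intro mult_right_mono mult_left_mono) auto
      ultimately have "v ^ 8 * (8 * (real s + 1)) + 4 ^ 8 * v ^ 4 * P \<le> c1 * P\<^sup>2"
        by (simp add: c1_def power2_eq_square algebra_simps)
      then have "P * (v ^ 8 * (8 * (real s + 1)) + 4 ^ 8 * v ^ 4 * P) \<le> P * (c1 * P\<^sup>2)"
        using P by (intro mult_left_mono) auto
      then show ?thesis by (simp add: power2_eq_square power3_eq_cube mult_ac)
    qed
    have c1: "c1 \<ge> 1" by (simp add: c1_def)
    have C1: "C \<ge> 1" using c1 by (simp add: C_def)
    have h0: "harm n \<ge> (0 :: real)" by (rule harm_nonneg)
    have "Y ^ 8 \<le> ?Q ^ 6 * (N * (5 * (n' * u * P powr (1/2000)))) * (c1 * P ^ 3)"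
    proof (rule order_trans[OF Y8], rule mult_mono[OF _ a2])
      show "?Q ^ 6 * (N * (u\<^sup>2 + 4 * n' * u * real D * harm n)) \<le> ?Q ^ 6 * (N * (5 * (n' * u * P powr (1/2000))))"
        by (intro mult_left_mono a1) (use pos uv0 in simp_all)
      show "0 \<le> P * (v ^ 8 * (8 * (real s + 1)) + 4 ^ 8 * v ^ 4 * P)"
        using P uv0 by (intro mult_nonneg_nonneg add_nonneg_nonneg) simp_all
    qed (use pos uv0 h0 in simp_all)
    also have "\<dots> = ?Q ^ 7 * (5 * c1 * (P powr (1/2000) * P ^ 3))"
      by (simp add: numeral_eq_Suc mult_ac)
    also have "\<dots> \<le> ?Q ^ 7 * (C ^ 8 * (P powr (-109/5000)) ^ 8 * (?Q * v ^ 8))"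
    proof (rule mult_left_mono)
      have e1: "P powr (1/2000) * P ^ 3 = P powr (1/2000 + 3)"
        using P powr_add[of P "1/2000" 3] by simp
      have e2: "(P powr (-109/5000)) ^ 8 = P powr (-109/625)" using P by (simp add: powr_power)
      have "P powr (193/400) / 2 * (P powr (193/400) / 2) * (P powr (21/100) / 2) * (P powr (1/4) / 2) ^ 8
          \<le> N * n' * u * v ^ 8"
        using u v n' N uv0 pos Pp by (intro mult_mono power_mono) auto
      moreover have "P powr (193/400) / 2 * (P powr (193/400) / 2) * (P powr (21/100) / 2) * (P powr (1/4) / 2) ^ 8
          = P powr (127/40) / 2 ^ 11"
      proof -
        have "(P powr (1/4)) ^ 8 = P powr 2" using P by (simp add: powr_power)
        then have "P powr (193/400) / 2 * (P powr (193/400) / 2) * (P powr (21/100) / 2) * (P powr (1/4) / 2) ^ 8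
          = (P powr (193/400) * P powr (193/400) * P powr (21/100) * P powr 2) / 2 ^ 11"
          by (simp add: power_divide)
        then show ?thesis by (simp flip: powr_add)
      qed
      ultimately have Q: "P powr (127/40) / 2 ^ 11 \<le> ?Q * v ^ 8" by (simp only:)
      have "5 * c1 * (P powr (1/2000) * P ^ 3) \<le> 5 * c1 * P powr (-109/625 + 127/40)"
        unfolding e1 using P c1 by (intro mult_left_mono powr_mono) auto
      also have "\<dots> = C * (P powr (-109/625) * (P powr (127/40) / 2 ^ 11))"
        by (simp add: C_def flip: powr_add)
      also have "\<dots> \<le> C ^ 8 * (P powr (-109/625) * (P powr (127/40) / 2 ^ 11))"
        using C1 self_le_power[of C 8] by (intro mult_right_mono) auto
      also have "\<dots> \<le> C ^ 8 * (P powr (-109/625) * (?Q * v ^ 8))"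
        using C1 Q by (intro mult_left_mono) auto
      finally show "5 * c1 * (P powr (1/2000) * P ^ 3) \<le> C ^ 8 * (P powr (-109/5000)) ^ 8 * (?Q * v ^ 8)"
        unfolding e2 by (simp add: mult.assoc)
    qed (use pos uv0 in simp)
    also have "\<dots> = (C * P powr (-109/5000) * (N * n' * u * v)) ^ 8"
      by (simp add: power_mult_distrib numeral_eq_Suc mult_ac)
    finally show "Y ^ 8 \<le> (C * P powr (-109/5000) * (N * n' * u * v)) ^ 8" .
    show "0 \<le> C * P powr (-109/5000) * (N * n' * u * v)" using C1 pos uv0 by simp
  qed
  have "u * v * norm (S a) \<le> u * v * (sup_const * P powr (-109/5000) * (N * n'))"
  proof -
    have "2 * N * (u * v)\<^sup>2 \<le> u * v * (4 * P powr (-109/5000) * (N * n'))"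
      using mult_left_mono[OF part1, of "u * v"] uv0 by (simp add: power2_eq_square mult_ac)
    moreover have "sup_const = 4 + C" by (simp add: sup_const_def C_def c1_def)
    ultimately show ?thesis using Y1 part2 by (simp add: algebra_simps)
  qed
  then show ?thesis using uv0 by (simp add: P_def N_def n'_def)
qed

lemma energy_short_le:
  assumes W: "W \<subseteq> {1..<int p}"
  shows "real (energy W L n) \<le> real s * real n * (3 * (real (card W))\<^sup>2 * real p powr (-1/4)
    + 4 * real (card W) powr (5/4) * real p powr (1/2000))"
proof -
  let ?K = "real (card W)"
  have "1 \<le> real n * real p powr (-1/4)"
  proof -
    have "real p powr (1/4) \<le> real n" using large n_lower by (simp add: sufficiently_large_def)
    then have "real p powr (1/4) * real p powr (-1/4) \<le> real n * real p powr (-1/4)"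
      by (rule mult_right_mono) simp
    then show ?thesis using P_pos by (simp flip: powr_add)
  qed
  then have "real s * ?K\<^sup>2 * (1 + 2 * real n * real p powr (-1/4)) \<le> real s * ?K\<^sup>2 * (3 * (real n * real p powr (-1/4)))"
    by (intro mult_left_mono) auto
  moreover have "4 * real s * ?K powr (5/4) * real n * (real D * harm n)
      \<le> 4 * real s * ?K powr (5/4) * real n * real p powr (1/2000)"
    by (intro mult_left_mono D_harm) auto
  moreover have "real (energy W L n) \<le> real s * ?K\<^sup>2 * (1 + 2 * real n * real p powr (-1/4))
      + 4 * real s * ?K powr (5/4) * real n * (real D * harm n)"
    using energy_le[OF W n_square not_dvd divisors] by (simp add: mult_ac)
  ultimately show ?thesis by (simp add: algebra_simps)
qed

definition rel_size :: "int \<Rightarrow> real" where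
  "rel_size a = norm (S a) / (real (card M) * real n)"

lemma rel_size_nonneg: "rel_size a \<ge> 0"
  by (simp add: rel_size_def)

text \<open>The first term of the energy bound alone would only allow \<open>y\<close> up to about \<open>p powr (-43/400)\<close>, which is
below \<open>p powr (-1/10)\<close>; so the second term dominates.\<close>

lemma large_values_bound:
  assumes W: "W \<subseteq> {1..<int p}" "W \<noteq> {}"
    and y: "\<And>a. a \<in> W \<Longrightarrow> y \<le> rel_size a" and y1: "y \<ge> real p powr (-1/10)"
  shows "y \<le> 6 * real s * real p powr (71/4000) * real (card W) powr (-3/8)"
proof -
  define P where "P = real p"
  define N where "N = real (card M)"
  define n' where "n' = real n"
  define K where "K = real (card W)"
  have P: "P \<ge> 3" using P3 by (simp add: P_def)
  have Pp: "P powr e > 0" for e using P by simp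
  have pos: "N > 0" "n' > 0" using N_pos n_pos by (auto simp: N_def n'_def)
  have finW: "finite W" using W(1) finite_subset by blast
  have K: "K > 0" using W finW by (simp add: K_def card_gt_0_iff)
  have y0: "y > 0" by (rule less_le_trans[OF Pp y1[folded P_def]])
  have "(K * (y * (N * n')))\<^sup>2 \<le> N * (P * real (energy W L n))"
    unfolding K_def N_def P_def
    by (rule large_values_le[OF M finW])
      (use y y0 pos in \<open>auto simp: rel_size_def N_def n'_def field_simps\<close>)
  also have "\<dots> \<le> N * (P * (real s * n' * (3 * K\<^sup>2 * P powr (-1/4) + 4 * K powr (5/4) * P powr (1/2000))))"
    unfolding K_def P_def n'_def using pos P energy_short_le[OF W(1)] by (intro mult_left_mono) (auto simp: N_def)
  finally have "(N * n' * K\<^sup>2) * (N * n' * y\<^sup>2)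
      \<le> (N * n' * K\<^sup>2) * (P * real s * (3 * P powr (-1/4) + 4 * K powr (-3/4) * P powr (1/2000)))"
  proof -
    assume h: "(K * (y * (N * n')))\<^sup>2
      \<le> N * (P * (real s * n' * (3 * K\<^sup>2 * P powr (-1/4) + 4 * K powr (5/4) * P powr (1/2000))))"
    have K54: "K powr (5/4) = K\<^sup>2 * K powr (-3/4)"
    proof -
      have "K\<^sup>2 * K powr (-3/4) = K powr 2 * K powr (-3/4)" using K by (simp add: powr_numeral)
      then show ?thesis by (simp flip: powr_add)
    qed
    show ?thesis using h unfolding K54 by (simp add: power2_eq_square algebra_simps)
  qed
  then have "N * n' * y\<^sup>2 \<le> P * real s * (3 * P powr (-1/4) + 4 * K powr (-3/4) * P powr (1/2000))"
    using pos K by simp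
  moreover have "P powr (193/200) \<le> 4 * (N * n')"
  proof -
    have "P powr (193/400) * P powr (193/400) \<le> (2 * N) * (2 * n')"
      using card_M n_lower pos by (intro mult_mono) (auto simp: P_def N_def n'_def)
    then show ?thesis by (simp flip: powr_add)
  qed
  then have "P powr (193/200) * y\<^sup>2 \<le> 4 * (N * n') * y\<^sup>2" by (rule mult_right_mono) simp
  ultimately have "P powr (193/200) * y\<^sup>2
      \<le> 4 * (P * real s * (3 * P powr (-1/4) + 4 * K powr (-3/4) * P powr (1/2000)))"
    by linarith
  then have "P powr (-193/200) * (P powr (193/200) * y\<^sup>2)
      \<le> P powr (-193/200) * (4 * (P * real s * (3 * P powr (-1/4) + 4 * K powr (-3/4) * P powr (1/2000))))"
    by (rule mult_left_mono) simp
  moreover have "P powr (-193/200) * (P powr (193/200) * y\<^sup>2) = y\<^sup>2"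
    using P by (simp add: mult.assoc[symmetric] flip: powr_add)
  moreover have "P powr (-193/200) * (4 * (P * real s * (3 * P powr (-1/4) + 4 * K powr (-3/4) * P powr (1/2000))))
      = 12 * real s * P powr (-43/200) + 16 * real s * K powr (-3/4) * P powr (71/2000)"
  proof -
    have powr_mult_self: "P powr a * P * P powr b = P powr (a + 1 + b)" for a b
      using P by (simp add: powr_add)
    have 1: "P powr (-193/200) * P * P powr (-1/4) = P powr (-43/200)"
      using powr_mult_self[of "-193/200" "-1/4"] by simp
    have 2: "P powr (-193/200) * P * P powr (1/2000) = P powr (71/2000)"
      using powr_mult_self[of "-193/200" "1/2000"] by simp
    have "P powr (-193/200) * (4 * (P * real s * (3 * P powr (-1/4) + 4 * K powr (-3/4) * P powr (1/2000))))
      = 12 * real s * (P powr (-193/200) * P * P powr (-1/4))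
        + 16 * real s * K powr (-3/4) * (P powr (-193/200) * P * P powr (1/2000))"
      by (simp add: algebra_simps)
    then show ?thesis unfolding 1 2 .
  qed
  ultimately have main: "y\<^sup>2 \<le> 12 * real s * P powr (-43/200) + 16 * real s * K powr (-3/4) * P powr (71/2000)"
    by (simp only:)
  have "24 * real s * P powr (-43/200) \<le> P powr (3/200) * P powr (-43/200)"
    using large by (intro mult_right_mono) (auto simp: sufficiently_large_def P_def)
  also have "\<dots> = P powr (-1/5)" by (simp flip: powr_add)
  also have "\<dots> = (P powr (-1/10))\<^sup>2" using P by (simp add: powr_power)
  also have "\<dots> \<le> y\<^sup>2" using y1 by (intro power_mono) (auto simp: P_def)
  finally have "y\<^sup>2 \<le> 32 * real s * (K powr (-3/4) * P powr (71/2000))" using main by (simp add: algebra_simps)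
  also have "\<dots> \<le> (36 * (real s)\<^sup>2) * (K powr (-3/4) * P powr (71/2000))"
  proof (rule mult_right_mono)
    have "real s * 1 \<le> real s * real s" using s by (intro mult_left_mono) auto
    then show "32 * real s \<le> 36 * (real s)\<^sup>2" by (simp add: power2_eq_square)
  qed simp
  also have "\<dots> = (6 * real s * P powr (71/4000) * K powr (-3/8))\<^sup>2"
    using P K by (simp add: power_mult_distrib powr_power)
  finally show ?thesis
    unfolding P_def K_def by (rule power2_le_imp_le) simp
qed

text \<open>The least value on a set of \<open>j\<close> large values satisfies both the supremum bound and the large
values bound with \<open>j\<close> elements. The power \<open>8/3\<close> of the latter is what turns \<open>j powr (-3/8)\<close> into
\<open>1 / j\<close>, and the remaining power \<open>7/3\<close> of the supremum bound, with the exponent \<open>-763/15000\<close>, outweighs the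
factor \<open>p powr (71/1500)\<close> that the large values bound loses.\<close>

lemma sum_large_le:
  defines "A \<equiv> {a \<in> {1..<int p}. rel_size a \<ge> real p powr (-1/10)}"
  shows "(\<Sum>a\<in>A. rel_size a ^ 5) \<le> sup_const powr (7/3) * (6 * real s) powr (8/3) * real p powr (-1/1000)"
proof -
  define P where "P = real p"
  have P: "P \<ge> 3" using P3 by (simp add: P_def)
  have A: "A \<subseteq> {1..<int p}" by (auto simp: A_def)
  have finA: "finite A" using A finite_subset by blast
  have sc: "sup_const > 0" by (simp add: sup_const_def add_pos_nonneg)
  define b where "b j = sup_const powr (7/3) * (6 * real s) powr (8/3) * P powr (-7/2000) * inverse (real j)" for j :: nat
  have "(\<Sum>a\<in>A. rel_size a ^ 5) \<le> (\<Sum>j\<in>{1..card A}. b j)"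
  proof (rule sum_fifth_powers_le_sorted[OF finA rel_size_nonneg])
    fix W assume W: "W \<subseteq> A" "W \<noteq> {}"
    then have finW: "finite W" using finA finite_subset by blast
    define y where "y = Min (rel_size ` W)"
    have "y \<in> rel_size ` W" unfolding y_def using finW W by (intro Min_in) auto
    then obtain a where a: "a \<in> W" "y = rel_size a" by auto
    have yW: "y \<le> rel_size c" if "c \<in> W" for c using finW that by (simp add: y_def)
    have y1: "y \<ge> P powr (-1/10)" using a W by (auto simp: A_def P_def)
    have y0: "y > 0" by (rule less_le_trans[OF _ y1]) (use P in simp)
    let ?K = "real (card W)"
    have K: "?K > 0" using W finW by (simp add: card_gt_0_iff)
    have B1: "y \<le> sup_const * P powr (-109/5000)"
    proof -
      have "\<not> int p dvd a" using a W A not_dvd_range by blast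
      from norm_bilinear_sum_le[OF this] show ?thesis
        using N_pos n_pos unfolding a(2) rel_size_def P_def by (simp add: divide_le_eq mult_ac)
    qed
    have B2: "y \<le> 6 * real s * P powr (71/4000) * ?K powr (-3/8)"
      unfolding P_def
      by (rule large_values_bound[OF _ W(2) yW]) (use W A y1 in \<open>auto simp: P_def\<close>)
    have "y ^ 5 = y powr 5" using y0 by (simp add: powr_numeral)
    also have "\<dots> = y powr (7/3) * y powr (8/3)" by (simp flip: powr_add)
    also have "\<dots> \<le> (sup_const * P powr (-109/5000)) powr (7/3)
        * (6 * real s * P powr (71/4000) * ?K powr (-3/8)) powr (8/3)"
      using B1 B2 y0 by (intro mult_mono powr_mono2) auto
    also have "\<dots> = sup_const powr (7/3) * P powr (-763/15000)
        * ((6 * real s) powr (8/3) * P powr (71/1500) * ?K powr (-1))"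
      using sc by (simp add: powr_mult powr_powr)
    also have "\<dots> = sup_const powr (7/3) * (6 * real s) powr (8/3)
        * (P powr (-763/15000) * P powr (71/1500)) * inverse ?K"
      using K by (simp add: powr_minus)
    also have "P powr (-763/15000) * P powr (71/1500) = P powr (-53/15000)" by (simp flip: powr_add)
    also have "sup_const powr (7/3) * (6 * real s) powr (8/3) * P powr (-53/15000) * inverse ?K \<le> b (card W)"
      unfolding b_def using P by (intro mult_right_mono mult_left_mono powr_mono) auto
    finally show "\<exists>a\<in>W. rel_size a ^ 5 \<le> b (card W)" using a by auto
  qed
  also have "\<dots> \<le> (\<Sum>j\<in>{1..p}. b j)"
  proof (rule sum_mono2)
    have "card A \<le> card {1..<int p}" using A by (intro card_mono) auto
    then show "{1..card A} \<subseteq> {1..p}" by auto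
  qed (auto simp: b_def)
  also have "\<dots> = sup_const powr (7/3) * (6 * real s) powr (8/3) * (P powr (-7/2000) * harm p)"
    by (simp add: b_def harm_def sum_distrib_left mult.assoc)
  also have "\<dots> \<le> sup_const powr (7/3) * (6 * real s) powr (8/3) * (P powr (-7/2000) * P powr (1/2000))"
    using harm_p by (intro mult_left_mono) (auto simp: P_def)
  also have "P powr (-7/2000) * P powr (1/2000) = P powr (-3/1000)" by (simp flip: powr_add)
  also have "sup_const powr (7/3) * (6 * real s) powr (8/3) * P powr (-3/1000)
     \<le> sup_const powr (7/3) * (6 * real s) powr (8/3) * P powr (-1/1000)"
    using P by (intro mult_left_mono powr_mono) auto
  finally show ?thesis by (simp add: P_def)
qed

text \<open>Three of the five factors are below \<open>p powr (-1/10)\<close>, and the squares of all the sizes sum to at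
most a constant times \<open>p powr (299/1000)\<close>.\<close>

lemma sum_small_le:
  "(\<Sum>a\<in>{a \<in> {1..<int p}. rel_size a < real p powr (-1/10)}. rel_size a ^ 5) \<le> 22 * real s * real p powr (-1/1000)"
proof -
  define P where "P = real p"
  define N where "N = real (card M)"
  define n' where "n' = real n"
  have P: "P \<ge> 3" using P3 by (simp add: P_def)
  have Pp: "P powr e > 0" for e using P by simp
  have pos: "N > 0" "n' > 0" using N_pos n_pos by (auto simp: N_def n'_def)
  have finM: "finite M" using M finite_subset by blast
  let ?B = "{a \<in> {1..<int p}. rel_size a < P powr (-1/10)}"
  have "(\<Sum>a\<in>?B. rel_size a ^ 5) \<le> (\<Sum>a\<in>?B. P powr (-3/10) * (rel_size a)\<^sup>2)"
  proof (rule sum_mono)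
    fix a assume a: "a \<in> ?B"
    have "rel_size a ^ 3 \<le> (P powr (-1/10)) ^ 3" using a rel_size_nonneg by (intro power_mono) auto
    also have "\<dots> = P powr (-3/10)" using P by (simp add: powr_power)
    finally have "rel_size a ^ 3 * (rel_size a)\<^sup>2 \<le> P powr (-3/10) * (rel_size a)\<^sup>2" by (rule mult_right_mono) simp
    then show "rel_size a ^ 5 \<le> P powr (-3/10) * (rel_size a)\<^sup>2" by (simp flip: power_add)
  qed
  also have "\<dots> = P powr (-3/10) * (\<Sum>a\<in>?B. (rel_size a)\<^sup>2)" by (rule sum_distrib_left[symmetric])
  also have "\<dots> \<le> P powr (-3/10) * (\<Sum>a\<in>{0..<int p}. (rel_size a)\<^sup>2)"
    by (intro mult_left_mono sum_mono2) auto
  also have "(\<Sum>a\<in>{0..<int p}. (rel_size a)\<^sup>2) = (\<Sum>a\<in>{0..<int p}. (norm (S a))\<^sup>2) / (N * n')\<^sup>2"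
    by (simp add: rel_size_def N_def n'_def power_divide sum_divide_distrib)
  also have "P powr (-3/10) * ((\<Sum>a\<in>{0..<int p}. (norm (S a))\<^sup>2) / (N * n')\<^sup>2)
      \<le> P powr (-3/10) * (22 * real s * P powr (299/1000))"
  proof (rule mult_left_mono)
    have N34: "N powr (-3/4) \<le> 2 * P powr (-579/1600)"
    proof -
      have "N powr (-3/4) \<le> (P powr (193/400) / 2) powr (-3/4)"
        using card_M pos Pp by (intro powr_mono2') (auto simp: P_def N_def)
      also have "\<dots> = P powr (-579/1600) * 2 powr (3/4)"
        using P by (simp add: powr_divide powr_powr powr_minus field_simps)
      also have "\<dots> \<le> P powr (-579/1600) * 2 powr 1"
        by (intro mult_left_mono powr_mono) auto
      finally show ?thesis by simp
    qed
    have N54: "N powr (5/4) = N\<^sup>2 * N powr (-3/4)"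
    proof -
      have "N\<^sup>2 * N powr (-3/4) = N powr 2 * N powr (-3/4)" using pos by (simp add: powr_numeral)
      then show ?thesis by (simp flip: powr_add)
    qed
    have "(\<Sum>a\<in>{0..<int p}. (norm (S a))\<^sup>2) \<le> P * real (energy M L n)"
      unfolding P_def by (rule sum_norm_bilinear_sum_squared_le[OF finM])
    also have "\<dots> \<le> P * (real s * n' * (3 * N\<^sup>2 * P powr (-1/4) + 4 * N powr (5/4) * P powr (1/2000)))"
      using energy_short_le[OF M] P unfolding P_def N_def n'_def by (intro mult_left_mono) auto
    also have "\<dots> = N\<^sup>2 * n' * (real s * (3 * (P * P powr (-1/4)) + 4 * N powr (-3/4) * (P * P powr (1/2000))))"
      unfolding N54 by (simp add: algebra_simps)
    also have "\<dots> \<le> N\<^sup>2 * n' * (real s * (11 * P powr (3/4)))"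
    proof -
      have 1: "P * P powr (-1/4) = P powr (3/4)"
        using P powr_add[of P 1 "-1/4"] by simp
      have "N powr (-3/4) * (P * P powr (1/2000)) \<le> 2 * P powr (-579/1600) * (P * P powr (1/2000))"
        using N34 P by (intro mult_right_mono) auto
      also have "\<dots> = 2 * P powr (-579/1600 + 1 + 1/2000)"
      proof -
        have "P powr a * (P * P powr b) = P powr (a + 1 + b)" for a b
          using P by (simp add: powr_add)
        from this[of "-579/1600" "1/2000"] show ?thesis by simp
      qed
      also have "\<dots> \<le> 2 * P powr (3/4)" using P by (intro mult_left_mono powr_mono) auto
      finally have "3 * (P * P powr (-1/4)) + 4 * N powr (-3/4) * (P * P powr (1/2000)) \<le> 11 * P powr (3/4)"
        unfolding 1 by (simp add: mult_ac)
      then show ?thesis using pos by (intro mult_left_mono) auto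
    qed
    also have "\<dots> \<le> N\<^sup>2 * n' * (real s * (22 * (P powr (299/1000) * n')))"
    proof -
      have "P powr (3/4) \<le> P powr (299/1000 + 193/400)" using P by (intro powr_mono) auto
      also have "\<dots> = P powr (299/1000) * P powr (193/400)" by (rule powr_add)
      also have "\<dots> \<le> P powr (299/1000) * (2 * n')"
        using n_lower by (intro mult_left_mono) (auto simp: P_def n'_def)
      finally have "11 * P powr (3/4) \<le> 22 * (P powr (299/1000) * n')"
        by (simp add: mult_ac)
      then show ?thesis using pos by (intro mult_left_mono) simp_all
    qed
    finally have "(\<Sum>a\<in>{0..<int p}. (norm (S a))\<^sup>2) \<le> 22 * real s * P powr (299/1000) * (N * n')\<^sup>2"
      by (simp add: power2_eq_square mult_ac)
    then show "(\<Sum>a\<in>{0..<int p}. (norm (S a))\<^sup>2) / (N * n')\<^sup>2 \<le> 22 * real s * P powr (299/1000)"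
      using pos by (simp add: divide_le_eq)
  qed simp
  also have "\<dots> = 22 * real s * P powr (-1/1000)" by (simp flip: powr_add)
  finally show ?thesis by (simp add: P_def)
qed

lemma fifth_moment_short_le:
  "(\<Sum>a\<in>{1..<int p}. norm (S a) ^ 5)
    \<le> (sup_const powr (7/3) * (6 * real s) powr (8/3) + 22 * real s) * real p powr (-1/1000)
      * (real (card M) * real n) ^ 5"
proof -
  let ?F = "{1..<int p}" and ?t = "real p powr (-1/10)"
  have "?F = {a \<in> ?F. rel_size a \<ge> ?t} \<union> {a \<in> ?F. rel_size a < ?t}" by auto
  then have "(\<Sum>a\<in>?F. rel_size a ^ 5) = (\<Sum>a\<in>{a \<in> ?F. rel_size a \<ge> ?t} \<union> {a \<in> ?F. rel_size a < ?t}. rel_size a ^ 5)"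
    by (rule arg_cong)
  also have "\<dots> = (\<Sum>a\<in>{a \<in> ?F. rel_size a \<ge> ?t}. rel_size a ^ 5) + (\<Sum>a\<in>{a \<in> ?F. rel_size a < ?t}. rel_size a ^ 5)"
    by (rule sum.union_disjoint) (auto intro: finite_subset[of _ ?F])
  also have "\<dots> \<le> (sup_const powr (7/3) * (6 * real s) powr (8/3) + 22 * real s) * real p powr (-1/1000)"
    using sum_large_le sum_small_le by (simp add: distrib_right)
  finally have "(\<Sum>a\<in>?F. rel_size a ^ 5) * (real (card M) * real n) ^ 5
    \<le> (sup_const powr (7/3) * (6 * real s) powr (8/3) + 22 * real s) * real p powr (-1/1000)
      * (real (card M) * real n) ^ 5"
    by (rule mult_right_mono) simp
  moreover have "rel_size a ^ 5 * (real (card M) * real n) ^ 5 = norm (S a) ^ 5" for a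
    using N_pos n_pos by (simp add: rel_size_def flip: power_mult_distrib)
  ultimately show ?thesis by (simp add: sum_distrib_right)
qed

end

section \<open>Long intervals and the counting formula\<close>

lemma sum_blocks:
  fixes f :: "int \<Rightarrow> 'a :: comm_monoid_add"
  assumes "e 0 = 0" and e: "\<And>j. j < q \<Longrightarrow> e j \<le> e (Suc j)"
  shows "(\<Sum>x\<in>{L+1..L+int (e q)}. f x)
    = (\<Sum>j<q. \<Sum>x\<in>{L+int (e j)+1..L+int (e j)+int (e (Suc j) - e j)}. f x)"
  using e
proof (induction q)
  case 0
  then show ?case using assms(1) by simp
next
  case (Suc q)
  have le: "e q \<le> e (Suc q)" using Suc.prems by simp
  have "{L+1..L+int (e (Suc q))} = {L+1..L+int (e q)} \<union> {L+int (e q)+1..L+int (e (Suc q))}"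
    using le by auto
  then have "(\<Sum>x\<in>{L+1..L+int (e (Suc q))}. f x)
     = (\<Sum>x\<in>{L+1..L+int (e q)}. f x) + (\<Sum>x\<in>{L+int (e q)+1..L+int (e (Suc q))}. f x)"
    by (simp add: sum.union_disjoint)
  moreover have "L + int (e (Suc q)) = L + int (e q) + int (e (Suc q) - e q)" using le by simp
  ultimately show ?case using Suc by (simp add: add.assoc del: of_nat_diff)
qed

lemma sum_power5_le:
  fixes y :: "nat \<Rightarrow> real"
  assumes "\<And>j. j < q \<Longrightarrow> y j \<ge> 0"
  shows "(\<Sum>j<q. y j) ^ 5 \<le> real q ^ 4 * (\<Sum>j<q. y j ^ 5)"
proof (cases "q = 0")
  case False
  have "(\<Sum>j<q. (1 / real q) *\<^sub>R y j) ^ 5 \<le> (\<Sum>j<q. 1 / real q * y j ^ 5)"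
    by (rule convex_on_sum[OF _ _ convex_power_odd[of 5]]) (use False assms in auto)
  then have "((\<Sum>j<q. y j) / real q) ^ 5 \<le> (\<Sum>j<q. y j ^ 5) / real q"
    by (simp add: sum_divide_distrib)
  then have "(\<Sum>j<q. y j) ^ 5 / real q ^ 5 \<le> (\<Sum>j<q. y j ^ 5) / real q"
    by (simp add: power_divide)
  then have "(\<Sum>j<q. y j) ^ 5 \<le> (\<Sum>j<q. y j ^ 5) / real q * real q ^ 5"
    using False by (subst (asm) pos_divide_le_eq) auto
  then show ?thesis using False by (simp add: numeral_eq_Suc mult_ac)
qed simp

text \<open>Replace all the factors by the largest one.\<close>

lemma prod_le_sum_powers:
  fixes y :: "nat \<Rightarrow> real"
  assumes I: "finite I" "I \<noteq> {}" and y: "\<And>i. i \<in> I \<Longrightarrow> y i \<ge> 0"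
  shows "(\<Prod>i\<in>I. y i) \<le> (\<Sum>i\<in>I. y i ^ card I)"
proof -
  define m where "m = Max (y ` I)"
  have "m \<in> y ` I" unfolding m_def using I by (intro Max_in) auto
  then obtain k where k: "k \<in> I" "m = y k" by auto
  have "y i \<le> m" if "i \<in> I" for i using I that by (simp add: m_def)
  then have "(\<Prod>i\<in>I. y i) \<le> (\<Prod>i\<in>I. m)" using y by (intro prod_mono) auto
  also have "\<dots> = y k ^ card I" by (simp add: k)
  also have "\<dots> \<le> (\<Sum>i\<in>I. y i ^ card I)" using k I y by (intro member_le_sum) auto
  finally show ?thesis .
qed

context reciprocal_powers
begin

text \<open>By convexity, \<open>q\<close> blocks cost the factor \<open>q ^ 5\<close>. It is recovered from \<open>q * n0 \<le> n\<close>, and the constant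
\<open>32\<close> comes from blocks that are up to twice as long as \<open>n0\<close>.\<close>

lemma fifth_moment_long_le:
  assumes M: "M \<subseteq> {1..<int p}"
    and nd: "\<And>x. x \<in> {L+1..L+int n} \<Longrightarrow> \<not> int p dvd x"
    and n0: "n0 > 0" "n0 \<le> n"
    and short: "\<And>K k. n0 \<le> k \<Longrightarrow> k < 2 * n0 \<Longrightarrow> (\<And>x. x \<in> {K+1..K+int k} \<Longrightarrow> \<not> int p dvd x) \<Longrightarrow>
      (\<Sum>a\<in>{1..<int p}. norm (bilinear_sum M K k a) ^ 5) \<le> B * (real (card M) * real k) ^ 5"
    and B: "B \<ge> 0"
  shows "(\<Sum>a\<in>{1..<int p}. norm (bilinear_sum M L n a) ^ 5) \<le> 32 * B * (real (card M) * real n) ^ 5"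
proof -
  define q where "q = n div n0"
  have q0: "q > 0" using n0 by (simp add: q_def div_greater_zero_iff)
  \<comment> \<open>the right end of the last block is moved to \<open>n\<close>\<close>
  define e where "e j = (if j = q then n else j * n0)" for j
  have qn: "q * n0 \<le> n" "n < (q + 1) * n0"
    using n0 by (simp_all add: q_def) (metis add.commute dividend_less_div_times mult.commute mult_Suc_right)
  define len where "len j = e (Suc j) - e j" for j
  have len: "n0 \<le> len j" "len j < 2 * n0" "e j \<le> e (Suc j)" "e j + len j \<le> n" if j: "j < q" for j
  proof -
    have "n0 \<le> len j \<and> len j < 2 * n0 \<and> e j \<le> e (Suc j) \<and> e j + len j \<le> n"
    proof (cases "Suc j = q")
      case True
      define t where "t = j * n0"
      have "len j = n - t" "e j = t" "e (Suc j) = n" using j True by (auto simp: len_def e_def t_def)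
      moreover have "t + n0 \<le> n" "n < t + 2 * n0" using qn by (auto simp: t_def simp flip: True)
      ultimately show ?thesis by linarith
    next
      case False
      define t where "t = j * n0"
      have "len j = n0" "e j = t" "e (Suc j) = t + n0" using j False by (auto simp: len_def e_def t_def)
      moreover have "(Suc j) * n0 \<le> q * n0" using j by (intro mult_right_mono) auto
      then have "t + n0 \<le> n" using qn(1) by (simp add: t_def)
      ultimately show ?thesis using n0 by linarith
    qed
    then show "n0 \<le> len j" "len j < 2 * n0" "e j \<le> e (Suc j)" "e j + len j \<le> n" by auto
  qed
  have e0: "e 0 = 0" "e q = n" using q0 by (auto simp: e_def)
  have split: "bilinear_sum M L n a = (\<Sum>j<q. bilinear_sum M (L + int (e j)) (len j) a)" for a
  proof -
    have "bilinear_sum M L n a = (\<Sum>m\<in>M. \<Sum>x\<in>{L+1..L+int (e q)}. add_char p (a * (m * recip_pow x)))"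
      by (simp add: bilinear_sum_def e0)
    also have "\<dots> = (\<Sum>m\<in>M. \<Sum>j<q. \<Sum>x\<in>{L+int (e j)+1..L+int (e j)+int (len j)}. add_char p (a * (m * recip_pow x)))"
      unfolding len_def by (intro sum.cong[OF refl] sum_blocks e0 len)
    also have "\<dots> = (\<Sum>j<q. bilinear_sum M (L + int (e j)) (len j) a)"
      unfolding bilinear_sum_def by (rule sum.swap)
    finally show ?thesis .
  qed
  let ?F = "{1..<int p}"
  let ?T = "\<lambda>j a. norm (bilinear_sum M (L + int (e j)) (len j) a)"
  have block: "(\<Sum>a\<in>?F. ?T j a ^ 5) \<le> B * (real (card M) * real (2 * n0)) ^ 5" if j: "j < q" for j
  proof -
    have "(\<Sum>a\<in>?F. ?T j a ^ 5) \<le> B * (real (card M) * real (len j)) ^ 5"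
    proof (rule short[OF len(1)[OF j] len(2)[OF j]])
      fix x assume "x \<in> {L + int (e j) + 1..L + int (e j) + int (len j)}"
      then have "x \<in> {L+1..L+int n}" using len(4)[OF j] by auto
      then show "\<not> int p dvd x" by (rule nd)
    qed
    also have "\<dots> \<le> B * (real (card M) * real (2 * n0)) ^ 5"
      using len(2)[OF j] B by (intro mult_left_mono power_mono) auto
    finally show ?thesis .
  qed
  have "(\<Sum>a\<in>?F. norm (bilinear_sum M L n a) ^ 5) \<le> (\<Sum>a\<in>?F. real q ^ 4 * (\<Sum>j<q. ?T j a ^ 5))"
  proof (rule sum_mono)
    fix a
    have "norm (bilinear_sum M L n a) \<le> (\<Sum>j<q. ?T j a)" unfolding split by (rule norm_sum)
    then have "norm (bilinear_sum M L n a) ^ 5 \<le> (\<Sum>j<q. ?T j a) ^ 5" by (rule power_mono) simp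
    also have "\<dots> \<le> real q ^ 4 * (\<Sum>j<q. ?T j a ^ 5)" by (rule sum_power5_le) simp
    finally show "norm (bilinear_sum M L n a) ^ 5 \<le> real q ^ 4 * (\<Sum>j<q. ?T j a ^ 5)" .
  qed
  also have "\<dots> = real q ^ 4 * (\<Sum>j<q. \<Sum>a\<in>?F. ?T j a ^ 5)"
    by (subst sum.swap) (simp add: sum_distrib_left)
  also have "\<dots> \<le> real q ^ 4 * (\<Sum>j<q. B * (real (card M) * real (2 * n0)) ^ 5)"
    using block by (intro mult_left_mono sum_mono) auto
  also have "\<dots> = 32 * B * (real (card M) * real (q * n0)) ^ 5"
    by (simp add: power_mult_distrib numeral_eq_Suc mult_ac)
  also have "\<dots> \<le> 32 * B * (real (card M) * real n) ^ 5"
    using qn(1) B by (intro mult_left_mono power_mono) (auto simp flip: of_nat_mult)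
  finally show ?thesis .
qed

lemma Fp_star_eq: "Fp_star p = {1..<int p}"
  by (auto simp: Fp_star_def residue_ring_def)

lemma residues_p: "residues (int p)"
  using p3 by (simp add: residues_def)

text \<open>Among \<open>p\<close> consecutive integers there is a multiple of \<open>p\<close>. So the interval is shorter, and its points
are distinct modulo \<open>p\<close>.\<close>

lemma shifted_interval_facts:
  assumes sub: "shifted_interval p L N \<subseteq> Fp_star p"
  shows "\<And>x. x \<in> {L+1..L+int N} \<Longrightarrow> \<not> int p dvd x"
    and "inj_on (\<lambda>k. k mod int p) {L+1..L+int N}"
    and "shifted_interval p L N = (\<lambda>k. k mod int p) ` {L+1..L+int N}"
proof -
  have im: "shifted_interval p L N = (\<lambda>k. k mod int p) ` {L+1..L+int N}"
  proof -
    have eq: "{L+1..L+int N} = (\<lambda>k. L + k) ` {1..int N}" by simp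
    show ?thesis unfolding shifted_interval_def eq by (rule image_image[symmetric])
  qed
  then show "shifted_interval p L N = (\<lambda>k. k mod int p) ` {L+1..L+int N}" .
  show nd: "\<not> int p dvd x" if "x \<in> {L+1..L+int N}" for x
  proof -
    have "x mod int p \<in> {1..<int p}" using that sub im Fp_star_eq by blast
    then show ?thesis by auto
  qed
  have Np: "int N < int p"
  proof (rule ccontr)
    assume "\<not> int N < int p"
    define x where "x = L + int p - L mod int p"
    have "0 \<le> L mod int p" "L mod int p < int p" using p_pos by auto
    then have "x \<in> {L+1..L+int N}" using \<open>\<not> int N < int p\<close> by (auto simp: x_def)
    moreover have "int p dvd x"
    proof -
      have "x = int p * (L div int p) + int p" unfolding x_def by (simp add: minus_mod_eq_mult_div algebra_simps)
      then show ?thesis by simp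
    qed
    ultimately show False using nd by blast
  qed
  show "inj_on (\<lambda>k. k mod int p) {L+1..L+int N}"
  proof (rule inj_onI, rule ccontr)
    fix x y assume xy: "x \<in> {L+1..L+int N}" "y \<in> {L+1..L+int N}" "x mod int p = y mod int p" "x \<noteq> y"
    then have "int p dvd \<bar>x - y\<bar>" by (simp add: mod_eq_dvd_iff)
    then have "int p \<le> \<bar>x - y\<bar>" using xy(4) by (intro zdvd_imp_le) auto
    then show False using xy(1,2) Np by auto
  qed
qed

lemma ring_inverse_power:
  assumes "x \<in> {1..<int p}"
  shows "inv\<^bsub>Fp p\<^esub> (x [^]\<^bsub>Fp p\<^esub> s) = recip_pow x mod int p"
proof -
  interpret R: residues "int p" "Fp p" using residues_p by simp_all
  have "(x mod int p) [^]\<^bsub>Fp p\<^esub> s = x ^ s mod int p" by (rule R.pow_cong)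
  then have pw: "x [^]\<^bsub>Fp p\<^esub> s = x ^ s mod int p" using assms by simp
  show ?thesis unfolding pw
  proof (rule R.comm_inv_char)
    have "[x ^ s * recip_pow x = 1] (mod int p)" using assms not_dvd_range recip_pow_inverse by blast
    then have "x ^ s * recip_pow x mod int p = 1 mod int p" by (simp only: Cong.cong_def)
    then show "(x ^ s mod int p) \<otimes>\<^bsub>Fp p\<^esub> (recip_pow x mod int p) = \<one>\<^bsub>Fp p\<^esub>"
      by (simp only: R.mult_cong R.one_cong)
  qed auto
qed

lemma ring_equation_iff:
  assumes x: "\<And>i. i \<in> {1..5::nat} \<Longrightarrow> x i \<in> {1..<int p}" and a: "a \<in> carrier (Fp p)"
  shows "(\<Oplus>\<^bsub>Fp p\<^esub>i\<in>{1..5}. m i \<otimes>\<^bsub>Fp p\<^esub> inv\<^bsub>Fp p\<^esub> (x i [^]\<^bsub>Fp p\<^esub> s)) = a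
    \<longleftrightarrow> int p dvd (\<Sum>i\<in>{1..5}. m i * recip_pow (x i)) - a"
proof -
  let ?lhs = "\<Oplus>\<^bsub>Fp p\<^esub>i\<in>{1..5}. m i \<otimes>\<^bsub>Fp p\<^esub> inv\<^bsub>Fp p\<^esub> (x i [^]\<^bsub>Fp p\<^esub> s)"
  interpret R: residues "int p" "Fp p" using residues_p by simp_all
  have "m i \<otimes>\<^bsub>Fp p\<^esub> inv\<^bsub>Fp p\<^esub> (x i [^]\<^bsub>Fp p\<^esub> s) = (m i * recip_pow (x i)) mod int p"
    if "i \<in> {1..5}" for i
    unfolding ring_inverse_power[OF x[OF that]] R.res_mult_eq by (simp add: mod_mult_right_eq)
  then have "?lhs
      = (\<Oplus>\<^bsub>Fp p\<^esub>i\<in>{1..5}. (m i * recip_pow (x i)) mod int p)"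
    by (intro R.finsum_cong') auto
  also have "\<dots> = (\<Sum>i\<in>{1..5}. m i * recip_pow (x i)) mod int p" by (rule R.sum_cong) simp
  finally have "?lhs
      = (\<Sum>i\<in>{1..5}. m i * recip_pow (x i)) mod int p" .
  moreover have "a mod int p = a" using a by (simp add: residue_ring_def)
  ultimately show ?thesis by (metis mod_eq_dvd_iff)
qed

lemma T5_formula:
  assumes M: "\<And>i. i \<in> {1..5} \<Longrightarrow> M i \<subseteq> Fp_star p"
    and X: "\<And>i. i \<in> {1..5} \<Longrightarrow> shifted_interval p (L i) N \<subseteq> Fp_star p"
    and a: "a \<in> carrier (Fp p)"
  shows "of_nat (p * T5 p s M (\<lambda>i. shifted_interval p (L i) N) a)
    = (\<Sum>b\<in>{0..<int p}. add_char p (- (b * a)) * (\<Prod>i\<in>{1..5}. bilinear_sum (M i) (L i) N b))"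
proof -
  let ?r = "\<lambda>m x. \<Oplus>\<^bsub>Fp p\<^esub>i\<in>{1..5}. m i \<otimes>\<^bsub>Fp p\<^esub> inv\<^bsub>Fp p\<^esub> (x i [^]\<^bsub>Fp p\<^esub> s)"
  let ?X = "\<lambda>i. shifted_interval p (L i) N"
  let ?PM = "Pi\<^sub>E {1..5} M" and ?PX = "Pi\<^sub>E {1..5} ?X"
  let ?g = "\<lambda>m x. (\<Sum>i\<in>{1..5}. m i * recip_pow (x i)) - a"
  have finM: "finite (M i)" if "i \<in> {1..5}" for i
    using M[OF that] finite_subset unfolding Fp_star_eq by blast
  have finX: "finite (?X i)" for i by (simp add: shifted_interval_def)
  have finP: "finite (?PM \<times> ?PX)" using finM finX by (intro finite_cartesian_product finite_PiE) auto
  have "{(m, x). m \<in> ?PM \<and> x \<in> ?PX \<and>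
      ?r m x = a}
    = {t \<in> ?PM \<times> ?PX. int p dvd ?g (fst t) (snd t)}"
  proof -
    have iff: "?r m x = a \<longleftrightarrow> int p dvd ?g m x"
      if "x \<in> ?PX" for m x
    proof (rule ring_equation_iff[OF _ a])
      fix i :: nat assume i: "i \<in> {1..5}"
      then have "x i \<in> ?X i" using that by auto
      then show "x i \<in> {1..<int p}" using X[OF i] Fp_star_eq by blast
    qed
    show ?thesis
    proof (rule Set.set_eqI)
      fix t :: "(nat \<Rightarrow> int) \<times> (nat \<Rightarrow> int)"
      obtain m x where t: "t = (m, x)" by (cases t)
      show "t \<in> {(m, x). m \<in> ?PM \<and> x \<in> ?PX \<and>
          ?r m x = a}
        \<longleftrightarrow> t \<in> {t \<in> ?PM \<times> ?PX. int p dvd ?g (fst t) (snd t)}"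
        using iff[of x m] unfolding t by (cases "x \<in> ?PX") simp_all
    qed
  qed
  then have "of_nat (p * T5 p s M ?X a) = (\<Sum>t\<in>{t \<in> ?PM \<times> ?PX. int p dvd ?g (fst t) (snd t)}. complex_of_nat p)"
    by (simp add: T5_def)
  also have "\<dots> = (\<Sum>t\<in>?PM \<times> ?PX. if int p dvd ?g (fst t) (snd t) then of_nat p else 0)"
    by (rule sum.inter_filter[OF finP])
  also have "\<dots> = (\<Sum>t\<in>?PM \<times> ?PX. \<Sum>b\<in>{0..<int p}. add_char p (b * ?g (fst t) (snd t)))"
    by (simp only: sum_add_char[OF p_pos])
  also have "\<dots> = (\<Sum>b\<in>{0..<int p}. \<Sum>t\<in>?PM \<times> ?PX. add_char p (b * ?g (fst t) (snd t)))"
    by (rule sum.swap)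
  also have "\<dots> = (\<Sum>b\<in>{0..<int p}. add_char p (- (b * a)) * (\<Prod>i\<in>{1..5}. bilinear_sum (M i) (L i) N b))"
  proof (rule sum.cong[OF refl])
    fix b
    have interval: "(\<Sum>y\<in>?X i. add_char p (b * (k * recip_pow y)))
        = (\<Sum>y\<in>{L i + 1..L i + int N}. add_char p (b * (k * recip_pow y)))" if i: "i \<in> {1..5}" for i k
    proof -
      have "(\<Sum>y\<in>?X i. add_char p (b * (k * recip_pow y)))
          = (\<Sum>y\<in>{L i + 1..L i + int N}. add_char p (b * (k * recip_pow (y mod int p))))"
        unfolding shifted_interval_facts(3)[OF X[OF i]]
        by (rule sum.reindex_cong[OF shifted_interval_facts(2)[OF X[OF i]]]) auto
      also have "\<dots> = (\<Sum>y\<in>{L i + 1..L i + int N}. add_char p (b * (k * recip_pow y)))"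
        by (intro sum.cong refl add_char_cong p_pos cong_mult cong_refl recip_pow_cong) (simp add: Cong.cong_def)
      finally show ?thesis .
    qed
    have "(\<Sum>t\<in>?PM \<times> ?PX. add_char p (b * ?g (fst t) (snd t)))
      = (\<Sum>m\<in>?PM. \<Sum>x\<in>?PX. add_char p (- (b * a)) * (\<Prod>i\<in>{1..5}. add_char p (b * (m i * recip_pow (x i)))))"
    proof -
      have "add_char p (b * ?g m x) = add_char p (- (b * a)) * (\<Prod>i\<in>{1..5}. add_char p (b * (m i * recip_pow (x i))))"
        for m x :: "nat \<Rightarrow> int"
      proof -
        have "b * ?g m x = - (b * a) + (\<Sum>i\<in>{1..5}. b * (m i * recip_pow (x i)))"
          by (simp add: right_diff_distrib sum_distrib_left)
        then show ?thesis by (simp only: add_char_add add_char_sum finite_atLeastAtMost)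
      qed
      then show ?thesis by (simp add: sum.cartesian_product case_prod_unfold)
    qed
    also have "\<dots> = add_char p (- (b * a)) * (\<Sum>m\<in>?PM. \<Sum>x\<in>?PX. \<Prod>i\<in>{1..5}. add_char p (b * (m i * recip_pow (x i))))"
      by (simp only: sum_distrib_left)
    also have "(\<Sum>m\<in>?PM. \<Sum>x\<in>?PX. \<Prod>i\<in>{1..5}. add_char p (b * (m i * recip_pow (x i))))
        = (\<Sum>m\<in>?PM. \<Prod>i\<in>{1..5}. \<Sum>y\<in>?X i. add_char p (b * (m i * recip_pow y)))"
      by (intro sum.cong[OF refl] prod_sum_PiE[symmetric] finX) simp
    also have "\<dots> = (\<Prod>i\<in>{1..5}. \<Sum>k\<in>M i. \<Sum>y\<in>?X i. add_char p (b * (k * recip_pow y)))"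
      by (intro prod_sum_PiE[symmetric] finM) simp
    also have "\<dots> = (\<Prod>i\<in>{1..5}. bilinear_sum (M i) (L i) N b)"
      unfolding bilinear_sum_def by (intro prod.cong[OF refl] sum.cong[OF refl] interval)
    finally show "(\<Sum>t\<in>?PM \<times> ?PX. add_char p (b * ?g (fst t) (snd t)))
      = add_char p (- (b * a)) * (\<Prod>i\<in>{1..5}. bilinear_sum (M i) (L i) N b)" .
  qed
  finally show ?thesis .
qed

text \<open>The frequency \<open>0\<close> contributes \<open>N ^ 10 / p\<close>. At the other frequencies the product of the five
sums is estimated by the sum of their fifth powers.\<close>

lemma T5_error_le:
  assumes M: "\<And>i. i \<in> {1..5} \<Longrightarrow> M i \<subseteq> Fp_star p" "\<And>i. i \<in> {1..5} \<Longrightarrow> card (M i) = N"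
    and X: "\<And>i. i \<in> {1..5} \<Longrightarrow> shifted_interval p (L i) N \<subseteq> Fp_star p"
    and a: "a \<in> carrier (Fp p)"
    and B: "\<And>i. i \<in> {1..5} \<Longrightarrow> (\<Sum>b\<in>{1..<int p}. norm (bilinear_sum (M i) (L i) N b) ^ 5) \<le> B"
  shows "\<bar>real (T5 p s M (\<lambda>i. shifted_interval p (L i) N) a) - real N ^ 10 / real p\<bar> \<le> 5 * B / real p"
proof -
  let ?T = "T5 p s M (\<lambda>i. shifted_interval p (L i) N) a"
  let ?S = "\<lambda>i b. bilinear_sum (M i) (L i) N b"
  let ?t = "\<lambda>b. add_char p (- (b * a)) * (\<Prod>i\<in>{1..5}. ?S i b)"
  have "?S i 0 = of_nat (N * N)" if "i \<in> {1..5}" for i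
    using M(2)[OF that] by (simp add: bilinear_sum_def)
  then have "(\<Prod>i\<in>{1..5}. ?S i 0) = (\<Prod>i\<in>{1..5::nat}. of_nat (N * N))" by (intro prod.cong) auto
  then have t0: "?t 0 = of_real (real N ^ 10)"
    by (simp add: power_mult_distrib flip: power_add)
  have "{0..<int p} = insert 0 {1..<int p}" using p_pos by auto
  then have "of_nat (p * ?T) = ?t 0 + (\<Sum>b\<in>{1..<int p}. ?t b)"
    using T5_formula[OF M(1) X a] by simp
  then have "complex_of_real (real p * real ?T - real N ^ 10) = (\<Sum>b\<in>{1..<int p}. ?t b)"
    unfolding t0 by simp
  then have "\<bar>real p * real ?T - real N ^ 10\<bar> = norm (\<Sum>b\<in>{1..<int p}. ?t b)"
    by (metis norm_of_real)
  also have "\<dots> \<le> (\<Sum>b\<in>{1..<int p}. \<Sum>i\<in>{1..5}. norm (?S i b) ^ 5)"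
  proof (rule sum_norm_le)
    fix b
    have "norm (?t b) = (\<Prod>i\<in>{1..5}. norm (?S i b))" by (simp add: norm_mult prod_norm)
    also have "\<dots> \<le> (\<Sum>i\<in>{1..5}. norm (?S i b) ^ card {1..5::nat})"
      by (rule prod_le_sum_powers) auto
    finally show "norm (?t b) \<le> (\<Sum>i\<in>{1..5}. norm (?S i b) ^ 5)" by simp
  qed
  also have "\<dots> = (\<Sum>i\<in>{1..5}. \<Sum>b\<in>{1..<int p}. norm (?S i b) ^ 5)" by (rule sum.swap)
  also have "\<dots> \<le> (\<Sum>i\<in>{1..5::nat}. B)" by (rule sum_mono[OF B])
  finally have "\<bar>real p * real ?T - real N ^ 10\<bar> \<le> 5 * B" by simp
  moreover have "\<bar>real ?T - real N ^ 10 / real p\<bar> = \<bar>real p * real ?T - real N ^ 10\<bar> / real p"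
  proof -
    have "real ?T - real N ^ 10 / real p = (real p * real ?T - real N ^ 10) / real p"
      using p_pos by (simp add: field_simps)
    then show ?thesis by (simp add: abs_divide)
  qed
  ultimately show ?thesis using p_pos by (simp add: divide_right_mono)
qed

end

text \<open>The exponent \<open>1/4000\<close> is used once for the divisor bound and once for the logarithm.\<close>

lemma eventually_divisor_harm:
  obtains D :: "nat \<Rightarrow> nat" where
    "\<And>p m. m \<in> {1..p} \<Longrightarrow> card {d. d dvd m} \<le> D p"
    "eventually (\<lambda>p. real (D p) * harm p \<le> real p powr (1/2000) \<and> harm p \<le> real p powr (1/2000)) at_top"
proof -
  obtain C :: real where C: "C \<ge> 1" "\<And>n. n > 0 \<Longrightarrow> real (card {d. d dvd n}) \<le> C * real n powr (1/4000)"
    using card_divisors_le_powr[of "1/4000"] by auto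
  define D where "D p = nat \<lfloor>C * real p powr (1/4000)\<rfloor>" for p
  show ?thesis
  proof
    fix p m :: nat assume m: "m \<in> {1..p}"
    have "real (card {d. d dvd m}) \<le> C * real m powr (1/4000)" using m by (intro C) auto
    also have "\<dots> \<le> C * real p powr (1/4000)" using m C(1) by (intro mult_left_mono powr_mono2) auto
    finally show "card {d. d dvd m} \<le> D p" unfolding D_def by (rule le_nat_floor)
  next
    have "eventually (\<lambda>x::real. C * (1 + ln x) \<le> x powr (1/4000)) at_top" using C(1) by real_asymp
    then have "eventually (\<lambda>p. C * (1 + ln (real p)) \<le> real p powr (1/4000)) at_top"
      by (rule eventually_compose_filterlim[OF _ filterlim_real_sequentially])
    moreover have "eventually (\<lambda>p::nat. p \<ge> 1) at_top" by (rule eventually_ge_at_top)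
    ultimately show "eventually (\<lambda>p. real (D p) * harm p \<le> real p powr (1/2000) \<and> harm p \<le> real p powr (1/2000)) at_top"
    proof eventually_elim
      case (elim p)
      have h: "harm p \<le> 1 + ln (real p)"
      proof -
        have "harm p - ln (real p) \<le> harm 1 - ln (real (1::nat))"
          using decseqD[OF decseq_harm_diff_ln, of 0 "p - 1"] elim(2) by (simp del: of_nat_Suc)
        then show ?thesis by (simp add: harm_def)
      qed
      have l0: "ln (real p) \<ge> 0" using elim(2) by simp
      have D1: "real (D p) \<le> C * real p powr (1/4000)"
        unfolding D_def using C(1) by (intro of_nat_floor) simp
      have "real (D p) * harm p \<le> (C * real p powr (1/4000)) * (1 + ln (real p))"
        using D1 h C(1) by (intro mult_mono) (auto simp: harm_nonneg)
      also have "\<dots> = real p powr (1/4000) * (C * (1 + ln (real p)))" by simp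
      also have "\<dots> \<le> real p powr (1/4000) * real p powr (1/4000)"
        using elim(1) by (intro mult_left_mono) auto
      also have "\<dots> = real p powr (1/2000)" by (simp flip: powr_add)
      finally have 1: "real (D p) * harm p \<le> real p powr (1/2000)" .
      have "1 * (1 + ln (real p)) \<le> C * (1 + ln (real p))"
        using C(1) l0 by (intro mult_right_mono) auto
      then have "harm p \<le> C * (1 + ln (real p))" unfolding mult_1 by (rule order_trans[OF h])
      also have "\<dots> \<le> real p powr (1/4000)" by (rule elim(1))
      also have "\<dots> \<le> real p powr (1/2000)" using elim(2) by (intro powr_mono) auto
      finally show ?case using 1 by simp
    qed
  qed
qed

theorem corollary1p3:
  fixes s :: nat and \<epsilon> :: real
  assumes "s \<ge> 1" and "\<epsilon> > 0"
  shows "\<exists>\<delta>>0. \<exists>C::real. \<exists>p\<^sub>0::nat. \<forall>p N :: nat. \<forall>M :: nat \<Rightarrow> int set. \<forall>L :: nat \<Rightarrow> int. \<forall>a :: int.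
    prime p \<longrightarrow> p \<ge> p\<^sub>0 \<longrightarrow>
    real N > real p powr (14 / 29 + \<epsilon>) \<longrightarrow>
    (\<forall>i\<in>{1..5}. M i \<subseteq> Fp_star p \<and> card (M i) = N) \<longrightarrow>
    (\<forall>i\<in>{1..5}. shifted_interval p (L i) N \<subseteq> Fp_star p) \<longrightarrow>
    a \<in> carrier (Fp p) \<longrightarrow>
    \<bar>real (T5 p s M (\<lambda>i. shifted_interval p (L i) N) a) - real N ^ 10 / real p\<bar>
      \<le> C * (real N ^ 10 / real p) * real p powr (- \<delta>)"
proof -
  obtain D :: "nat \<Rightarrow> nat" where
    D: "\<And>p m. m \<in> {1..p} \<Longrightarrow> card {d. d dvd m} \<le> D p" and
    D_harm: "eventually (\<lambda>p. real (D p) * harm p \<le> real p powr (1/2000) \<and> harm p \<le> real p powr (1/2000)) at_top"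
    using eventually_divisor_harm by blast
  have "eventually (\<lambda>p. sufficiently_large s (real p)) at_top"
    by (rule eventually_compose_filterlim[OF eventually_sufficiently_large filterlim_real_sequentially])
  with D_harm have "eventually (\<lambda>p. sufficiently_large s (real p) \<and>
      real (D p) * harm p \<le> real p powr (1/2000) \<and> harm p \<le> real p powr (1/2000)) at_top"
    by eventually_elim simp
  then obtain p0 where p0: "\<And>p. p \<ge> p0 \<Longrightarrow> sufficiently_large s (real p)"
      "\<And>p. p \<ge> p0 \<Longrightarrow> real (D p) * harm p \<le> real p powr (1/2000)"
      "\<And>p. p \<ge> p0 \<Longrightarrow> harm p \<le> real p powr (1/2000)"
    unfolding eventually_at_top_linorder by blast
  \<comment> \<open>the constant \<open>sup_const\<close>, which depends on \<open>s\<close> only, but belongs to a locale with a fixed \<open>p\<close>\<close>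
  define sup_c where "sup_c = 4 + 5 * 2 ^ 11 * (8 * (real s + 1) + 4 ^ 8)"
  define K where "K = sup_c powr (7/3) * (6 * real s) powr (8/3) + 22 * real s"
  have K0: "K \<ge> 0" by (simp add: K_def)
  have "\<bar>real (T5 p s M (\<lambda>i. shifted_interval p (L i) N) a) - real N ^ 10 / real p\<bar>
      \<le> 160 * K * (real N ^ 10 / real p) * real p powr (- (1/1000))"
    if pr: "prime p" "p \<ge> p0" and N: "real N > real p powr (14 / 29 + \<epsilon>)"
      and M: "\<forall>i\<in>{1..5}. M i \<subseteq> Fp_star p \<and> card (M i) = N"
      and X: "\<forall>i\<in>{1..5}. shifted_interval p (L i) N \<subseteq> Fp_star p"
      and a: "a \<in> carrier (Fp p)" for p N M L a
  proof -
    have p3: "p \<ge> 3" using p0(1)[OF pr(2)] by (simp add: sufficiently_large_def)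
    interpret reciprocal_powers p s using pr p3 assms(1) by unfold_locales
    have one: "1 \<le> real p powr (193/400)" using p3 by (intro ge_one_powr_ge_zero) auto
    define n0 where "n0 = nat \<lfloor>real p powr (193/400)\<rfloor>"
    have n0: "real p powr (193/400) / 2 \<le> real n0" "real n0 \<le> real p powr (193/400)"
      unfolding n0_def using nat_floor_ge_half[OF one] by auto
    have n0_pos: "n0 > 0" using n0(1) one by (cases n0) auto
    have "real p powr (193/400) \<le> real p powr (14/29 + \<epsilon>)"
      using p3 assms(2) by (intro powr_mono) auto
    then have pN: "real p powr (193/400) \<le> real N" using N by linarith
    have "real n0 \<le> real N" using n0(2) pN by (rule order_trans)
    then have n0N: "n0 \<le> N" by (simp only: of_nat_le_iff)
    have moment: "(\<Sum>b\<in>{1..<int p}. norm (bilinear_sum (M i) (L i) N b) ^ 5)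
        \<le> 32 * (K * real p powr (-1/1000)) * (real (card (M i)) * real N) ^ 5" if i: "i \<in> {1..5}" for i
    proof (rule fifth_moment_long_le[OF _ _ n0_pos n0N])
      have Mi: "M i \<subseteq> {1..<int p}" "card (M i) = N" using M i Fp_star_eq by auto
      show "M i \<subseteq> {1..<int p}" by (rule Mi)
      show "\<not> int p dvd x" if "x \<in> {L i + 1..L i + int N}" for x
        using shifted_interval_facts(1)[of "L i" N] X i that by blast
      show "0 \<le> K * real p powr (-1/1000)" using K0 by simp
      fix k0 k assume k: "n0 \<le> k" "k < 2 * n0"
        and nd: "\<And>x. x \<in> {k0 + 1..k0 + int k} \<Longrightarrow> \<not> int p dvd x"
      interpret short_interval_sum p s "M i" k0 k "D p"
      proof unfold_locales
        show "sufficiently_large s (real p)" by (rule p0(1)[OF pr(2)])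
        show "harm p \<le> real p powr (1/2000)" by (rule p0(3)[OF pr(2)])
        have "real k < real (2 * n0)" using k(2) by (simp only: of_nat_less_iff)
        then have "real k < 2 * real n0" by simp
        then show k2: "real k \<le> 2 * real p powr (193/400)" using n0(2) by linarith
        show "real p powr (193/400) \<le> 2 * real k" using n0(1) k(1) by linarith
        show "real p powr (193/400) \<le> 2 * real (card (M i))" using Mi(2) pN by simp
        have "k \<le> p"
        proof -
          have "real p powr (193/400) \<le> real p powr (277/400)"
            using p3 by (intro powr_mono) auto
          moreover have "0 \<le> real p powr (277/400)" by simp
          ultimately have "2 * real p powr (193/400) \<le> 4 * real p powr (277/400)" by linarith
          also have "\<dots> < real p" using p0(1)[OF pr(2)] by (simp add: sufficiently_large_def)
          finally show ?thesis using k2 by simp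
        qed
        then have "harm k \<le> (harm p :: real)" by (rule harm_mono)
        then have "real (D p) * harm k \<le> real (D p) * harm p" by (intro mult_left_mono) auto
        also have "\<dots> \<le> real p powr (1/2000)" by (rule p0(2)[OF pr(2)])
        finally show "real (D p) * harm k \<le> real p powr (1/2000)" .
      qed (use Mi nd D in auto)
      show "(\<Sum>b\<in>{1..<int p}. norm (bilinear_sum (M i) k0 k b) ^ 5)
          \<le> K * real p powr (-1/1000) * (real (card (M i)) * real k) ^ 5"
        using fifth_moment_short_le by (simp only: K_def sup_c_def sup_const_def)
    qed
    have "\<bar>real (T5 p s M (\<lambda>i. shifted_interval p (L i) N) a) - real N ^ 10 / real p\<bar>
      \<le> 5 * (32 * (K * real p powr (-1/1000)) * (real N * real N) ^ 5) / real p"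
    proof (rule T5_error_le)
      fix i :: nat assume i: "i \<in> {1..5}"
      show "(\<Sum>b\<in>{1..<int p}. norm (bilinear_sum (M i) (L i) N b) ^ 5)
          \<le> 32 * (K * real p powr (-1/1000)) * (real N * real N) ^ 5"
        using moment[OF i] M i by simp
    qed (use M X a in auto)
    also have "\<dots> = 160 * K * (real N ^ 10 / real p) * real p powr (- (1/1000))"
      by (simp add: power_mult_distrib flip: power_add)
    finally show ?thesis .
  qed
  then show ?thesis by (intro exI[of _ "1/1000 :: real"] conjI exI[of _ "160 * K"] exI[of _ p0]) auto
qed

end
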